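(* Let $S$ be a closed (no boundary) orientable surface of genus $g \geq 2$ with $p \geq 3$ punctures (interior marked points). Then there exists an ideal triangulation $T$ of $S$ such that the quiver $Q_T$ associated to $T$ has a maximal green sequence.
   Context: A quiver is a finite directed graph with no loops and no 2-cycles. For an ideal triangulation $T$ of a marked surface (in the sense of Fomin–Shapiro–Thurston), the associated quiver $Q_T$ has one vertex for each arc of $T$; for each ideal triangle of $T$ and each pair of its sides that are arcs of $T$ and that follow one another in clockwise order, one draws an arrow between the corresponding vertices (with the usual Fomin–Shapiro–Thurston convention for self-folded triangles), and then all 2-cycles are cancelled. Mutation: for a quiver with a set of frozen vertices and a non-frozen vertex $k$, the mutation $\mu_k$ (1) adds an arrow $i\to j$ for every 2-path $i \to k \to j$, (2) reverses all arrows incident to $k$, (3) deletes a maximal collection of 2-cycles created and any arrows between frozen vertices. Mutation at frozen vertices is not allowed. The framed quiver $\hat Q$ of $Q$ has vertex set $Q_0 \sqcup \{i' : i \in Q_0\}$ (the $i'$ frozen) and arrows those of $Q$ together with $i \to i'$ for each $i \in Q_0$. In a quiver $R$ obtained from $\hat Q$ by mutations, a non-frozen vertex $i$ is green if there is no arrow $j' \to i$ from a frozen vertex, and red if there is no arrow $i \to j'$ to a frozen vertex. A green sequence for $Q$ is a sequence $i_1,\dots,i_l$ of vertices of $Q$ such that $i_1$ is green in $\hat Q$ and each $i_k$ is green in $\mu_{i_{k-1}}\circ\cdots\circ\mu_{i_1}(\hat Q)$; it is maximal if every non-frozen vertex of $\mu_{i_l}\circ\cdots\circ\mu_{i_1}(\hat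 Q)$ is red. *)

theory Defs
  imports "HOL-Analysis.Analysis"
begin

section \<open>Closed orientable surfaces\<close>

definition closed_surface :: "'a topology \<Rightarrow> bool" where
  "closed_surface X \<longleftrightarrow>
     compact_space X \<and> connected_space X \<and> Hausdorff_space X \<and>
     (\<forall>x \<in> topspace X. \<exists>U. openin X U \<and> x \<in> U \<and>
        subtopology X U homeomorphic_space (euclidean :: complex topology))"

definition polygon_vertex :: "nat \<Rightarrow> nat \<Rightarrow> complex" where
  "polygon_vertex g k = cis (2 * pi * real k / real (4 * g))"

definition polygon :: "nat \<Rightarrow> complex set" where
  "polygon g = convex hull (polygon_vertex g ` {..<4 * g})"

text \<open>
  The edge identifications of the \<open>4g\<close>-gon with boundary word
  \<open>a\<^sub>1 b\<^sub>1 a\<^sub>1\<^sup>-\<^sup>1 b\<^sub>1\<^sup>-\<^sup>1 \<dots> a\<^sub>g b\<^sub>g a\<^sub>g\<^sup>-\<^sup>1 b\<^sub>g\<^sup>-\<^sup>1\<close>: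
  for \<open>k mod 4 \<in> {0, 1}\<close>, the edge from vertex \<open>k\<close> to vertex \<open>k + 1\<close> is glued to the edge
  from vertex \<open>k + 3\<close> to vertex \<open>k + 2\<close>.
\<close>

definition edge_glue :: "nat \<Rightarrow> complex \<Rightarrow> complex \<Rightarrow> bool" where
  "edge_glue g x y \<longleftrightarrow>
     (\<exists>k < 4 * g. k mod 4 \<in> {0, 1} \<and>
        (\<exists>u \<in> {0..1}.
           x = linepath (polygon_vertex g k) (polygon_vertex g (k + 1)) u \<and>
           y = linepath (polygon_vertex g (k + 3)) (polygon_vertex g (k + 2)) u))"

text \<open>
  The closed orientable surface of genus \<open>g \<ge> 1\<close>, up to homeomorphism: a closed surface that
  is the quotient of the \<open>4g\<close>-gon by the identifications above.
\<close>

definition closed_orientable_surface_of_genus :: "nat \<Rightarrow> 'a topology \<Rightarrow> bool" where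
  "closed_orientable_surface_of_genus g X \<longleftrightarrow>
     closed_surface X \<and>
     (\<exists>q. quotient_map (top_of_set (polygon g)) X q \<and>
        (\<forall>x \<in> polygon g. \<forall>y \<in> polygon g. q x = q y \<longleftrightarrow> equivclp (edge_glue g) x y))"


section \<open>Ideal triangulations\<close>

text \<open>
  The corners \<open>0, 1, 2\<close> of the model triangle are in counterclockwise order, and the index is
  periodic modulo 3. Side \<open>s\<close> runs from corner \<open>s\<close> to corner \<open>s + 1\<close>, so side
  \<open>s + 1\<close> follows side \<open>s\<close> in counterclockwise order, and side \<open>s\<close> follows side \<open>s + 1\<close>
  in clockwise order.
\<close>

definition corner :: "nat \<Rightarrow> complex" where
  "corner s = cis (2 * pi * real s / 3)"

definition model_triangle :: "complex set" where
  "model_triangle = convex hull (corner ` {..<3})"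

definition side :: "nat \<Rightarrow> complex set" where
  "side s = closed_segment (corner s) (corner (Suc s))"

definition open_side :: "nat \<Rightarrow> complex set" where
  "open_side s = open_segment (corner s) (corner (Suc s))"

text \<open>
  An ideal triangulation of the surface \<open>X\<close> with set of punctures \<open>M\<close> is given by the
  characteristic maps of its ideal triangles, one map from the model triangle onto each closed
  ideal triangle. The arcs are the images of the sides. They have their endpoints in \<open>M\<close>, are
  otherwise simple, disjoint from \<open>M\<close> and pairwise disjoint, and they cut \<open>X\<close> into the open
  ideal triangles. Nothing forces the three corners, or the three sides, of an ideal triangle to
  be distinct in \<open>X\<close>, so loops and self-folded triangles are allowed.

  The last clause says that whenever two sides give the same arc, they run through it in opposite
  directions (and, by choice of the parametrisations, at the same speed). This means that the
  characteristic maps are all orientation preserving for one orientation of \<open>X\<close>; it is this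
  orientation to which ``clockwise'' refers. As \<open>(\<phi>, s)\<close> and \<open>(\<psi>, t)\<close> may be two sides of
  the same triangle, the clause covers self-folded triangles as well.
\<close>

definition ideal_triangulation ::
    "'a topology \<Rightarrow> 'a set \<Rightarrow> (complex \<Rightarrow> 'a) set \<Rightarrow> bool" where
  "ideal_triangulation X M T \<longleftrightarrow>
     finite T \<and>
     (\<forall>\<phi> \<in> T. continuous_map (top_of_set model_triangle) X \<phi>) \<and>
     (\<Union>\<phi> \<in> T. \<phi> ` model_triangle) = topspace X \<and>
     (\<forall>\<phi> \<in> T. \<forall>s < 3. \<phi> (corner s) \<in> M) \<and>
     (\<forall>\<phi> \<in> T. \<forall>s < 3. inj_on \<phi> (open_side s) \<and> \<phi> ` open_side s \<inter> M = {}) \<and>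
     (\<forall>\<phi> \<in> T. inj_on \<phi> (interior model_triangle) \<and> \<phi> ` interior model_triangle \<inter> M = {}) \<and>
     (\<forall>\<phi> \<in> T. \<forall>\<psi> \<in> T. \<phi> \<noteq> \<psi> \<longrightarrow>
        \<phi> ` interior model_triangle \<inter> \<psi> ` interior model_triangle = {}) \<and>
     (\<forall>\<phi> \<in> T. \<forall>\<psi> \<in> T. \<forall>s < 3.
        \<phi> ` interior model_triangle \<inter> \<psi> ` open_side s = {}) \<and>
     (\<forall>\<phi> \<in> T. \<forall>\<psi> \<in> T. \<forall>s < 3. \<forall>t < 3.
        (\<phi>, s) \<noteq> (\<psi>, t) \<and> \<phi> ` open_side s \<inter> \<psi> ` open_side t \<noteq> {} \<longrightarrow>
        (\<forall>u \<in> {0..1}.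
           \<phi> (linepath (corner s) (corner (Suc s)) u) =
           \<psi> (linepath (corner (Suc t)) (corner t) u)))"

definition arc_of :: "(complex \<Rightarrow> 'a) \<Rightarrow> nat \<Rightarrow> 'a set" where
  "arc_of \<phi> s = \<phi> ` side s"

definition arcs :: "(complex \<Rightarrow> 'a) set \<Rightarrow> 'a set set" where
  "arcs T = {arc_of \<phi> s | \<phi> s. \<phi> \<in> T \<and> s < 3}"

definition folded_at :: "(complex \<Rightarrow> 'a) \<Rightarrow> nat \<Rightarrow> bool" where
  "folded_at \<phi> s \<longleftrightarrow> arc_of \<phi> s = arc_of \<phi> (Suc s)"

definition self_folded :: "(complex \<Rightarrow> 'a) \<Rightarrow> bool" where
  "self_folded \<phi> \<longleftrightarrow> (\<exists>s < 3. folded_at \<phi> s)"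

text \<open>
  The Fomin--Shapiro--Thurston map on arcs: the folded side of a self-folded triangle is sent to
  the loop enclosing it (the remaining side of that triangle), and every other arc to itself.
\<close>

definition fst_label :: "(complex \<Rightarrow> 'a) set \<Rightarrow> 'a set \<Rightarrow> 'a set" where
  "fst_label T a =
     (if \<exists>\<phi> \<in> T. \<exists>s < 3. folded_at \<phi> s \<and> arc_of \<phi> s = a
      then THE b. \<exists>\<phi> \<in> T. \<exists>s < 3. folded_at \<phi> s \<and> arc_of \<phi> s = a \<and> b = arc_of \<phi> (s + 2)
      else a)"


section \<open>Quivers and mutation\<close>

text \<open>
  \<open>arrows Q i j\<close> is the number of arrows from \<open>i\<close> to \<open>j\<close>.
\<close>

record 'v quiver =
  verts :: "'v set"
  frozen :: "'v set"
  arrows :: "'v \<Rightarrow> 'v \<Rightarrow> nat"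

definition is_quiver :: "'v quiver \<Rightarrow> bool" where
  "is_quiver Q \<longleftrightarrow>
     finite (verts Q) \<and> frozen Q \<subseteq> verts Q \<and>
     (\<forall>i j. arrows Q i j > 0 \<longrightarrow> i \<in> verts Q \<and> j \<in> verts Q) \<and>
     (\<forall>i. arrows Q i i = 0) \<and>
     (\<forall>i j. arrows Q i j = 0 \<or> arrows Q j i = 0)"

definition cancel_2_cycles :: "('v \<Rightarrow> 'v \<Rightarrow> nat) \<Rightarrow> 'v \<Rightarrow> 'v \<Rightarrow> nat" where
  "cancel_2_cycles a i j = a i j - min (a i j) (a j i)"

definition add_2_paths :: "'v \<Rightarrow> ('v \<Rightarrow> 'v \<Rightarrow> nat) \<Rightarrow> 'v \<Rightarrow> 'v \<Rightarrow> nat" where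
  "add_2_paths k a i j = a i j + a i k * a k j"

definition reverse_at :: "'v \<Rightarrow> ('v \<Rightarrow> 'v \<Rightarrow> nat) \<Rightarrow> 'v \<Rightarrow> 'v \<Rightarrow> nat" where
  "reverse_at k a i j = (if i = k \<or> j = k then a j i else a i j)"

definition delete_within :: "'v set \<Rightarrow> ('v \<Rightarrow> 'v \<Rightarrow> nat) \<Rightarrow> 'v \<Rightarrow> 'v \<Rightarrow> nat" where
  "delete_within F a i j = (if i \<in> F \<and> j \<in> F then 0 else a i j)"

definition mutate :: "'v \<Rightarrow> 'v quiver \<Rightarrow> 'v quiver" where
  "mutate k Q =
     Q\<lparr>arrows := delete_within (frozen Q)
        (cancel_2_cycles (reverse_at k (add_2_paths k (arrows Q))))\<rparr>"

lemma is_quiver_mutate: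
  assumes "is_quiver Q" "k \<in> verts Q - frozen Q"
  shows "is_quiver (mutate k Q)"
  unfolding is_quiver_def
proof (intro conjI allI impI)
  show "finite (verts (mutate k Q))" "frozen (mutate k Q) \<subseteq> verts (mutate k Q)"
    using assms by (simp_all add: is_quiver_def mutate_def)
next
  fix i j
  assume "arrows (mutate k Q) i j > 0"
  then have "reverse_at k (add_2_paths k (arrows Q)) i j > 0"
    by (auto simp: mutate_def delete_within_def cancel_2_cycles_def split: if_splits)
  then have "i = k \<or> j = k \<or> arrows Q i j > 0 \<or> arrows Q i k > 0 \<and> arrows Q k j > 0"
    and "i = k \<or> j = k \<Longrightarrow> arrows Q j i > 0 \<or> arrows Q j k > 0 \<and> arrows Q k i > 0"
    by (auto simp: reverse_at_def add_2_paths_def split: if_splits)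
  then show "i \<in> verts (mutate k Q)" "j \<in> verts (mutate k Q)"
    using assms unfolding is_quiver_def mutate_def by auto
next
  fix i j
  show "arrows (mutate k Q) i i = 0"
    by (simp add: mutate_def delete_within_def cancel_2_cycles_def)
  show "arrows (mutate k Q) i j = 0 \<or> arrows (mutate k Q) j i = 0"
    by (auto simp: mutate_def delete_within_def cancel_2_cycles_def min_def)
qed

text \<open>
  In the framed quiver, the vertex \<open>i\<close> is \<open>Inl i\<close> and its frozen copy \<open>i'\<close> is \<open>Inr i\<close>.
\<close>

definition framed :: "'v quiver \<Rightarrow> ('v + 'v) quiver" where
  "framed Q =
     \<lparr>verts = Inl ` verts Q \<union> Inr ` verts Q,
      frozen = Inr ` verts Q,
      arrows = (\<lambda>x y. case (x, y) of
          (Inl i, Inl j) \<Rightarrow> arrows Q i j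
        | (Inl i, Inr j) \<Rightarrow> if i = j \<and> i \<in> verts Q then 1 else 0
        | (Inr i, _) \<Rightarrow> 0)\<rparr>"

definition green :: "'v quiver \<Rightarrow> 'v \<Rightarrow> bool" where
  "green R i \<longleftrightarrow> i \<in> verts R - frozen R \<and> (\<forall>j \<in> frozen R. arrows R j i = 0)"

definition red :: "'v quiver \<Rightarrow> 'v \<Rightarrow> bool" where
  "red R i \<longleftrightarrow> i \<in> verts R - frozen R \<and> (\<forall>j \<in> frozen R. arrows R i j = 0)"

definition mutated_framed :: "'v quiver \<Rightarrow> 'v list \<Rightarrow> ('v + 'v) quiver" where
  "mutated_framed Q ks = fold mutate (map Inl ks) (framed Q)"

definition green_sequence :: "'v quiver \<Rightarrow> 'v list \<Rightarrow> bool" where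
  "green_sequence Q ks \<longleftrightarrow>
     (\<forall>m < length ks. green (mutated_framed Q (take m ks)) (Inl (ks ! m)))"

definition maximal_green_sequence :: "'v quiver \<Rightarrow> 'v list \<Rightarrow> bool" where
  "maximal_green_sequence Q ks \<longleftrightarrow>
     green_sequence Q ks \<and>
     (\<forall>x \<in> verts (mutated_framed Q ks) - frozen (mutated_framed Q ks).
        red (mutated_framed Q ks) x)"


section \<open>The quiver of an ideal triangulation\<close>

text \<open>
  One arrow from \<open>a\<close> to \<open>b\<close> for each ideal triangle that is not self-folded and each side
  \<open>fst_label T b\<close> of it that follows its side \<open>fst_label T a\<close> in clockwise order.
\<close>

definition triangle_arrows ::
    "(complex \<Rightarrow> 'a) set \<Rightarrow> 'a set \<Rightarrow> 'a set \<Rightarrow> nat" where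
  "triangle_arrows T a b =
     card {(\<phi>, s). \<phi> \<in> T \<and> \<not> self_folded \<phi> \<and> s < 3 \<and>
        arc_of \<phi> (Suc s) = fst_label T a \<and> arc_of \<phi> s = fst_label T b}"

definition triangulation_quiver :: "(complex \<Rightarrow> 'a) set \<Rightarrow> 'a set quiver" where
  "triangulation_quiver T =
     \<lparr>verts = arcs T,
      frozen = {},
      arrows = (\<lambda>a b. if a \<in> arcs T \<and> b \<in> arcs T
                      then cancel_2_cycles (triangle_arrows T) a b else 0)\<rparr>"

lemma is_quiver_triangulation_quiver:
  assumes "finite T"
  shows "is_quiver (triangulation_quiver T)"
proof -
  have "arcs T = (\<lambda>(\<phi>, s). arc_of \<phi> s) ` (T \<times> {..<3})"
    by (auto simp: arcs_def)
  then have "finite (arcs T)"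
    using assms by simp
  then show ?thesis
    by (auto simp: is_quiver_def triangulation_quiver_def cancel_2_cycles_def min_def)
qed

lemma is_quiver_framed:
  assumes "is_quiver Q"
  shows "is_quiver (framed Q)"
  using assms by (auto simp: is_quiver_def framed_def split: sum.splits if_splits)

end

theory Submission
  imports Defs
begin

text \<open>
  Divide one side of the \<open>4g\<close>-gon, and the side glued to it, by \<open>p - 2\<close> punctures, put another
  puncture at the vertices, and let \<open>T\<close> be the cone over the resulting \<open>n\<close>-gon from the last
  puncture, at the centre. Its quiver consists of the 3-cycles through spoke \<open>k\<close>, spoke \<open>k + 1\<close> and
  the outer arc \<open>k\<close>, where the outer arcs \<open>k\<close> and \<open>\<tau> k\<close> agree for the side pairing \<open>\<tau>\<close>.

  A maximal green sequence corresponds to switching the tags at all punctures. Sweeping back and forth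
  through the oriented cycle of all spokes switches them at the centre. Flipping all outer arcs then
  makes the spokes into disjoint oriented cycles, one around each other puncture; sweeping through
  these and flipping the outer arcs again finishes. All c-vectors on the way are explicit. The argument
  only needs that no two neighbouring sides of the \<open>n\<close>-gon are glued to each other.

  The punctures can be prescribed because any two finite sets of points of the same size are related
  by a homeomorphism of the surface: push them off the image of the boundary of the polygon by
  homeomorphisms supported in charts, then move them inside the polygon.
\<close>

section \<open>Exchange matrices and sweeps along oriented cycles\<close>

text \<open>The two flips of the outer arcs are there because, in the cone itself, the arcs at an
  outer puncture are spokes and outer arcs together, and an outer arc has both ends at outer
  punctures, so the oriented cycles around different punctures overlap. Flipping outer arc
  \<open>k\<close> replaces it by an arc from the centre to itself. After that every spoke has
  exactly one end at an outer puncture, the cycles are disjoint, and their sweeps do not interfere.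
  The centre is swept before the flips, while it meets only spokes. Two neighbouring sides glued to
  each other would produce an outer puncture with a single spoke, around which there is no cycle.

  Tagged arcs never appear in the formal argument. A sweep returns the exchange matrix to itself up
  to a permutation of the vertices, so it is enough to carry the matrix, the c-vectors and a current
  labelling \<open>X\<close> of the spokes.\<close>

definition skew :: "('v \<Rightarrow> 'v \<Rightarrow> int) \<Rightarrow> bool" where
  "skew b \<longleftrightarrow> (\<forall>i j. b i j = - b j i)"

text \<open>Entries count arrows with sign, so cancelling 2-cycles needs no separate operation: the
  two products count the paths through \<open>k\<close> from \<open>i\<close> to \<open>j\<close>
  and from \<open>j\<close> to \<open>i\<close>.\<close>

definition mutB :: "'v \<Rightarrow> ('v \<Rightarrow> 'v \<Rightarrow> int) \<Rightarrow> 'v \<Rightarrow> 'v \<Rightarrow> int" where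
  "mutB k b i j = (if i = k \<or> j = k then - b i j
     else b i j + max 0 (b i k) * max 0 (b k j) - max 0 (b j k) * max 0 (b k i))"

text \<open>The mutation rule for c-vectors, valid only at a green vertex \<open>k\<close>.\<close>

definition mutC :: "'v \<Rightarrow> ('v \<Rightarrow> 'v \<Rightarrow> int) \<Rightarrow> ('v \<Rightarrow> 'f \<Rightarrow> int) \<Rightarrow> 'v \<Rightarrow> 'f \<Rightarrow> int" where
  "mutC k b c i f = (if i = k then - c k f else c i f + max 0 (b i k) * c k f)"

text \<open>The nonnegativity of the row \<open>c k\<close> is greenness of \<open>k\<close>, and it
  is the condition under which \<open>mutC\<close> is the correct rule. The end state is part of the
  relation and the start state is arbitrary, so that runs can be concatenated.\<close>

inductive green_run ::
  "'v set \<Rightarrow> ('v \<Rightarrow> 'v \<Rightarrow> int) \<Rightarrow> ('v \<Rightarrow> 'f \<Rightarrow> int) \<Rightarrow> 'v list \<Rightarrow>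
     ('v \<Rightarrow> 'v \<Rightarrow> int) \<Rightarrow> ('v \<Rightarrow> 'f \<Rightarrow> int) \<Rightarrow> bool" for V where
  green_run_Nil: "green_run V b c [] b c"
| green_run_Cons: "k \<in> V \<Longrightarrow> \<forall>f. 0 \<le> c k f \<Longrightarrow> green_run V (mutB k b) (mutC k b c) ks b' c'
    \<Longrightarrow> green_run V b c (k # ks) b' c'"

lemma green_run_append:
  assumes "green_run V b c ks b' c'" "green_run V b' c' ls b'' c''"
  shows "green_run V b c (ks @ ls) b'' c''"
  using assms by (induction rule: green_run.induct) (auto intro: green_run_Cons)

lemma green_run_single:
  assumes "k \<in> V" "\<forall>f. 0 \<le> c k f"
  shows "green_run V b c [k] (mutB k b) (mutC k b c)"
  using assms by (auto intro: green_run.intros)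

lemma skewD: "skew b \<Longrightarrow> b i j = - b j i"
  unfolding skew_def by blast

lemma skew_mutB:
  assumes "skew b" shows "skew (mutB k b)"
  unfolding skew_def
proof (intro allI)
  fix i j
  show "mutB k b i j = - mutB k b j i"
    unfolding mutB_def skewD[OF assms, of i j] by simp
qed

lemma mutB_mutB:
  assumes "skew b" shows "mutB k (mutB k b) = b"
proof (intro ext)
  fix i j
  have "b k i = - b i k" "b j k = - b k j"
    by (rule skewD[OF assms])+
  then show "mutB k (mutB k b) i j = b i j"
    by (simp add: mutB_def max_def)
qed

definition cyc_pred :: "nat \<Rightarrow> nat \<Rightarrow> nat" where
  "cyc_pred d j = (if j = 0 then d - 1 else j - 1)"

definition cyc_succ :: "nat \<Rightarrow> nat \<Rightarrow> nat" where
  "cyc_succ d j = (if Suc j = d then 0 else Suc j)"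

text \<open>Two vertices with opposite rows, such as the two arcs at a puncture of degree 2: mutating at
  both of them exchanges their roles.\<close>

lemma sweep_pair:
  fixes u v s t :: 'v and c :: "'v \<Rightarrow> 'f \<Rightarrow> int"
  defines "b2 \<equiv> \<lambda>b. mutB v (mutB u b)" and "c2 \<equiv> \<lambda>b c. mutC v (mutB u b) (mutC u b c)"
  assumes "u \<noteq> v" "s \<noteq> t" "{s, t} \<inter> {u, v} = {}" "u \<in> V" "v \<in> V" "skew b"
    and bu: "\<And>z. b z u = of_bool (z = s) - of_bool (z = t)"
    and bv: "\<And>z. b z v = of_bool (z = t) - of_bool (z = s)"
    and "\<And>f. 0 \<le> c u f" "\<And>f. 0 \<le> c v f"
  shows "green_run V b c [u, v] (b2 b) (c2 b c)"
    and "b2 b (Transposition.transpose u v i) (Transposition.transpose u v j) = b i j"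
    and "c2 b c u f = - c u f" and "c2 b c v f = - c v f"
    and "z \<notin> {u, v} \<Longrightarrow> c2 b c z f = c z f + of_bool (s = z) * c u f + of_bool (t = z) * c v f"
proof -
  have sk: "b i j = - b j i" for i j by (rule skewD[OF assms(8)])
  have bu': "b u z = of_bool (z = t) - of_bool (z = s)" for z
    using sk[of u z] bu[of z] by simp
  have bv': "b v z = of_bool (z = s) - of_bool (z = t)" for z
    using sk[of v z] bv[of z] by simp
  have d: "s \<noteq> u" "s \<noteq> v" "t \<noteq> u" "t \<noteq> v" using assms(5) by auto
  note d' = d d[symmetric] assms(3,4) assms(3,4)[symmetric]
  have c1: "mutC u b c v f = c v f" for f
    using d' by (simp add: mutC_def bu)
  have v1: "mutB u b z v = b z v" for z
    using d' by (simp add: mutB_def bu bv bu' bv')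
  show "green_run V b c [u, v] (b2 b) (c2 b c)"
    unfolding b2_def c2_def using assms by (auto intro!: green_run.intros simp: c1)
  show "c2 b c u f = - c u f" "c2 b c v f = - c v f"
    "z \<notin> {u, v} \<Longrightarrow> c2 b c z f = c z f + of_bool (s = z) * c u f + of_bool (t = z) * c v f"
    unfolding c2_def using d' by (auto simp add: mutC_def v1 bu bv)
  have m1: "mutB u b u z = - b u z" "mutB u b v z = b v z" for z
    using d' by (simp_all add: mutB_def bu bv bu' bv')
  have mx: "max 0 (of_bool (i = s) - of_bool (i = t)) = (of_bool (i = s) :: int)"
    "max 0 (of_bool (i = t) - of_bool (i = s)) = (of_bool (i = t) :: int)" for i
    using assms(4) by (auto simp: of_bool_def)
  \<comment> \<open>The path \<open>s\<close>, \<open>u\<close>, \<open>t\<close> and the path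
    \<open>t\<close>, \<open>v\<close>, \<open>s\<close> create opposite arrows between
    \<open>s\<close> and \<open>t\<close>, which cancel. All that remains is the change of sign in
    the rows and columns of \<open>u\<close> and \<open>v\<close>, and exchanging \<open>u\<close>
    and \<open>v\<close> undoes it, since their rows are opposite.\<close>
  have b2: "b2 b i j = (if i = u \<or> i = v \<or> j = u \<or> j = v then - b i j else b i j)" for i j
  proof -
    consider "i = v" | "j = v" | "i \<noteq> v" "j \<noteq> v" "i = u" | "i \<noteq> v" "j \<noteq> v" "j = u"
      | "i \<notin> {u, v}" "j \<notin> {u, v}" by blast
    then show ?thesis
    proof cases
      case 5
      then have "b2 b i j = mutB u b i j + of_bool (i = t) * of_bool (j = s) - of_bool (j = t) * of_bool (i = s)"
        unfolding b2_def by (simp add: mutB_def[of v] v1 m1 bv bv' mx)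
      moreover have "mutB u b i j = b i j + of_bool (i = s) * of_bool (j = t) - of_bool (j = s) * of_bool (i = t)"
        using 5 by (simp add: mutB_def bu bu' mx)
      ultimately show ?thesis using 5 by simp
    next
      case 3
      then have "b2 b i j = - b u j + max 0 (mutB u b u v) * max 0 (mutB u b v j) - max 0 (mutB u b j v) * max 0 (mutB u b v u)"
        unfolding b2_def using d' by (simp add: mutB_def[of v] m1)
      then show ?thesis using 3 d' by (simp add: v1 m1 bu bv bv' bu')
    next
      case 4
      then have "b2 b i j = mutB u b i u + max 0 (mutB u b i v) * max 0 (mutB u b v u) - max 0 (mutB u b u v) * max 0 (mutB u b v i)"
        unfolding b2_def using d' by (simp add: mutB_def[of v])
      moreover have "mutB u b i u = - b i u" by (simp add: mutB_def)
      ultimately show ?thesis using 4 d' by (simp add: v1 m1 bu bv bv' bu')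
    qed (simp_all add: b2_def mutB_def[of v] v1 m1)
  qed
  have T: "Transposition.transpose u v k = (if k = u then v else if k = v then u else k)" for k
    by (simp add: Transposition.transpose_def)
  show "b2 b (Transposition.transpose u v i) (Transposition.transpose u v j) = b i j"
    unfolding b2 T using d' by (auto simp: bu bu' bv bv')
qed

lemma mutB_relabel:
  assumes "\<And>i j. b' (p i) (p j) = b i j" "p k = k" "inj p"
  shows "mutB k b' (p i) (p j) = mutB k b i j"
proof -
  have "p i = k \<longleftrightarrow> i = k" "p j = k \<longleftrightarrow> j = k"
    using assms(2,3) by (metis injD)+
  moreover have "b' (p i) k = b i k" "b' k (p j) = b k j" "b' (p j) k = b j k" "b' k (p i) = b k i"
    using assms(1)[of i k] assms(1)[of k j] assms(1)[of j k] assms(1)[of k i] assms(2) by simp_all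
  ultimately show ?thesis by (simp add: mutB_def assms(1))
qed

text \<open>The vertices \<open>x 0, \<dots>, x (d - 1)\<close> form an oriented cycle, such as the arcs at a puncture, and
  \<open>w j\<close> completes the arrow from \<open>x j\<close> to \<open>x (j + 1)\<close> to a triangle. Mutating at \<open>x 0\<close> leaves a
  cycle of length \<open>d - 1\<close>; sweep through it and mutate at \<open>x 0\<close> again. As mutation is an
  involution, the matrix returns to itself up to the transposition from the case \<open>d = 2\<close>.\<close>

lemma sweep:
  fixes x w :: "nat \<Rightarrow> 'v" and c :: "'v \<Rightarrow> 'f \<Rightarrow> int"
  assumes "2 \<le> d" "inj_on x {..<d}" "x ` {..<d} \<subseteq> V" "\<And>j. j < d \<Longrightarrow> w j \<notin> x ` {..<d}"
    and "w 0 \<noteq> w (d - 1)" "skew b"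
    and "\<And>j z. j < d \<Longrightarrow> b z (x j) =
          of_bool (z = x (cyc_pred d j)) + of_bool (z = w j)
          - of_bool (z = x (cyc_succ d j)) - of_bool (z = w (cyc_pred d j))"
    and "\<And>j f. j < d \<Longrightarrow> 0 \<le> c (x j) f"
  shows "\<exists>ks b' c' p. green_run V b c ks b' c' \<and> skew b' \<and> p permutes (x ` {..<d}) \<and>
     (\<forall>i j. b' (p i) (p j) = b i j) \<and>
     (\<forall>j<d. \<forall>f. c' (p (x j)) f = - c (x (cyc_pred d j)) f) \<and>
     (\<forall>z f. z \<notin> x ` {..<d} \<longrightarrow>
        c' z f = c z f + (\<Sum>j<d. of_bool (w j = z) * c (x j) f))"
  using assms
proof (induction d arbitrary: x w b c rule: nat_induct_at_least)
  case base
  let ?p = "Transposition.transpose (x 0) (x 1)"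
  have x: "x 0 \<noteq> x 1" using inj_onD[OF base(1), of 0 1] by auto
  have set: "x ` {..<2} = {x 0, x 1}" by (auto simp: numeral_2_eq_2 lessThan_Suc)
  have w: "w 0 \<noteq> w 1" "w 0 \<noteq> x 0" "w 0 \<noteq> x 1" "w 1 \<noteq> x 0" "w 1 \<noteq> x 1"
    using base(3)[of 0] base(3)[of 1] base(4) unfolding set by auto
  have "b z (x 0) = of_bool (z = w 0) - of_bool (z = w 1)"
    "b z (x 1) = of_bool (z = w 1) - of_bool (z = w 0)" for z
    using base(6)[of 0 z] base(6)[of 1 z] by (simp_all add: cyc_pred_def cyc_succ_def)
  note b = this
  have V: "x 0 \<in> V" "x 1 \<in> V" "{w 0, w 1} \<inter> {x 0, x 1} = {}"
    using base(2) w by (auto simp: set)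
  have pos: "0 \<le> c (x 0) f" "0 \<le> c (x 1) f" for f
    using base(7)[of 0] base(7)[of 1] by simp_all
  note * = sweep_pair[OF x w(1) V(3,1,2) base(5) b pos]
  let ?b = "mutB (x 1) (mutB (x 0) b)" let ?c = "mutC (x 1) (mutB (x 0) b) (mutC (x 0) b c)"
  show ?case
  proof (intro exI conjI allI impI)
    show "green_run V b c [x 0, x 1] ?b ?c" by (fact *(1))
    show "skew ?b" using base(5) by (simp add: skew_mutB)
    show "?p permutes (x ` {..<2})"
      unfolding set by (simp add: permutes_swap_id)
    show "?b (?p i) (?p j) = b i j" for i j
      by (fact *(2))
    show "?c (?p (x j)) f = - c (x (cyc_pred 2 j)) f" if "j < 2" for j f
    proof -
      consider "j = 0" | "j = 1" using \<open>j < 2\<close> by linarith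
      then show ?thesis
        by cases (simp_all only: cyc_pred_def transpose_apply_first transpose_apply_second *(3,4) if_True if_False simp_thms one_neq_zero diff_self_eq_0 one_add_one[symmetric] add_diff_cancel_right')
    qed
    show "?c z f = c z f + (\<Sum>j<2. of_bool (w j = z) * c (x j) f)"
      if "z \<notin> x ` {..<2}" for z f
    proof -
      have "(\<Sum>j<2. of_bool (w j = z) * c (x j) f) = of_bool (w 0 = z) * c (x 0) f + of_bool (w 1 = z) * c (x 1) f"
        by (simp add: numeral_2_eq_2)
      then show ?thesis using that unfolding set by (subst *(5)) simp_all
    qed
  qed
next
  case (Suc d)
  define y where "y j = x (Suc j)" for j
  \<comment> \<open>Mutation at \<open>x 0\<close> creates the arrow from \<open>x d\<close> to
    \<open>x 1\<close> that closes the shorter cycle, with \<open>x 0\<close> itself as the third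
    vertex of the new triangle. The other triangles keep theirs.\<close>
  define v where "v j = (if j = d - 1 then x 0 else w (Suc j))" for j
  define b1 where "b1 = mutB (x 0) b"
  define c1 where "c1 = mutC (x 0) b c"
  have sk: "b i j = - b j i" for i j by (rule skewD[OF Suc.prems(5)])
  have inj: "x i = x j \<longleftrightarrow> i = j" if "i \<le> d" "j \<le> d" for i j
    using Suc.prems(1) that by (auto simp: inj_on_def)
  have wx: "w i \<noteq> x j" if "i \<le> d" "j \<le> d" for i j
    using Suc.prems(3)[of i] that by auto
  have w0d: "w 0 \<noteq> w d" using Suc.prems(4) by simp
  have col: "b z (x j) = of_bool (z = x (cyc_pred (Suc d) j)) + of_bool (z = w j)
          - of_bool (z = x (cyc_succ (Suc d) j)) - of_bool (z = w (cyc_pred (Suc d) j))"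
    if "j \<le> d" for z j using Suc.prems(6) that by simp
  have b0: "b z (x 0) = of_bool (z = x d) + of_bool (z = w 0) - of_bool (z = x 1) - of_bool (z = w d)" for z
    using col[of 0 z] Suc.hyps by (simp add: cyc_pred_def cyc_succ_def)
  have dist: "x d \<noteq> x 1" "x d \<noteq> w d" "w 0 \<noteq> x 1" "w 0 \<noteq> w d"
    using inj[of d 1] wx[of d d] wx[of 0 1] w0d Suc.hyps by auto
  have out0: "max 0 (b z (x 0)) = of_bool (z = x d) + of_bool (z = w 0)" for z
    unfolding b0 using dist wx[of 0 d] by auto
  have in0: "max 0 (b (x 0) z) = of_bool (z = x 1) + of_bool (z = w d)" for z
    unfolding sk[of "x 0" z] b0 using dist wx[of d 1] Suc.hyps by auto
  have bj0: "b (x (Suc j)) (x 0) = of_bool (j = d - 1) - of_bool (j = 0)" if "j < d" for j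
    unfolding b0 using that inj[of "Suc j" d] inj[of "Suc j" 1] wx[of 0 "Suc j"] wx[of d "Suc j"] by auto
  have b1_0: "b1 z (x 0) = - b z (x 0)" "b1 (x 0) z = - b (x 0) z" for z
    unfolding b1_def by (simp_all add: mutB_def)
  have c1: "c1 z f = (if z = x 0 then - c (x 0) f
      else c z f + (of_bool (z = x d) + of_bool (z = w 0)) * c (x 0) f)" for z f
    unfolding c1_def mutC_def out0 by simp
  have yx: "y ` {..<d} = x ` {1..d}"
    unfolding y_def image_image[symmetric, of x Suc] image_Suc_lessThan by simp
  have c1y: "c1 (y j) f = c (x (Suc j)) f + of_bool (j = d - 1) * c (x 0) f" if "j < d" for j f
    unfolding c1 y_def using that inj[of "Suc j" 0] inj[of "Suc j" d] wx[of 0 "Suc j"] by auto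
  have pos: "0 \<le> c (x j) f" if "j \<le> d" for j f using Suc.prems(7) that by simp
  have "\<exists>ks b' c' p. green_run V b1 c1 ks b' c' \<and> skew b' \<and> p permutes (y ` {..<d}) \<and>
     (\<forall>i j. b' (p i) (p j) = b1 i j) \<and>
     (\<forall>j<d. \<forall>f. c' (p (y j)) f = - c1 (y (cyc_pred d j)) f) \<and>
     (\<forall>z f. z \<notin> y ` {..<d} \<longrightarrow>
        c' z f = c1 z f + (\<Sum>j<d. of_bool (v j = z) * c1 (y j) f))"
  proof (rule Suc.IH)
    show "inj_on y {..<d}" unfolding y_def inj_on_def using inj by auto
    show "y ` {..<d} \<subseteq> V" unfolding yx using Suc.prems(2) by auto
    show "v j \<notin> y ` {..<d}" if "j < d" for j
      unfolding yx v_def using wx[of "Suc j"] inj[of 0] that by (auto simp: image_iff)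
    show "v 0 \<noteq> v (d - 1)" unfolding v_def using Suc.hyps wx[of 1 0] by auto
    show "skew b1" unfolding b1_def by (rule skew_mutB[OF Suc.prems(5)])
    show "0 \<le> c1 (y j) f" if "j < d" for j f
      unfolding c1y[OF that] using pos[of "Suc j" f] pos[of 0 f] that by simp
    show "b1 z (y j) = of_bool (z = y (cyc_pred d j)) + of_bool (z = v j)
          - of_bool (z = y (cyc_succ d j)) - of_bool (z = v (cyc_pred d j))" if j: "j < d" for j z
    proof (cases "z = x 0")
      case True
      have "b1 z (y j) = of_bool (j = d - 1) - of_bool (j = 0)"
        unfolding True b1_0 y_def sk[of "x 0"] bj0[OF j] by simp
      moreover have "x 0 \<noteq> y i" if "i < d" for i
        unfolding y_def using inj[of 0 "Suc i"] that by simp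
      moreover have "x 0 = v i \<longleftrightarrow> i = d - 1" if "i < d" for i
        unfolding v_def using wx[of "Suc i" 0] that by auto
      ultimately show ?thesis
        unfolding True using j Suc.hyps by (auto simp: cyc_pred_def cyc_succ_def)
    next
      case False
      have "b1 z (y j) = b z (x (Suc j)) + (of_bool (z = x d) + of_bool (z = w 0)) * max 0 (of_bool (j = 0) - of_bool (j = d - 1))
          - max 0 (of_bool (j = d - 1) - of_bool (j = 0)) * (of_bool (z = x 1) + of_bool (z = w d))"
        unfolding b1_def y_def mutB_def out0 in0 bj0[OF j] sk[of "x 0" "x (Suc j)"]
        using False inj[of "Suc j" 0] j by simp
      also have "\<dots> = b z (x (Suc j)) + (of_bool (z = x d) + of_bool (z = w 0)) * of_bool (j = 0)
          - of_bool (j = d - 1) * (of_bool (z = x 1) + of_bool (z = w d))"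
        using Suc.hyps by auto
      finally have *: "b1 z (y j) = b z (x (Suc j)) + (of_bool (z = x d) + of_bool (z = w 0)) * of_bool (j = 0)
          - of_bool (j = d - 1) * (of_bool (z = x 1) + of_bool (z = w d))" .
      have **: "b z (x (Suc j)) = of_bool (z = x j) + of_bool (z = w (Suc j))
          - of_bool (z = x (if j = d - 1 then 0 else Suc (Suc j))) - of_bool (z = w j)"
        using col[of "Suc j" z] j by (auto simp: cyc_pred_def cyc_succ_def)
      consider "j = 0" | "0 < j" "j < d - 1" | "0 < j" "j = d - 1" using j by linarith
      then show ?thesis
      proof cases
        case 1
        then show ?thesis unfolding * ** using False Suc.hyps
          by (simp add: cyc_pred_def cyc_succ_def y_def v_def)
      next
        case 2
        then obtain i where i: "j = Suc i" "Suc (Suc i) \<noteq> d" by (cases j) auto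
        show ?thesis unfolding * ** using False 2 i
          by (simp add: cyc_pred_def cyc_succ_def y_def v_def)
      next
        case 3
        then have "j = Suc (j - 1) \<and> d = Suc (Suc (j - 1))" by auto
        then obtain i where i: "j = Suc i" "d = Suc (Suc i)" by blast
        show ?thesis unfolding * ** using False
          by (simp add: cyc_pred_def cyc_succ_def y_def v_def i)
      qed
    qed
  qed
  then obtain ks b' c' p where run: "green_run V b1 c1 ks b' c'" and skb': "skew b'"
    and p: "p permutes (y ` {..<d})" and b': "\<And>i j. b' (p i) (p j) = b1 i j"
    and c'y: "\<And>j f. j < d \<Longrightarrow> c' (p (y j)) f = - c1 (y (cyc_pred d j)) f"
    and c'z: "\<And>z f. z \<notin> y ` {..<d} \<Longrightarrow>
        c' z f = c1 z f + (\<Sum>j<d. of_bool (v j = z) * c1 (y j) f)" by blast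
  have x0: "x 0 \<notin> y ` {..<d}"
  proof
    assume "x 0 \<in> y ` {..<d}"
    then obtain i where "1 \<le> i" "i \<le> d" "x 0 = x i" unfolding yx by auto
    then show False using inj[of 0 i] by auto
  qed
  have px0: "p (x 0) = x 0" using p x0 by (simp add: permutes_not_in)
  have injp: "inj p" using p by (rule permutes_inj)
  have x0V: "x 0 \<in> V" using Suc.prems(2) by auto
  \<comment> \<open>The last vertex \<open>x d\<close> of the shorter cycle carries
    \<open>c (x d) + c (x 0)\<close> and is the one attached to \<open>x 0\<close>, whose own
    c-vector is \<open>- c (x 0)\<close>. The sum is nonnegative, so \<open>x 0\<close> is green for
    the final mutation.\<close>
  have c'0: "c' (x 0) f = c (x d) f" for f
  proof -
    have "(\<Sum>j<d. of_bool (v j = x 0) * c1 (y j) f) = (\<Sum>j\<in>{d - 1}. of_bool (v j = x 0) * c1 (y j) f)"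
    proof (intro sum.mono_neutral_right ballI)
      fix i assume "i \<in> {..<d} - {d - 1}"
      then show "of_bool (v i = x 0) * c1 (y i) f = 0" unfolding v_def using wx[of "Suc i" 0] by auto
    qed (use Suc.hyps in auto)
    also have "\<dots> = c (x d) f + c (x 0) f"
      using Suc.hyps c1y[of "d - 1" f] by (simp add: v_def)
    finally show ?thesis unfolding c'z[OF x0] by (simp add: c1)
  qed
  let ?b = "mutB (x 0) b'" let ?c = "mutC (x 0) b' c'"
  have b'0: "max 0 (b' (p z) (x 0)) = of_bool (z = x 1) + of_bool (z = w d)" for z
    using b'[of z "x 0"] unfolding px0 b1_0 sk[of z "x 0"] in0[symmetric] by simp
  have c_p: "?c (p z) f = c' (p z) f + (of_bool (z = x 1) + of_bool (z = w d)) * c (x d) f"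
    if "z \<noteq> x 0" for z f
    using that injD[OF injp, of z "x 0"] unfolding mutC_def b'0 c'0 px0 by auto
  show ?case
  proof (intro exI conjI allI impI)
    have "green_run V b' c' [x 0] ?b ?c"
      using x0V c'0 pos[of d] by (intro green_run_single) auto
    from green_run_append[OF run this] have "green_run V b c (x 0 # ks @ [x 0]) ?b ?c"
      unfolding b1_def c1_def using x0V pos[of 0] by (intro green_run_Cons) auto
    then show "green_run V b c (x 0 # ks @ [x 0]) ?b ?c" .
    show "skew ?b" by (rule skew_mutB[OF skb'])
    show "p permutes x ` {..<Suc d}"
      by (rule permutes_subset[OF p]) (auto simp: yx)
    show "?b (p i) (p j) = b i j" for i j
      using mutB_relabel[where b' = b' and b = b1 and p = p, OF b' px0 injp, of i j] mutB_mutB[OF Suc.prems(5)] unfolding b1_def by simp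
    show "?c (p (x j)) f = - c (x (cyc_pred (Suc d) j)) f" if "j < Suc d" for j f
    proof (cases j)
      case 0
      then show ?thesis by (simp add: px0 mutC_def c'0 cyc_pred_def)
    next
      case (Suc i)
      then have i: "i < d" using that by simp
      have "?c (p (x j)) f = - c1 (y (cyc_pred d i)) f + of_bool (i = 0) * c (x d) f"
        using c_p[of "x (Suc i)" f] c'y[OF i, of f] inj[of "Suc i" 0] inj[of "Suc i" 1] wx[of d "Suc i"] i
        unfolding Suc y_def by auto
      also have "\<dots> = - c (x i) f"
      proof (cases "i = 0")
        case True
        then show ?thesis using c1y[of "d - 1" f] i by (simp add: cyc_pred_def)
      next
        case False
        then show ?thesis using c1y[of "i - 1" f] i by (auto simp add: cyc_pred_def)
      qed
      finally show ?thesis using Suc by (simp add: cyc_pred_def)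
    qed
    show "?c z f = c z f + (\<Sum>j<Suc d. of_bool (w j = z) * c (x j) f)"
      if z: "z \<notin> x ` {..<Suc d}" for z f
    proof -
      have zx: "z \<noteq> x j" if "j \<le> d" for j using z that by auto
      have zy: "z \<notin> y ` {..<d}" using z unfolding yx by auto
      have pz: "p z = z" using p zy by (simp add: permutes_not_in)
      obtain e where e: "d = Suc e" using Suc.hyps by (cases d) auto
      have "(\<Sum>j<d. of_bool (v j = z) * c1 (y j) f) = (\<Sum>j<e. of_bool (w (Suc j) = z) * c (x (Suc j)) f)"
        unfolding e using c1y zx[of 0] by (simp add: v_def e)
      then have "?c z f = c z f + of_bool (z = w 0) * c (x 0) f
          + (\<Sum>j<e. of_bool (w (Suc j) = z) * c (x (Suc j)) f) + of_bool (z = w d) * c (x d) f"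
        using c_p[of z f] zx[of 0] zx[of 1] zx[of d] Suc.hyps unfolding pz c'z[OF zy] c1 by simp
      also have "\<dots> = c z f + (\<Sum>j<Suc d. of_bool (w j = z) * c (x j) f)"
        unfolding e sum.lessThan_Suc_shift[of _ "Suc e"] by (simp add: eq_commute)
      finally show ?thesis .
    qed
  qed
qed

section \<open>Mutation at several pairwise unconnected vertices\<close>

definition mutB_set :: "'v set \<Rightarrow> ('v \<Rightarrow> 'v \<Rightarrow> int) \<Rightarrow> 'v \<Rightarrow> 'v \<Rightarrow> int" where
  "mutB_set S b i j = (if i \<in> S \<or> j \<in> S then - b i j
     else b i j + (\<Sum>e\<in>S. max 0 (b i e) * max 0 (b e j) - max 0 (b j e) * max 0 (b e i)))"

definition mutC_set ::
  "'v set \<Rightarrow> ('v \<Rightarrow> 'v \<Rightarrow> int) \<Rightarrow> ('v \<Rightarrow> 'f \<Rightarrow> int) \<Rightarrow> 'v \<Rightarrow> 'f \<Rightarrow> int" where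
  "mutC_set S b c i f = (if i \<in> S then - c i f else c i f + (\<Sum>e\<in>S. max 0 (b i e) * c e f))"

lemma skew_mutB_set:
  assumes "skew b" shows "skew (mutB_set S b)"
  unfolding skew_def
proof (intro allI)
  fix i j
  show "mutB_set S b i j = - mutB_set S b j i"
    unfolding mutB_set_def skewD[OF assms, of i j] by (simp add: sum_negf[symmetric])
qed

text \<open>Mutating at one vertex of the list leaves the rows of the others unchanged, because
  there are no arrows between them. They therefore stay green, and the contributions of the single
  mutations add up, in any order, to the sums in \<open>mutB_set\<close> and
  \<open>mutC_set\<close>. For a set with inner arrows these formulas would not describe an iterated
  mutation.\<close>

lemma green_run_independent:
  fixes c :: "'v \<Rightarrow> 'f \<Rightarrow> int"
  assumes "distinct es" "set es \<subseteq> V" "\<And>e e'. e \<in> set es \<Longrightarrow> e' \<in> set es \<Longrightarrow> b e e' = 0"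
    and "\<And>e f. e \<in> set es \<Longrightarrow> 0 \<le> c e f"
  shows "green_run V b c es (mutB_set (set es) b) (mutC_set (set es) b c)"
  using assms
proof (induction es arbitrary: b c)
  case Nil
  have "mutB_set {} b = b" "mutC_set {} b c = c"
    by (simp_all add: mutB_set_def mutC_set_def fun_eq_iff)
  then show ?case by (simp add: green_run_Nil)
next
  case (Cons k es)
  let ?b = "mutB k b" let ?c = "mutC k b c"
  have k: "b k e = 0" "b e k = 0" "e \<noteq> k" if "e \<in> set es" for e
    using Cons.prems(1,3) that by auto
  have bk: "?b i e = (if i = k then 0 else b i e)" "?b e i = (if i = k then 0 else b e i)"
    if "e \<in> set es" for e i
    using k[OF that] by (auto simp: mutB_def)
  have ck: "?c e f = c e f" if "e \<in> set es" for e f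
    using k[OF that] by (auto simp: mutC_def)
  have sumb: "(\<Sum>e\<in>set es. max 0 (?b i e) * max 0 (?b e j) - max 0 (?b j e) * max 0 (?b e i)) =
      (if i = k \<or> j = k then 0 else
       (\<Sum>e\<in>set es. max 0 (b i e) * max 0 (b e j) - max 0 (b j e) * max 0 (b e i)))" for i j
    by (auto simp: bk intro!: sum.cong sum.neutral)
  have sumc: "(\<Sum>e\<in>set es. max 0 (?b i e) * ?c e f) =
      (if i = k then 0 else (\<Sum>e\<in>set es. max 0 (b i e) * c e f))" for i f
    by (auto simp: bk ck intro!: sum.cong sum.neutral)
  have kes: "k \<notin> set es" using Cons.prems(1) by simp
  have "mutB_set (set es) ?b i j = mutB_set (set (k # es)) b i j" for i j
  proof -
    consider "i = k" "j \<in> set es" | "j = k" "i \<in> set es" | "i = k" "j \<notin> set es" | "j = k" "i \<notin> set es"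
      | "i \<noteq> k" "j \<noteq> k" "i \<in> set es \<or> j \<in> set es"
      | "i \<notin> set (k # es)" "j \<notin> set (k # es)" by auto
    then show ?thesis
    proof cases
      case 1
      then show ?thesis by (simp add: mutB_set_def bk k)
    next
      case 2
      then show ?thesis by (simp add: mutB_set_def bk k)
    next
      case 3
      then show ?thesis using kes by (simp add: mutB_set_def sumb) (simp add: mutB_def)
    next
      case 4
      then show ?thesis using kes by (simp add: mutB_set_def sumb) (simp add: mutB_def)
    next
      case 5
      then show ?thesis using bk by (auto simp: mutB_set_def)
    next
      case 6
      then show ?thesis using kes by (simp add: mutB_set_def sumb) (simp add: mutB_def)
    qed
  qed
  moreover have "mutC_set (set es) ?b ?c i f = mutC_set (set (k # es)) b c i f" for i f
  proof -
    consider "i = k" | "i \<in> set es" | "i \<notin> set (k # es)" by auto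
    then show ?thesis
    proof cases
      case 1
      then show ?thesis using kes by (simp add: mutC_set_def sumc) (simp add: mutC_def)
    next
      case 2
      then show ?thesis using k by (auto simp: mutC_set_def ck)
    next
      case 3
      then show ?thesis using kes by (simp add: mutC_set_def sumc) (simp add: mutC_def)
    qed
  qed
  ultimately have eq: "mutB_set (set es) ?b = mutB_set (set (k # es)) b"
    "mutC_set (set es) ?b ?c = mutC_set (set (k # es)) b c"
    by (simp_all add: fun_eq_iff)
  have "green_run V ?b ?c es (mutB_set (set es) ?b) (mutC_set (set es) ?b ?c)"
    by (rule Cons.IH) (use Cons.prems in \<open>auto simp: bk ck\<close>)
  then show ?case
    unfolding eq using Cons.prems(2,4) by (intro green_run_Cons) auto
qed

section \<open>Green sequences of framed quivers\<close>

definition net_arrows :: "'v quiver \<Rightarrow> 'v \<Rightarrow> 'v \<Rightarrow> int" where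
  "net_arrows Q i j = int (arrows Q i j) - int (arrows Q j i)"

lemma skew_net_arrows: "skew (net_arrows Q)"
  by (simp add: skew_def net_arrows_def)

text \<open>The case of two frozen vertices is excluded because \<open>mutate\<close> deletes the
  arrows between them, whereas \<open>mutB\<close> keeps the count of paths through
  \<open>k\<close>.\<close>

lemma net_arrows_mutate:
  assumes "is_quiver Q" "k \<in> verts Q - frozen Q" "i \<notin> frozen Q \<or> j \<notin> frozen Q"
  shows "net_arrows (mutate k Q) i j = mutB k (net_arrows Q) i j"
proof -
  have z: "arrows Q i i = 0" "arrows Q i j = 0 \<or> arrows Q j i = 0" for i j
    using assms(1) by (auto simp: is_quiver_def)
  have mx: "max 0 (net_arrows Q i j) = int (arrows Q i j)" for i j
    using z(2)[of i j] by (auto simp: net_arrows_def)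
  define r where "r = reverse_at k (add_2_paths k (arrows Q))"
  have "net_arrows (mutate k Q) i j = int (r i j) - int (r j i)"
    using assms(3) by (auto simp: net_arrows_def mutate_def delete_within_def cancel_2_cycles_def r_def)
  also have "\<dots> = mutB k (net_arrows Q) i j"
    unfolding r_def mutB_def mx
    by (auto simp: reverse_at_def add_2_paths_def net_arrows_def z(1))
  finally show ?thesis .
qed

lemma arrows_eq_0_iff:
  assumes "is_quiver Q" shows "arrows Q i j = 0 \<longleftrightarrow> net_arrows Q i j \<le> 0"
proof -
  have "arrows Q i j = 0 \<or> arrows Q j i = 0" using assms by (auto simp: is_quiver_def)
  then show ?thesis by (auto simp: net_arrows_def)
qed

lemma verts_frozen_fold_mutate [simp]:
  "verts (fold mutate ks R) = verts R" "frozen (fold mutate ks R) = frozen R"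
  by (induction ks arbitrary: R) (auto simp: mutate_def)

text \<open>No arrow leads from a frozen vertex into a green \<open>k\<close>, so one of the two
  products in \<open>mutB\<close> vanishes on frozen columns and the other is the summand in
  \<open>mutC\<close>. The quiver \<open>R\<close> is prescribed only by its signed counts, since
  the induction passes from \<open>R\<close> to its mutation.\<close>

lemma green_run_mutations:
  fixes Q :: "'v quiver" and R :: "('v + 'v) quiver"
  assumes "green_run (verts Q) b c ks b' c'"
    and "is_quiver R" "verts R = verts (framed Q)" "frozen R = frozen (framed Q)"
    and "\<And>i j. net_arrows R (Inl i) (Inl j) = b i j" "\<And>i f. net_arrows R (Inl i) (Inr f) = c i f"
  defines "R' \<equiv> \<lambda>m. fold mutate (map Inl (take m ks)) R"
  shows "(\<forall>m < length ks. green (R' m) (Inl (ks ! m))) \<and> is_quiver (R' (length ks)) \<and>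
     (\<forall>i f. net_arrows (R' (length ks)) (Inl i) (Inr f) = c' i f)"
  using assms(1-6) unfolding R'_def
proof (induction arbitrary: R rule: green_run.induct)
  case (green_run_Nil b c)
  then show ?case by simp
next
  case (green_run_Cons k c b ks b' c')
  let ?R = "mutate (Inl k) R"
  have k: "Inl k \<in> verts R - frozen R"
    using green_run_Cons by (auto simp: framed_def)
  have fr: "Inl i \<notin> frozen R" for i
    using green_run_Cons by (auto simp: framed_def)
  have nf: "net_arrows R (Inr f) (Inl i) = - c i f" for f i
    using skewD[OF skew_net_arrows, of R "Inr f" "Inl i"] green_run_Cons.prems(5) by simp
  have "(\<forall>m < length ks. green (fold mutate (map Inl (take m ks)) ?R) (Inl (ks ! m))) \<and>
     is_quiver (fold mutate (map Inl (take (length ks) ks)) ?R) \<and>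
     (\<forall>i f. net_arrows (fold mutate (map Inl (take (length ks) ks)) ?R) (Inl i) (Inr f) = c' i f)"
  proof (rule green_run_Cons.IH)
    show "is_quiver ?R" by (rule is_quiver_mutate[OF green_run_Cons.prems(1) k])
    show "verts ?R = verts (framed Q)" "frozen ?R = frozen (framed Q)"
      using green_run_Cons.prems by (simp_all add: mutate_def)
    show "net_arrows ?R (Inl i) (Inl j) = mutB k b i j" for i j
      unfolding net_arrows_mutate[OF green_run_Cons.prems(1) k disjI1[OF fr]]
      by (simp add: mutB_def green_run_Cons.prems)
    show "net_arrows ?R (Inl i) (Inr f) = mutC k b c i f" for i f
      unfolding net_arrows_mutate[OF green_run_Cons.prems(1) k disjI1[OF fr]]
      using green_run_Cons.hyps(2) by (simp add: mutB_def mutC_def green_run_Cons.prems nf)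
  qed
  moreover have "green R (Inl k)"
    using k green_run_Cons.hyps(2) green_run_Cons.prems
    by (auto simp: green_def arrows_eq_0_iff framed_def nf)
  ultimately show ?case
    by (auto simp: less_Suc_eq_0_disj)
qed

lemma maximal_green_sequence_if_green_run:
  fixes Q :: "'v quiver"
  assumes "is_quiver Q" "frozen Q = {}"
    and "green_run (verts Q) (net_arrows Q) (\<lambda>i f. of_bool (i = f \<and> i \<in> verts Q)) ks b c"
    and "\<And>i f. i \<in> verts Q \<Longrightarrow> c i f \<le> 0"
  shows "maximal_green_sequence Q ks"
proof -
  have "net_arrows (framed Q) (Inl i) (Inl j) = net_arrows Q i j"
    "net_arrows (framed Q) (Inl i) (Inr f) = of_bool (i = f \<and> i \<in> verts Q)" for i j f
    by (auto simp: net_arrows_def framed_def)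
  note * = green_run_mutations[OF assms(3) is_quiver_framed[OF assms(1)] refl refl this]
  have "red (mutated_framed Q ks) x"
    if "x \<in> verts (mutated_framed Q ks) - frozen (mutated_framed Q ks)" for x
  proof -
    from that obtain i where x: "x = Inl i" "i \<in> verts Q"
      by (auto simp: mutated_framed_def framed_def)
    show ?thesis
      using that * assms(4)[OF x(2)]
      by (auto simp: red_def x arrows_eq_0_iff mutated_framed_def framed_def)
  qed
  then show ?thesis
    using * by (auto simp: maximal_green_sequence_def green_sequence_def mutated_framed_def)
qed

text \<open>As \<open>f\<close> is injective, an orbit that starts outside an invariant set
  \<open>K\<close> stays outside it. The least return time of its starting point then lists it
  without repetition, so the cycles of a permutation can be treated one at a time, each with an
  explicit cyclic numbering.\<close>

lemma bij_betw_cycles_induct [consumes 2, case_names empty cycle]: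
  assumes "finite S" "bij_betw f S S"
    and "P {}"
    and "\<And>K x d. K \<subseteq> S \<Longrightarrow> f ` K = K \<Longrightarrow> P K \<Longrightarrow> x \<in> S - K \<Longrightarrow> 0 < d \<Longrightarrow>
       inj_on (\<lambda>i. (f ^^ i) x) {..<d} \<Longrightarrow> (f ^^ d) x = x \<Longrightarrow>
       (\<lambda>i. (f ^^ i) x) ` {..<d} \<subseteq> S - K \<Longrightarrow> P (K \<union> (\<lambda>i. (f ^^ i) x) ` {..<d})"
  shows "P S"
proof -
  have inj: "inj_on f S" and im: "f ` S = S" using assms(2) by (auto simp: bij_betw_def)
  have "P S" if "K \<subseteq> S" "f ` K = K" "P K" for K
    using that
  proof (induction "card (S - K)" arbitrary: K rule: less_induct)
    case less
    show ?case
    proof (cases "K = S")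
      case True
      then show ?thesis using less by simp
    next
      case False
      then obtain x where x: "x \<in> S - K" using less by auto
      have orb: "(f ^^ i) x \<in> S - K" for i
      proof (induction i)
        case (Suc i)
        have "f ((f ^^ i) x) \<notin> K"
        proof
          assume "f ((f ^^ i) x) \<in> K"
          then obtain k where "k \<in> K" "f k = f ((f ^^ i) x)" using less.prems(2) by (metis imageE)
          then have "k = (f ^^ i) x" using Suc inj less.prems(1) by (auto dest: inj_onD)
          then show False using \<open>k \<in> K\<close> Suc by simp
        qed
        then show ?case using Suc im by auto
      qed (use x in simp)
      \<comment> \<open>Injectivity removes the common iterates, so any repetition in the orbit is a
        return to \<open>x\<close> itself; the pigeonhole principle provides a repetition.\<close>
      have cancel: "(f ^^ j) x = x" if "(f ^^ (i + j)) x = (f ^^ i) x" for i j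
        using that
      proof (induction i)
        case (Suc i)
        then have "f ((f ^^ (i + j)) x) = f ((f ^^ i) x)" by simp
        then show ?case using Suc.IH orb inj by (metis DiffD1 inj_onD)
      qed simp
      have "\<not> inj_on (\<lambda>i. (f ^^ i) x) {..card S}"
      proof
        assume "inj_on (\<lambda>i. (f ^^ i) x) {..card S}"
        from card_inj_on_le[OF this _ assms(1)] orb show False by auto
      qed
      then obtain i j where "i < j" "(f ^^ i) x = (f ^^ j) x"
        unfolding inj_on_def by (metis linorder_neqE_nat)
      then have "\<exists>d>0. (f ^^ d) x = x"
        using cancel[of i "j - i"] by (metis le_add_diff_inverse less_imp_le zero_less_diff)
      define d where "d = (LEAST d. 0 < d \<and> (f ^^ d) x = x)"
      have d: "0 < d" "(f ^^ d) x = x"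
        using LeastI_ex[of "\<lambda>d. 0 < d \<and> (f ^^ d) x = x"] \<open>\<exists>d>0. _\<close> unfolding d_def by auto
      have dmin: "\<not> (0 < e \<and> (f ^^ e) x = x)" if "e < d" for e
        using that unfolding d_def by (rule not_less_Least)
      have injd: "inj_on (\<lambda>i. (f ^^ i) x) {..<d}"
      proof (rule linorder_inj_onI')
        fix i j assume "i \<in> {..<d}" "j \<in> {..<d}" "i < j"
        then show "(f ^^ i) x \<noteq> (f ^^ j) x"
          using cancel[of i "j - i"] dmin[of "j - i"] by auto
      qed
      let ?O = "(\<lambda>i. (f ^^ i) x) ` {..<d}"
      have fO: "f ` ?O = ?O"
      proof -
        have "f ` ?O = (\<lambda>i. (f ^^ i) x) ` Suc ` {..<d}" by (simp add: image_image)
        also have "\<dots> = (\<lambda>i. (f ^^ i) x) ` {1..d}" by (simp add: image_Suc_lessThan)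
        also have "\<dots> = ?O"
        proof -
          have "{1..d} = insert d {1..<d}" "{..<d} = insert 0 {1..<d}" using d by auto
          then show ?thesis using d by (metis (no_types, lifting) funpow_0 image_insert)
        qed
        finally show ?thesis .
      qed
      have O: "?O \<subseteq> S - K" using orb by auto
      have "P (K \<union> ?O)"
        by (rule assms(4)[OF less.prems x d(1) injd d(2) O])
      moreover have "K \<union> ?O \<subseteq> S" "f ` (K \<union> ?O) = K \<union> ?O"
        using less.prems O fO by (auto simp: image_Un)
      moreover have "card (S - (K \<union> ?O)) < card (S - K)"
      proof (rule psubset_card_mono)
        have "x \<in> ?O" using d(1) by (intro image_eqI[of _ _ 0]) auto
        then show "S - (K \<union> ?O) \<subset> S - K" using x by blast
      qed (use assms(1) in simp)
      ultimately show ?thesis using less.hyps by blast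
    qed
  qed
  from this[of "{}"] assms(3) show ?thesis by simp
qed

section \<open>The quiver of a cone\<close>

text \<open>A sweep gives back the matrix only up to a permutation \<open>p\<close> of the spokes.
  The outer vertices \<open>e1\<close> and \<open>e2\<close> are not moved, so the shape of a column
  survives once the spokes are renamed by \<open>p\<close>.\<close>

lemma cyclic_form_relabel:
  fixes b b' :: "'v \<Rightarrow> 'v \<Rightarrow> int"
  assumes "p permutes A" "\<And>i j. b' (p i) (p j) = b i j" "e1 \<notin> A" "e2 \<notin> A"
    and "\<And>z. b z x = of_bool (z = x1) + of_bool (z = e1) - of_bool (z = x2) - of_bool (z = e2)"
  shows "b' z (p x) = of_bool (z = p x1) + of_bool (z = e1) - of_bool (z = p x2) - of_bool (z = e2)"
proof -
  obtain y where y: "z = p y" using permutes_surj[OF assms(1)] by (metis surjD)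
  have *: "p y = p a \<longleftrightarrow> y = a" for a using permutes_inj[OF assms(1)] by (auto dest: injD)
  have "p e1 = e1" "p e2 = e2" using assms(1,3,4) by (auto simp: permutes_not_in)
  then have "p y = e1 \<longleftrightarrow> y = e1" "p y = e2 \<longleftrightarrow> y = e2" using *[of e1] *[of e2] by auto
  then show ?thesis
    using assms(2)[of y x] assms(5)[of y] unfolding y * by simp
qed

text \<open>A polygon with \<open>n\<close> sides, whose side \<open>k\<close> is glued to side \<open>\<tau> k\<close> along the arc \<open>E k\<close>, is
  triangulated as a cone. The triangle over side \<open>k\<close> has the spokes \<open>k\<close> and \<open>k + 1\<close> (modulo \<open>n\<close>).\<close>

locale cone =
  fixes n :: nat and \<tau> :: "nat \<Rightarrow> nat" and E :: "nat \<Rightarrow> 'v"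
  assumes n: "3 \<le> n"
    and tau: "k < n \<Longrightarrow> \<tau> k < n" "k < n \<Longrightarrow> \<tau> (\<tau> k) = k" "k < n \<Longrightarrow> \<tau> k \<noteq> k"
    and tau_succ: "k < n \<Longrightarrow> \<tau> k \<noteq> cyc_succ n k"
    and E_eq: "j < n \<Longrightarrow> k < n \<Longrightarrow> E j = E k \<longleftrightarrow> j = k \<or> j = \<tau> k"
begin

abbreviation "pre \<equiv> cyc_pred n"
abbreviation "nxt \<equiv> cyc_succ n"

text \<open>Crossing side \<open>pre k\<close> near its end, corner \<open>k\<close>, leads into the
  polygon again at the start of the glued side, corner \<open>\<tau> (pre k)\<close>. So
  \<open>\<kappa>\<close> goes from a corner of the polygon to the next one at the same outer
  puncture, and \<open>\<rho>\<close> goes around that puncture the other way.\<close>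

definition \<kappa> :: "nat \<Rightarrow> nat" where "\<kappa> k = \<tau> (pre k)"
definition \<rho> :: "nat \<Rightarrow> nat" where "\<rho> k = nxt (\<tau> k)"

lemma pre_nxt [simp]:
  "k < n \<Longrightarrow> pre k < n" "k < n \<Longrightarrow> nxt k < n" "k < n \<Longrightarrow> pre (nxt k) = k" "k < n \<Longrightarrow> nxt (pre k) = k"
  "k < n \<Longrightarrow> pre k \<noteq> k" "k < n \<Longrightarrow> nxt k \<noteq> k"
  using n by (auto simp: cyc_pred_def cyc_succ_def)

lemma kappa_rho [simp]:
  "k < n \<Longrightarrow> \<kappa> k < n" "k < n \<Longrightarrow> \<rho> k < n" "k < n \<Longrightarrow> \<kappa> (\<rho> k) = k" "k < n \<Longrightarrow> \<rho> (\<kappa> k) = k"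
  by (simp_all add: \<kappa>_def \<rho>_def tau)

lemma bij_kappa: "bij_betw \<kappa> {..<n} {..<n}"
  by (rule bij_betw_byWitness[of _ \<rho>]) auto

text \<open>A fixed point of \<open>\<kappa>\<close> would be an outer puncture with only one spoke.
  The assumption on neighbouring sides excludes it, so every cycle has length at least 2, as
  \<open>sweep\<close> demands.\<close>

lemma kappa_neq: "k < n \<Longrightarrow> \<kappa> k \<noteq> k"
  unfolding \<kappa>_def using tau_succ[of "pre k"] by auto

lemma E_kappa: "k < n \<Longrightarrow> E (\<kappa> k) = E (pre k)"
  unfolding \<kappa>_def by (subst E_eq) (auto simp: tau)

lemma E_pre:
  assumes "k < n" shows "E (pre k) \<noteq> E k"
proof -
  have "pre k \<noteq> \<tau> k" using tau_succ[of "pre k"] tau(2)[of k] assms by auto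
  then show ?thesis using assms E_eq[of "pre k" k] by simp
qed

text \<open>A path from spoke \<open>l\<close> to spoke \<open>k\<close> through an outer arc leaves
  by \<open>E (pre l)\<close> and arrives by \<open>E k\<close>. For given \<open>k\<close> it
  exists for two distinct \<open>l\<close>, one for each of the two triangles at that arc.\<close>

lemma E_eq_iffs:
  assumes "l < n" "k < n"
  shows "of_bool (E (pre l) = E k) = (of_bool (l = nxt k) + of_bool (l = \<rho> k) :: int)"
proof -
  have "pre l = k \<longleftrightarrow> l = nxt k" "pre l = \<tau> k \<longleftrightarrow> l = \<rho> k"
    using assms unfolding \<rho>_def by (metis pre_nxt(3,4) tau(1))+
  moreover have "nxt k \<noteq> \<rho> k"
    unfolding \<rho>_def using assms(2) tau by (metis pre_nxt(3))
  ultimately show ?thesis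
    using assms by (auto simp: E_eq)
qed

lemma sum_E:
  assumes "j < n"
  shows "(\<Sum>i<n. of_bool (E i = E j) * (g i :: int)) = g j + g (\<tau> j)"
proof -
  have "(\<Sum>i<n. of_bool (E i = E j) * g i) = (\<Sum>i\<in>{j, \<tau> j}. of_bool (E i = E j) * g i)"
    using assms tau[of j] by (intro sum.mono_neutral_right) (auto simp: E_eq)
  also have "\<dots> = g j + g (\<tau> j)"
    using assms tau[of j] by (simp add: E_eq)
  finally show ?thesis .
qed

lemma sum_of_bool_E:
  assumes "k < n"
  shows "(\<Sum>e\<in>E ` {..<n}. of_bool (e = E k) * (g e :: int)) = g (E k)"
proof -
  have "(\<Sum>e\<in>E ` {..<n}. of_bool (e = E k) * g e) = (\<Sum>e\<in>{E k}. of_bool (e = E k) * g e)"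
    using assms by (intro sum.mono_neutral_right) auto
  then show ?thesis by simp
qed

definition spokes :: "(nat \<Rightarrow> 'v) \<Rightarrow> bool" where
  "spokes X \<longleftrightarrow> inj_on X {..<n} \<and> X ` {..<n} \<inter> E ` {..<n} = {}"

text \<open>The predicate \<open>cone_form\<close> describes the exchange matrix of the cone, and \<open>star_form\<close> the
  spoke columns of the matrix after all outer arcs have been flipped. Then the spokes form oriented
  cycles along \<open>\<kappa>\<close>, one for each class of vertices of the polygon.\<close>

definition cone_form :: "(nat \<Rightarrow> 'v) \<Rightarrow> ('v \<Rightarrow> 'v \<Rightarrow> int) \<Rightarrow> bool" where
  "cone_form X b \<longleftrightarrow> skew b \<and> (\<forall>j<n. \<forall>k<n. b (E j) (E k) = 0) \<and>
     (\<forall>y z. z \<notin> X ` {..<n} \<union> E ` {..<n} \<longrightarrow> b z y = 0) \<and>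
     (\<forall>k<n. \<forall>z. b z (X k) = of_bool (z = X (pre k)) + of_bool (z = E k)
          - of_bool (z = X (nxt k)) - of_bool (z = E (pre k)))"

definition star_form :: "(nat \<Rightarrow> 'v) \<Rightarrow> ('v \<Rightarrow> 'v \<Rightarrow> int) \<Rightarrow> bool" where
  "star_form X b \<longleftrightarrow> skew b \<and> (\<forall>j<n. \<forall>k<n. b (E j) (E k) = 0) \<and>
     (\<forall>k<n. \<forall>z. b z (X k) = of_bool (z = X (\<rho> k)) + of_bool (z = E (\<kappa> k))
          - of_bool (z = X (\<kappa> k)) - of_bool (z = E k))"

lemma max_E:
  assumes "e1 \<noteq> (e2 :: 'v)"
  shows "max 0 (of_bool (e = e1) - of_bool (e = e2)) = (of_bool (e = e1) :: int)"
  using assms by auto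

text \<open>The flips add arrows to spoke \<open>k\<close> from spokes \<open>nxt k\<close> and
  \<open>\<rho> k\<close>. The first cancels against the old arrow from spoke \<open>k\<close> to
  spoke \<open>nxt k\<close>, so the cycle around the centre disappears and the arrows along
  \<open>\<kappa>\<close> take its place.\<close>

lemma star_form_if_flipped:
  assumes X: "spokes X" and b: "cone_form X b"
  shows "star_form X (mutB_set (E ` {..<n}) b)"
  unfolding star_form_def
proof (intro conjI allI impI)
  let ?b = "mutB_set (E ` {..<n}) b"
  show "skew ?b" using b by (intro skew_mutB_set) (simp add: cone_form_def)
  show "?b (E j) (E k) = 0" if "j < n" "k < n" for j k
    using that b by (simp add: mutB_set_def cone_form_def)
  fix k z assume k: "k < n"
  have XE: "X i \<noteq> E j" if "i < n" "j < n" for i j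
    using X that by (auto simp: spokes_def)
  have Xi: "X i = X j \<longleftrightarrow> i = j" if "i < n" "j < n" for i j
    using X that by (auto simp: spokes_def inj_on_def)
  have sk: "b i j = - b j i" for i j using b by (auto simp: cone_form_def intro: skewD)
  have col: "b z (X k) = of_bool (z = X (pre k)) + of_bool (z = E k)
          - of_bool (z = X (nxt k)) - of_bool (z = E (pre k))" if "k < n" for k z
    using b that by (simp add: cone_form_def)
  have colE: "b (E j) (X k) = of_bool (E j = E k) - of_bool (E j = E (pre k))" if "k < n" "j < n" for j k
    using that XE[of _ j] by (simp add: col) (metis pre_nxt(1,2))
  have mx: "max 0 (b (E j) (X k)) = of_bool (E j = E k)"
    "max 0 (b (X k) (E j)) = of_bool (E j = E (pre k))" if "k < n" "j < n" for j k
    using max_E[OF E_pre[OF that(1)], of "E j"] max_E[OF E_pre[OF that(1), symmetric], of "E j"]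
    unfolding sk[of "X k" "E j"] colE[OF that] by simp_all
  consider j where "z = E j" "j < n" | l where "z = X l" "l < n" | "z \<notin> X ` {..<n} \<union> E ` {..<n}" by auto
  then show "?b z (X k) = of_bool (z = X (\<rho> k)) + of_bool (z = E (\<kappa> k))
          - of_bool (z = X (\<kappa> k)) - of_bool (z = E k)"
  proof cases
    case 1
    then show ?thesis using k XE[of "\<rho> k" j] XE[of "\<kappa> k" j] by (auto simp: mutB_set_def colE E_kappa)
  next
    case 2
    have s: "(\<Sum>e\<in>E ` {..<n}. max 0 (b (X i) e) * max 0 (b e (X j))) = of_bool (E (pre i) = E j)"
      if "i < n" "j < n" for i j
    proof -
      have "(\<Sum>e\<in>E ` {..<n}. max 0 (b (X i) e) * max 0 (b e (X j)))
          = (\<Sum>e\<in>E ` {..<n}. of_bool (e = E (pre i)) * of_bool (e = E j))"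
        using that by (intro sum.cong) (auto simp: mx)
      also have "\<dots> = of_bool (E (pre i) = E j)"
        using that by (intro sum_of_bool_E) auto
      finally show ?thesis .
    qed
    have "X k \<notin> E ` {..<n}" "z \<notin> E ` {..<n}" using 2 XE k by auto
    then have "?b z (X k) = b z (X k) + of_bool (E (pre l) = E k) - of_bool (E (pre k) = E l)"
      using k 2 by (simp add: mutB_set_def sum_subtractf s)
    also have "of_bool (E (pre k) = E l) = (of_bool (l = pre k) + of_bool (l = \<kappa> k) :: int)"
    proof -
      have "k = nxt l \<longleftrightarrow> l = pre k" "k = \<rho> l \<longleftrightarrow> l = \<kappa> k"
        using k 2 by auto
      then show ?thesis using E_eq_iffs[OF k 2(2)] by simp
    qed
    also have "b z (X k) = of_bool (l = pre k) - of_bool (l = nxt k)"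
      using 2 k XE[of l k] XE[of l "pre k"] by (simp add: col Xi)
    finally show ?thesis
      using 2 k XE[of l k] XE[of l "\<kappa> k"] by (simp add: Xi E_eq_iffs)
  next
    case 3
    have "b z y = 0" "b y z = 0" for y
      using b 3 sk[of y z] unfolding cone_form_def by auto
    then have "?b z (X k) = 0" by (simp add: mutB_set_def)
    then show ?thesis using 3 k by auto
  qed
qed

text \<open>The state after sweeping through the cycles of \<open>\<kappa>\<close> contained in \<open>K\<close>.\<close>

definition swept :: "'v set \<Rightarrow> (nat \<Rightarrow> 'v) \<Rightarrow> ('v \<Rightarrow> 'v \<Rightarrow> int) \<Rightarrow> ('v \<Rightarrow> 'f \<Rightarrow> int) \<Rightarrow>
    (nat \<Rightarrow> 'f \<Rightarrow> int) \<Rightarrow> nat set \<Rightarrow> bool" where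
  "swept V X b c R K \<longleftrightarrow> (\<exists>ks b' c' X'. green_run V b c ks b' c' \<and> spokes X' \<and> X' ` {..<n} = X ` {..<n} \<and>
     star_form X' b' \<and>
     (\<forall>k<n. \<forall>f. c' (X' k) f = (if k \<in> K then - R (\<rho> k) f else R k f)) \<and>
     (\<forall>j<n. \<forall>f. c' (E j) f = c (E j) f + (\<Sum>k\<in>K. of_bool (E (\<kappa> k) = E j) * R k f)))"

text \<open>Sweeping one cycle changes only the c-vectors of its own spokes and of outer arcs,
  because in star form the third vertices of the triangles along the cycle are outer arcs. The
  spokes not yet swept still carry the nonnegative \<open>R k\<close>. The spoke labelling changes
  by a permutation, which is why \<open>swept\<close> asks for a new labelling
  \<open>X'\<close>.\<close>

lemma swept_cycle:
  assumes sw: "swept V X b c R K" and R: "\<And>k f. k < n \<Longrightarrow> 0 \<le> R k f"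
    and XV: "X ` {..<n} \<subseteq> V"
    and K: "K \<subseteq> {..<n}" "a \<in> {..<n} - K" "0 < d"
    and inj: "inj_on (\<lambda>i. (\<kappa> ^^ i) a) {..<d}" and da: "(\<kappa> ^^ d) a = a"
    and O: "(\<lambda>i. (\<kappa> ^^ i) a) ` {..<d} \<subseteq> {..<n} - K"
  shows "swept V X b c R (K \<union> (\<lambda>i. (\<kappa> ^^ i) a) ` {..<d})"
proof -
  obtain ks b' c' X' where run: "green_run V b c ks b' c'" and X': "spokes X'"
    and X'X: "X' ` {..<n} = X ` {..<n}" and b': "star_form X' b'"
    and c'X: "\<forall>k<n. \<forall>f. c' (X' k) f = (if k \<in> K then - R (\<rho> k) f else R k f)"
    and c'E: "\<forall>j<n. \<forall>f. c' (E j) f = c (E j) f + (\<Sum>k\<in>K. of_bool (E (\<kappa> k) = E j) * R k f)"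
    using sw unfolding swept_def by (elim exE conjE) (rule that)
  note c'X = c'X[rule_format] and c'E = c'E[rule_format]
  define o' where "o' i = (\<kappa> ^^ i) a" for i
  define x where "x i = X' (o' i)" for i
  define w where "w i = E (o' (Suc i))" for i
  have o'n: "o' i < n" for i
    unfolding o'_def using K(2) by (induction i) auto
  have o'Suc: "o' (Suc i) = \<kappa> (o' i)" for i by (simp add: o'_def)
  have o'0: "o' 0 = a" by (simp add: o'_def)
  have o'd: "o' d = a" using da by (simp add: o'_def)
  have injo: "inj_on o' {..<d}" using inj by (simp add: o'_def[abs_def])
  have Oo: "o' ` {..<d} \<subseteq> {..<n} - K" using O by (simp add: o'_def[abs_def])
  have an: "a < n" using K(2) by auto
  have d: "2 \<le> d"
  proof (rule ccontr)
    assume "\<not> 2 \<le> d"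
    then have "d = 1" using K(3) by simp
    then show False using da kappa_neq[OF an] by simp
  qed
  have o'pre: "o' (cyc_pred d i) = \<rho> (o' i)" if "i < d" for i
  proof (cases i)
    case 0
    have "\<kappa> (o' (d - 1)) = a" using o'Suc[of "d - 1"] o'd K(3) by simp
    then have "\<rho> a = o' (d - 1)" using o'n[of "d - 1"] by auto
    then show ?thesis using 0 by (simp add: cyc_pred_def o'0)
  next
    case (Suc j)
    then show ?thesis using o'n by (simp add: cyc_pred_def o'Suc)
  qed
  have o'nxt: "o' (cyc_succ d i) = \<kappa> (o' i)" if "i < d" for i
    using o'd o'0 o'Suc by (auto simp: cyc_succ_def)
  have wpre: "w (cyc_pred d i) = E (o' i)" if "i < d" for i
    using that o'd o'0 by (auto simp: cyc_pred_def w_def)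
  have X'E: "X' i \<noteq> E j" "E j \<noteq> X' i" if "i < n" "j < n" for i j
    using X' that by (auto simp: spokes_def)
  have X'inj: "inj_on X' {..<n}" using X' by (auto simp: spokes_def)
  have wX: "w j \<notin> X' ` {..<n}" for j
    using X'E o'n[of "Suc j"] unfolding w_def by auto
  have xsub: "x ` {..<d} \<subseteq> X' ` {..<n}" unfolding x_def using o'n by auto
  have "\<exists>ks b'' c'' p. green_run V b' c' ks b'' c'' \<and> skew b'' \<and> p permutes (x ` {..<d}) \<and>
     (\<forall>i j. b'' (p i) (p j) = b' i j) \<and>
     (\<forall>j<d. \<forall>f. c'' (p (x j)) f = - c' (x (cyc_pred d j)) f) \<and>
     (\<forall>z f. z \<notin> x ` {..<d} \<longrightarrow>
        c'' z f = c' z f + (\<Sum>j<d. of_bool (w j = z) * c' (x j) f))"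
  proof (rule sweep[OF d])
    show "inj_on x {..<d}"
      using comp_inj_on[OF injo inj_on_subset[OF X'inj]] Oo by (auto simp: x_def[abs_def] comp_def)
    show "x ` {..<d} \<subseteq> V" using xsub X'X XV by auto
    show "w j \<notin> x ` {..<d}" if "j < d" for j using wX xsub by blast
    show "w 0 \<noteq> w (d - 1)"
      using E_pre[OF an] E_kappa[OF an] o'd K(3) by (simp add: w_def o'Suc o'0)
    show "skew b'" using b' by (simp add: star_form_def)
    show "b' z (x j) = of_bool (z = x (cyc_pred d j)) + of_bool (z = w j)
          - of_bool (z = x (cyc_succ d j)) - of_bool (z = w (cyc_pred d j))" if "j < d" for j z
      using b' o'n[of j] unfolding star_form_def x_def wpre[OF that] o'pre[OF that] o'nxt[OF that]
      by (simp add: w_def o'Suc)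
    show "0 \<le> c' (x j) f" if "j < d" for j f
      using R o'n[of j] Oo that by (auto simp: x_def c'X)
  qed
  then obtain ls b'' c'' p where run2: "green_run V b' c' ls b'' c''" and sk: "skew b''"
    and p: "p permutes (x ` {..<d})" and b'': "\<And>i j. b'' (p i) (p j) = b' i j"
    and c''x: "\<And>j f. j < d \<Longrightarrow> c'' (p (x j)) f = - c' (x (cyc_pred d j)) f"
    and c''z: "\<And>z f. z \<notin> x ` {..<d} \<Longrightarrow>
        c'' z f = c' z f + (\<Sum>j<d. of_bool (w j = z) * c' (x j) f)" by blast
  define X'' where "X'' k = p (X' k)" for k
  have pX: "p permutes (X' ` {..<n})" by (rule permutes_subset[OF p xsub])
  have EX: "E j \<notin> X' ` {..<n}" if "j < n" for j using X'E that by auto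
  have pE: "p (E j) = E j" if "j < n" for j
    using pX EX[OF that] by (simp add: permutes_not_in)
  have im: "X'' ` {..<n} = X' ` {..<n}"
    unfolding X''_def image_image[symmetric, of p X'] by (rule permutes_image[OF pX])
  show ?thesis unfolding swept_def
  proof (intro exI conjI allI impI)
    show "green_run V b c (ks @ ls) b'' c''" by (rule green_run_append[OF run run2])
    have "inj_on X'' {..<n}"
      unfolding X''_def using comp_inj_on[OF X'inj inj_on_subset[OF permutes_inj[OF p]]] by (simp add: comp_def)
    then show "spokes X''" using X' im by (simp add: spokes_def)
    show "X'' ` {..<n} = X ` {..<n}" using im X'X by simp
    show "star_form X'' b''" unfolding star_form_def
    proof (intro conjI allI impI)
      show "skew b''" by (fact sk)
      show "b'' (E j) (E k) = 0" if "j < n" "k < n" for j k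
        using b''[of "E j" "E k"] b' that by (simp add: pE star_form_def)
      show "b'' z (X'' k) = of_bool (z = X'' (\<rho> k)) + of_bool (z = E (\<kappa> k))
          - of_bool (z = X'' (\<kappa> k)) - of_bool (z = E k)" if "k < n" for k z
        unfolding X''_def
        by (rule cyclic_form_relabel[where p = p and b = b', OF pX]) (use b' b'' that EX in \<open>auto simp: star_form_def\<close>)
    qed
    show "c'' (X'' k) f = (if k \<in> K \<union> (\<lambda>i. (\<kappa> ^^ i) a) ` {..<d} then - R (\<rho> k) f else R k f)"
      if k: "k < n" for k f
    proof (cases "k \<in> o' ` {..<d}")
      case True
      then obtain i where i: "k = o' i" "i < d" by auto
      have "c'' (X'' k) f = - c' (X' (\<rho> k)) f"
        using c''x[OF i(2), of f] o'pre[OF i(2)] by (simp add: X''_def x_def i(1))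
      moreover have "\<rho> k \<notin> K"
      proof -
        have "o' (cyc_pred d i) \<in> o' ` {..<d}" using i d by (auto simp: cyc_pred_def)
        then show ?thesis using Oo o'pre[OF i(2)] i(1) by auto
      qed
      ultimately show ?thesis using True k c'X[of "\<rho> k" f] by (simp add: o'_def[abs_def])
    next
      case False
      have nx: "X' k \<notin> x ` {..<d}"
      proof
        assume "X' k \<in> x ` {..<d}"
        then obtain i where "i < d" "X' k = X' (o' i)" by (auto simp: x_def)
        then have "k = o' i" using X'inj k o'n[of i] by (auto dest: inj_onD)
        then show False using False \<open>i < d\<close> by simp
      qed
      have "w j \<noteq> X' k" for j using wX[of j] k by auto
      then have "c'' (X' k) f = c' (X' k) f" using c''z[OF nx, of f] by simp
      moreover have "X'' k = X' k" using p nx by (simp add: X''_def permutes_not_in)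
      ultimately show ?thesis using False k c'X[of k f] by (auto simp: o'_def[abs_def])
    qed
    show "c'' (E j) f = c (E j) f
        + (\<Sum>k\<in>K \<union> (\<lambda>i. (\<kappa> ^^ i) a) ` {..<d}. of_bool (E (\<kappa> k) = E j) * R k f)" if j: "j < n" for j f
    proof -
      have "E j \<notin> x ` {..<d}" using EX[OF j] xsub by auto
      then have "c'' (E j) f = c' (E j) f + (\<Sum>i<d. of_bool (w i = E j) * c' (x i) f)"
        by (rule c''z)
      also have "(\<Sum>i<d. of_bool (w i = E j) * c' (x i) f)
          = (\<Sum>i<d. of_bool (E (\<kappa> (o' i)) = E j) * R (o' i) f)"
        using Oo o'n by (intro sum.cong) (auto simp: w_def o'Suc x_def c'X)
      also have "\<dots> = (\<Sum>k\<in>o' ` {..<d}. of_bool (E (\<kappa> k) = E j) * R k f)"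
        by (subst sum.reindex[OF injo]) simp
      finally have "c'' (E j) f = c (E j) f + ((\<Sum>k\<in>K. of_bool (E (\<kappa> k) = E j) * R k f)
          + (\<Sum>k\<in>o' ` {..<d}. of_bool (E (\<kappa> k) = E j) * R k f))"
        using c'E[OF j, of f] by simp
      also have "(\<Sum>k\<in>K. of_bool (E (\<kappa> k) = E j) * R k f)
          + (\<Sum>k\<in>o' ` {..<d}. of_bool (E (\<kappa> k) = E j) * R k f)
          = (\<Sum>k\<in>K \<union> o' ` {..<d}. of_bool (E (\<kappa> k) = E j) * R k f)"
        using K(1) Oo by (intro sum.union_disjoint[symmetric]) (auto intro: finite_subset)
      finally show ?thesis by (simp add: o'_def[abs_def])
    qed
  qed
qed

lemma swept_all:
  assumes "spokes X" "star_form X b" "\<And>k f. k < n \<Longrightarrow> 0 \<le> c (X k) f" "X ` {..<n} \<subseteq> V"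
  shows "swept V X b c (\<lambda>k. c (X k)) {..<n}"
proof (induction rule: bij_betw_cycles_induct[OF finite_lessThan bij_kappa])
  case 1
  show ?case unfolding swept_def
    by (intro exI[of _ "[]"] exI[of _ b] exI[of _ c] exI[of _ X])
      (use assms in \<open>auto intro: green_run_Nil\<close>)
next
  case (2 K x d)
  then show ?case using assms(3,4) by (intro swept_cycle) auto
qed

text \<open>Writing \<open>e k\<close> and \<open>s k\<close> for the initial c-vectors of \<open>X k\<close> and \<open>E k\<close>, the c-vectors are
  \<open>- e (k - 1)\<close> and \<open>s k + e k + e (\<tau> k)\<close> after sweeping through all spokes;
  \<open>s (\<kappa> k) + e (\<kappa> k)\<close> and \<open>- (s k + e k + e (\<tau> k))\<close> after flipping the outer arcs;
  \<open>- (s k + e k)\<close> and \<open>s k\<close> after sweeping through the cycles of \<open>\<kappa>\<close>;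
  and \<open>- e k\<close> and \<open>- s k\<close> after flipping the outer arcs again.\<close>

theorem ex_green_run_to_red:
  assumes X: "spokes X" and b: "cone_form X b" and V: "V = X ` {..<n} \<union> E ` {..<n}"
    and c: "\<And>i f. i \<in> V \<Longrightarrow> c i f = of_bool (i = f)"
  shows "\<exists>ks b' c'. green_run V b c ks b' c' \<and> (\<forall>i\<in>V. \<forall>f. c' i f \<le> 0)"
proof -
  define e s where "e k f = (of_bool (X k = f) :: int)" and "s k f = (of_bool (E k = f) :: int)" for k f
  have es0: "0 \<le> e k f" "0 \<le> s k f" for k f by (simp_all add: e_def s_def)
  have cX: "c (X k) f = e k f" and cE: "c (E k) f = s k f" if "k < n" for k f
    using that V c[of "X k"] c[of "E k"] by (simp_all add: e_def s_def)
  have sE: "s j = s k" if "E j = E k" for j k using that by (simp add: s_def fun_eq_iff)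
  have XE: "X i \<noteq> E j" "E j \<noteq> X i" if "i < n" "j < n" for i j using X that by (auto simp: spokes_def)
  have Xinj: "inj_on X {..<n}" using X by (simp add: spokes_def)
  have "\<exists>ks b' c' p. green_run V b c ks b' c' \<and> skew b' \<and> p permutes (X ` {..<n}) \<and>
     (\<forall>i j. b' (p i) (p j) = b i j) \<and>
     (\<forall>j<n. \<forall>f. c' (p (X j)) f = - c (X (pre j)) f) \<and>
     (\<forall>z f. z \<notin> X ` {..<n} \<longrightarrow>
        c' z f = c z f + (\<Sum>j<n. of_bool (E j = z) * c (X j) f))"
  proof (rule sweep)
    show "2 \<le> n" using n by simp
    show "E 0 \<noteq> E (n - 1)" using E_pre[of 0] n by (auto simp: cyc_pred_def)
    show "0 \<le> c (X j) f" if "j < n" for j f using that by (simp add: cX es0)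
  qed (use Xinj V b XE in \<open>auto simp: cone_form_def\<close>)
  then obtain k1 b1 c1 p where run1: "green_run V b c k1 b1 c1" and sk1: "skew b1"
    and p: "p permutes (X ` {..<n})" and b1: "\<And>i j. b1 (p i) (p j) = b i j"
    and c1x: "\<And>j f. j < n \<Longrightarrow> c1 (p (X j)) f = - c (X (pre j)) f"
    and c1z: "\<And>z f. z \<notin> X ` {..<n} \<Longrightarrow>
        c1 z f = c z f + (\<Sum>j<n. of_bool (E j = z) * c (X j) f)" by blast
  define X1 where "X1 k = p (X k)" for k
  have EX: "E j \<notin> X ` {..<n}" if "j < n" for j using XE that by auto
  have pE: "p (E j) = E j" if "j < n" for j using p EX[OF that] by (simp add: permutes_not_in)
  have im1: "X1 ` {..<n} = X ` {..<n}"
    unfolding X1_def image_image[symmetric, of p X] by (rule permutes_image[OF p])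
  have X1: "spokes X1"
    using comp_inj_on[OF Xinj inj_on_subset[OF permutes_inj[OF p]]] X im1
    by (simp add: spokes_def X1_def[abs_def] comp_def)
  have form1: "cone_form X1 b1" unfolding cone_form_def
  proof (intro conjI allI impI)
    show "skew b1" by (fact sk1)
    show "b1 (E j) (E k) = 0" if "j < n" "k < n" for j k
      using b1[of "E j" "E k"] b that by (simp add: pE cone_form_def)
    show "b1 z y = 0" if "z \<notin> X1 ` {..<n} \<union> E ` {..<n}" for y z
    proof -
      have "p z = z" using that p unfolding im1 by (simp add: permutes_not_in)
      moreover obtain y' where "y = p y'" using permutes_surj[OF p] by (metis surjD)
      ultimately show ?thesis using b1[of z y'] b that unfolding im1 cone_form_def by simp
    qed
    show "b1 z (X1 k) = of_bool (z = X1 (pre k)) + of_bool (z = E k)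
          - of_bool (z = X1 (nxt k)) - of_bool (z = E (pre k))" if "k < n" for k z
      unfolding X1_def
      by (rule cyclic_form_relabel[where p = p and b = b, OF p]) (use b b1 that EX in \<open>auto simp: cone_form_def\<close>)
  qed
  have c1X: "c1 (X1 k) f = - e (pre k) f" if "k < n" for k f
    using c1x[OF that, of f] that by (simp add: X1_def cX)
  have c1E: "c1 (E k) f = s k f + e k f + e (\<tau> k) f" if "k < n" for k f
  proof -
    have "(\<Sum>j<n. of_bool (E j = E k) * c (X j) f) = (\<Sum>j<n. of_bool (E j = E k) * e j f)"
      by (intro sum.cong) (auto simp: cX)
    then show ?thesis using c1z[OF EX[OF that], of f] sum_E[OF that, of "\<lambda>j. e j f"] cE[OF that] by simp
  qed
  \<comment> \<open>\<open>E\<close> takes each value twice, so a list without repetitions is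
    chosen; its order does not matter.\<close>
  obtain es where es: "set es = E ` {..<n}" "distinct es"
    using finite_distinct_list[of "E ` {..<n}"] by auto
  define b2 where "b2 = mutB_set (E ` {..<n}) b1"
  define c2 where "c2 = mutC_set (E ` {..<n}) b1 c1"
  have run2: "green_run V b1 c1 es b2 c2"
    unfolding b2_def c2_def es(1)[symmetric]
    by (rule green_run_independent) (use es V form1 c1E es0 in \<open>auto simp: cone_form_def\<close>)
  have c2: "c2 i f = (if i \<in> E ` {..<n} then - c1 i f
        else c1 i f + (\<Sum>e\<in>E ` {..<n}. max 0 (b1 i e) * c1 e f))" for i f
    by (simp add: c2_def mutC_set_def)
  have form2: "star_form X1 b2" unfolding b2_def by (rule star_form_if_flipped[OF X1 form1])
  have X1E: "X1 i \<noteq> E j" "E j \<noteq> X1 i" if "i < n" "j < n" for i j using X1 that by (auto simp: spokes_def)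
  have c2X: "c2 (X1 k) f = s (\<kappa> k) f + e (\<kappa> k) f" if k: "k < n" for k f
  proof -
    have mx: "max 0 (b1 (X1 k) (E j)) = of_bool (E j = E (pre k))" if "j < n" for j
    proof -
      have "E j \<noteq> X1 (pre k)" "E j \<noteq> X1 (nxt k)" using X1E[of _ j] that k by (metis pre_nxt(1,2))+
      then have "b1 (X1 k) (E j) = of_bool (E j = E (pre k)) - of_bool (E j = E k)"
        using form1 k skewD[OF sk1, of "X1 k" "E j"] by (simp add: cone_form_def)
      then show ?thesis using max_E[OF E_pre[OF k]] by simp
    qed
    have "(\<Sum>e\<in>E ` {..<n}. max 0 (b1 (X1 k) e) * c1 e f)
        = (\<Sum>e\<in>E ` {..<n}. of_bool (e = E (pre k)) * c1 e f)"
    proof (intro sum.cong refl)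
      fix v assume "v \<in> E ` {..<n}"
      then obtain j where "v = E j" "j < n" by auto
      then show "max 0 (b1 (X1 k) v) * c1 v f = of_bool (v = E (pre k)) * c1 v f" using mx[of j] by simp
    qed
    also have "\<dots> = c1 (E (pre k)) f" using k by (intro sum_of_bool_E) auto
    also have "\<dots> = s (\<kappa> k) f + e (pre k) f + e (\<kappa> k) f"
      using k c1E[of "pre k" f] sE[OF E_kappa[OF k]] by (simp add: \<kappa>_def)
    moreover have "X1 k \<notin> E ` {..<n}" using X1E k by auto
    ultimately show ?thesis using c2[of "X1 k" f] c1X[OF k, of f] by simp
  qed
  have "swept V X1 b2 c2 (\<lambda>k. c2 (X1 k)) {..<n}"
    by (rule swept_all[OF X1 form2]) (use es0 V im1 in \<open>auto simp: c2X\<close>)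
  then obtain k3 b3 c3 X3 where run3: "green_run V b2 c2 k3 b3 c3" and X3: "spokes X3"
    and im3: "X3 ` {..<n} = X1 ` {..<n}" and form3: "star_form X3 b3"
    and c3X: "\<forall>k<n. \<forall>f. c3 (X3 k) f = (if k \<in> {..<n} then - c2 (X1 (\<rho> k)) f else c2 (X1 k) f)"
    and c3E: "\<forall>j<n. \<forall>f. c3 (E j) f
        = c2 (E j) f + (\<Sum>k<n. of_bool (E (\<kappa> k) = E j) * c2 (X1 k) f)"
    unfolding swept_def by (elim exE conjE) (rule that)
  note c3E = c3E[rule_format]
  have c3X': "c3 (X3 k) f = - s k f - e k f" if "k < n" for k f
    using that by (simp add: c3X c2X)
  \<comment> \<open>Reindexing by \<open>\<kappa>\<close> collects the contributions of both spokes
    attached to the arc, in total \<open>2 * s j + e j + e (\<tau> j)\<close>. Added to the value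
    \<open>- (s j + e j + e (\<tau> j))\<close> this leaves \<open>s j\<close>, so that the outer
    arcs are green again.\<close>
  have c3E': "c3 (E j) f = s j f" if j: "j < n" for j f
  proof -
    have "(\<Sum>k<n. of_bool (E (\<kappa> k) = E j) * c2 (X1 k) f)
        = (\<Sum>k<n. of_bool (E (\<kappa> k) = E j) * (s (\<kappa> k) f + e (\<kappa> k) f))"
      by (intro sum.cong) (auto simp: c2X)
    also have "\<dots> = (\<Sum>k<n. of_bool (E k = E j) * (s k f + e k f))"
      by (rule sum.reindex_bij_betw[OF bij_kappa])
    also have "\<dots> = s j f + e j f + (s (\<tau> j) f + e (\<tau> j) f)" by (rule sum_E[OF j])
    also have "s (\<tau> j) = s j" using j tau by (intro sE) (auto simp: E_eq)
    finally show ?thesis using c3E[OF j, of f] c2[of "E j" f] c1E[OF j, of f] j by simp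
  qed
  define b4 where "b4 = mutB_set (E ` {..<n}) b3"
  define c4 where "c4 = mutC_set (E ` {..<n}) b3 c3"
  have run4: "green_run V b3 c3 es b4 c4"
    unfolding b4_def c4_def es(1)[symmetric]
    by (rule green_run_independent) (use es V form3 c3E' es0 in \<open>auto simp: star_form_def\<close>)
  have c4: "c4 i f = (if i \<in> E ` {..<n} then - c3 i f
        else c3 i f + (\<Sum>e\<in>E ` {..<n}. max 0 (b3 i e) * c3 e f))" for i f
    by (simp add: c4_def mutC_set_def)
  have X3E: "X3 i \<noteq> E j" "E j \<noteq> X3 i" if "i < n" "j < n" for i j using X3 that by (auto simp: spokes_def)
  have c4X: "c4 (X3 k) f = - e k f" if k: "k < n" for k f
  proof -
    have mx: "max 0 (b3 (X3 k) (E j)) = of_bool (E j = E k)" if "j < n" for j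
    proof -
      have "E j \<noteq> X3 (\<rho> k)" "E j \<noteq> X3 (\<kappa> k)" using X3E[of _ j] that k by (metis kappa_rho(1,2))+
      then have "b3 (X3 k) (E j) = of_bool (E j = E k) - of_bool (E j = E (pre k))"
        using form3 k skewD[of b3 "X3 k" "E j"] E_kappa[OF k] by (simp add: star_form_def)
      then show ?thesis using max_E[OF E_pre[OF k, symmetric]] by simp
    qed
    have "(\<Sum>e\<in>E ` {..<n}. max 0 (b3 (X3 k) e) * c3 e f)
        = (\<Sum>e\<in>E ` {..<n}. of_bool (e = E k) * c3 e f)"
    proof (intro sum.cong refl)
      fix v assume "v \<in> E ` {..<n}"
      then obtain j where "v = E j" "j < n" by auto
      then show "max 0 (b3 (X3 k) v) * c3 v f = of_bool (v = E k) * c3 v f" using mx[of j] by simp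
    qed
    also have "\<dots> = s k f" using k by (simp add: sum_of_bool_E c3E')
    moreover have "X3 k \<notin> E ` {..<n}" using X3E k by auto
    ultimately show ?thesis using c4[of "X3 k" f] c3X'[OF k, of f] by simp
  qed
  have "green_run V b c (k1 @ es @ k3 @ es) b4 c4"
    using run1 run2 run3 run4 by (intro green_run_append)
  moreover have "c4 i f \<le> 0" if i: "i \<in> V" for i f
  proof -
    consider k where "i = X3 k" "k < n" | k where "i = E k" "k < n"
      using i unfolding V im1[symmetric] im3[symmetric] by auto
    then show ?thesis
    proof cases
      case 1
      then show ?thesis using es0(1)[of k f] by (simp add: c4X)
    next
      case 2
      then show ?thesis using es0(2)[of k f] by (simp add: c4 c3E')
    qed
  qed
  ultimately show ?thesis by blast
qed

end

section \<open>Polar coordinates in the polygon\<close>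

text \<open>The boundary of the polygon, parametrised with period \<open>4 * g\<close> such that vertex \<open>k\<close> is reached at
  time \<open>k\<close>.\<close>

definition bd :: "nat \<Rightarrow> real \<Rightarrow> complex" where
  "bd g t = linepath (polygon_vertex g (nat \<lfloor>t\<rfloor>)) (polygon_vertex g (Suc (nat \<lfloor>t\<rfloor>))) (t - of_int \<lfloor>t\<rfloor>)"

lemma bd_add:
  assumes "0 \<le> u" "u \<le> 1"
  shows "bd g (real k + u) = linepath (polygon_vertex g k) (polygon_vertex g (Suc k)) u"
proof (cases "u = 1")
  case True
  have "nat (int k + 1) = Suc k" by simp
  then show ?thesis using True by (simp add: bd_def linepath_def)
next
  case False
  then have "\<lfloor>real k + u\<rfloor> = int k" using assms by linarith
  then show ?thesis by (simp add: bd_def)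
qed

lemma bd_nat: "bd g (real k) = polygon_vertex g k"
  using bd_add[of 0 g k] by (simp add: linepath_def)

lemma polygon_vertex_periodic:
  assumes "1 \<le> g" shows "polygon_vertex g (k + 4 * g) = polygon_vertex g k"
proof -
  have "2 * pi * real (k + 4 * g) / real (4 * g) = 2 * pi * real k / real (4 * g) + 2 * pi"
    using assms by (simp add: field_simps)
  then show ?thesis unfolding polygon_vertex_def by (simp add: cis.ctr complex_eq_iff)
qed

lemma bd_periodic:
  assumes "1 \<le> g" "0 \<le> t" shows "bd g (t + 4 * real g) = bd g t"
proof -
  have "\<lfloor>t + 4 * real g\<rfloor> = \<lfloor>t\<rfloor> + 4 * int g" by linarith
  moreover have "nat (\<lfloor>t\<rfloor> + 4 * int g) = nat \<lfloor>t\<rfloor> + 4 * g" using assms(2) by (simp add: nat_add_distrib nat_mult_distrib)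
  ultimately show ?thesis
    using polygon_vertex_periodic[OF assms(1), of "nat \<lfloor>t\<rfloor>"] polygon_vertex_periodic[OF assms(1), of "Suc (nat \<lfloor>t\<rfloor>)"]
    by (simp add: bd_def)
qed

text \<open>Cosine decreases between 0 and pi and is symmetric under \<open>2 * pi - x\<close>. The
  bound serves for the angles between the vertices of the polygon and the normal of a side; equality
  singles out the two ends of that side.\<close>

lemma cos_le_cos_half:
  assumes "0 < \<theta>" "\<theta> \<le> pi" "\<theta> / 2 \<le> x" "x \<le> 2 * pi - \<theta> / 2"
  shows "cos x \<le> cos (\<theta> / 2)" and "cos x = cos (\<theta> / 2) \<Longrightarrow> x = \<theta> / 2 \<or> x = 2 * pi - \<theta> / 2"
proof -
  have "\<exists>y. \<theta> / 2 \<le> y \<and> y \<le> pi \<and> cos x = cos y \<and> (y = x \<or> y = 2 * pi - x)"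
    using assms cos_2pi_minus[of x]
    by (cases "x \<le> pi") (auto intro: exI[of _ x] exI[of _ "2 * pi - x"])
  then obtain y where y: "\<theta> / 2 \<le> y" "y \<le> pi" "cos x = cos y" "y = x \<or> y = 2 * pi - x" by blast
  show "cos x \<le> cos (\<theta> / 2)"
    unfolding y(3) using y assms by (intro cos_monotone_0_pi_le) auto
  show "x = \<theta> / 2 \<or> x = 2 * pi - \<theta> / 2" if "cos x = cos (\<theta> / 2)"
  proof -
    have cy: "cos y = cos (\<theta> / 2)" using that y(3) by simp
    have "y = \<theta> / 2"
      by (rule cos_inj_pi[OF _ _ _ _ cy]) (use y(1,2) assms(1,2) in simp_all)
    from y(4) show ?thesis
    proof
      assume "y = 2 * pi - x"
      then have "x = 2 * pi - \<theta> / 2" using \<open>y = \<theta> / 2\<close> by linarith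
      then show ?thesis by simp
    qed (use \<open>y = \<theta> / 2\<close> in simp)
  qed
qed

text \<open>The linear functional that is 1 on side \<open>k\<close> of the polygon and less than 1 on the rest of it.\<close>

definition support :: "nat \<Rightarrow> nat \<Rightarrow> complex \<Rightarrow> real" where
  "support g k z = (z \<bullet> cis (2 * pi * (real k + 1/2) / real (4 * g))) / cos (pi / real (4 * g))"

lemma support_linear: "support g k (a *\<^sub>R x + b *\<^sub>R y) = a * support g k x + b * support g k y"
  by (simp add: support_def inner_add_left add_divide_distrib)

lemma support_scale: "support g k (of_real r * x) = r * support g k x"
  using support_linear[of g k r x 0 x] by (simp add: scaleR_conv_of_real)

lemma cos_pi_pos: "1 \<le> g \<Longrightarrow> 0 < cos (pi / real (4 * g))"
  by (rule cos_gt_zero_pi) (auto simp: field_simps intro: less_le_trans[of _ 0])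

lemma support_vertex:
  assumes "1 \<le> g" "k < 4 * g" "m < 4 * g"
  shows "support g k (polygon_vertex g m) \<le> 1"
    and "support g k (polygon_vertex g m) = 1 \<longleftrightarrow> m = k \<or> m = Suc k mod (4 * g)"
proof -
  let ?N = "real (4 * g)"
  define \<theta> where "\<theta> = 2 * pi / ?N"
  have N: "4 \<le> ?N" using assms by simp
  have \<theta>: "0 < \<theta>" "\<theta> \<le> pi" using N pi_gt_zero unfolding \<theta>_def by (auto simp: field_simps)
  have half: "\<theta> / 2 = pi / ?N" by (simp add: \<theta>_def)
  have N\<theta>: "?N * \<theta> = 2 * pi" using N by (simp add: \<theta>_def)
  \<comment> \<open>The number of steps from vertex \<open>k\<close> to vertex \<open>m\<close>,
    taken from 1 to \<open>4 * g\<close> and not from 0. The angle of vertex \<open>m\<close>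
    against the normal of side \<open>k\<close> is then \<open>(j - 1/2) * \<theta>\<close>, which
    lies in the range of the cosine bound.\<close>
  define j where "j = (if k < m then m - k else m + 4 * g - k)"
  have j: "1 \<le> j" "j \<le> 4 * g" using assms by (auto simp: j_def)
  have "polygon_vertex g m \<bullet> cis (2 * pi * (real k + 1/2) / ?N) = cos (real m * \<theta> - (real k + 1/2) * \<theta>)"
    by (simp add: polygon_vertex_def \<theta>_def inner_complex_def cos_diff mult.commute mult.left_commute)
  also have "\<dots> = cos ((real j - 1/2) * \<theta>)"
  proof (cases "k < m")
    case True
    then have "real m * \<theta> - (real k + 1/2) * \<theta> = (real j - 1/2) * \<theta>"
      by (simp add: j_def of_nat_diff algebra_simps)
    then show ?thesis by simp
  next
    case False
    have "real j = real m + ?N - real k" using False assms by (simp add: j_def of_nat_diff)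
    have "(real j - 1/2) * \<theta> = (real m * \<theta> - (real k + 1/2) * \<theta>) + 2 * pi"
      unfolding \<open>real j = _\<close> N\<theta>[symmetric] by (simp add: algebra_simps)
    then show ?thesis by (metis cos_periodic)
  qed
  finally have eq: "polygon_vertex g m \<bullet> cis (2 * pi * (real k + 1/2) / ?N) = cos ((real j - 1/2) * \<theta>)" .
  have "1 * \<theta> \<le> real j * \<theta>" "real j * \<theta> \<le> ?N * \<theta>"
    using \<theta> j by (intro mult_right_mono; simp)+
  then have x: "\<theta> / 2 \<le> (real j - 1/2) * \<theta>" "(real j - 1/2) * \<theta> \<le> 2 * pi - \<theta> / 2"
    unfolding N\<theta> by (simp_all add: algebra_simps)
  note c = cos_le_cos_half[OF \<theta> x]
  have cp: "0 < cos (\<theta> / 2)" using cos_pi_pos[OF assms(1)] half by simp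
  have s: "support g k (polygon_vertex g m) = cos ((real j - 1/2) * \<theta>) / cos (\<theta> / 2)"
    unfolding support_def eq half by simp
  show "support g k (polygon_vertex g m) \<le> 1"
    unfolding s using c(1) cp by simp
  have jk: "m = k \<longleftrightarrow> j = 4 * g" "m = Suc k mod (4 * g) \<longleftrightarrow> j = 1"
    using assms by (auto simp: j_def mod_Suc)
  have "support g k (polygon_vertex g m) = 1 \<longleftrightarrow> cos ((real j - 1/2) * \<theta>) = cos (\<theta> / 2)"
    unfolding s using cp by auto
  also have "\<dots> \<longleftrightarrow> j = 1 \<or> j = 4 * g"
  proof
    assume "cos ((real j - 1/2) * \<theta>) = cos (\<theta> / 2)"
    then have "(real j - 1/2) * \<theta> = \<theta> / 2 \<or> (real j - 1/2) * \<theta> = ?N * \<theta> - \<theta> / 2"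
      using c(2) unfolding N\<theta> by simp
    then have "(real j - 1) * \<theta> = 0 \<or> (real j - ?N) * \<theta> = 0" by (auto simp: algebra_simps)
    then show "j = 1 \<or> j = 4 * g" using \<theta>(1) by auto
  next
    assume "j = 1 \<or> j = 4 * g"
    then have "(real j - 1/2) * \<theta> = \<theta> / 2 \<or> (real j - 1/2) * \<theta> = 2 * pi - \<theta> / 2"
      using N\<theta> by (auto simp: algebra_simps)
    then show "cos ((real j - 1/2) * \<theta>) = cos (\<theta> / 2)"
      using cos_2pi_minus[of "\<theta> / 2"] by metis
  qed
  finally show "support g k (polygon_vertex g m) = 1 \<longleftrightarrow> m = k \<or> m = Suc k mod (4 * g)"
    using jk by blast
qed

lemma polygon_vertex_mod: "1 \<le> g \<Longrightarrow> polygon_vertex g (m mod (4 * g)) = polygon_vertex g m"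
proof (induction m rule: less_induct)
  case (less m)
  show ?case
  proof (cases "m < 4 * g")
    case False
    then obtain m' where m': "m = m' + 4 * g" by (metis add.commute le_iff_add not_less)
    then show ?thesis
      using less.IH[of m'] less.prems polygon_vertex_periodic[of g m'] by simp
  qed simp
qed

lemma support_polygon:
  assumes "1 \<le> g" "k < 4 * g" "z \<in> polygon g"
  shows "support g k z \<le> 1"
proof -
  have "polygon g \<subseteq> {z. support g k z \<le> 1}"
    unfolding polygon_def
  proof (rule hull_minimal)
    show "polygon_vertex g ` {..<4 * g} \<subseteq> {z. support g k z \<le> 1}"
      using support_vertex(1)[OF assms(1,2)] by auto
    show "convex {z. support g k z \<le> 1}"
      unfolding convex_alt
    proof (intro ballI allI impI)
      fix x y u assume "x \<in> {z. support g k z \<le> 1}" "y \<in> {z. support g k z \<le> 1}" "0 \<le> u \<and> (u::real) \<le> 1"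
      then show "(1 - u) *\<^sub>R x + u *\<^sub>R y \<in> {z. support g k z \<le> 1}"
        unfolding mem_Collect_eq support_linear by (intro convex_bound_le) auto
    qed
  qed
  then show ?thesis using assms(3) by auto
qed

lemma support_bd:
  assumes "1 \<le> g" "k < 4 * g" "0 \<le> u" "u \<le> 1"
  shows "support g k (bd g (real k + u)) = 1"
proof -
  have "support g k (polygon_vertex g (Suc k)) = 1"
    using support_vertex(2)[OF assms(1,2), of "Suc k mod (4 * g)"] polygon_vertex_mod[OF assms(1), of "Suc k"] assms(2)
    by simp
  moreover have "support g k (polygon_vertex g k) = 1"
    using support_vertex(2)[OF assms(1,2,2)] by simp
  ultimately show ?thesis
    unfolding bd_add[OF assms(3,4)] linepath_def support_linear by simp
qed

lemma vertex_in_polygon: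
  assumes "1 \<le> g" shows "polygon_vertex g k \<in> polygon g"
proof -
  have "polygon_vertex g (k mod (4 * g)) \<in> polygon_vertex g ` {..<4 * g}" using assms by simp
  then show ?thesis
    unfolding polygon_vertex_mod[OF assms] polygon_def by (rule hull_inc)
qed

lemma convex_polygon: "convex (polygon g)" by (simp add: polygon_def)

lemma bd_in_polygon:
  assumes "1 \<le> g" shows "bd g t \<in> polygon g"
  unfolding bd_def linepath_def
  by (rule convexD_alt[OF convex_polygon]) (use vertex_in_polygon[OF assms] in \<open>auto, linarith+\<close>)

lemma real_floor_cases:
  assumes "0 \<le> t" "t < real n"
  obtains k u where "t = real k + u" "0 \<le> u" "u < 1" "k < n"
proof
  show "t = real (nat \<lfloor>t\<rfloor>) + (t - of_int \<lfloor>t\<rfloor>)" using assms by simp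
  show "nat \<lfloor>t\<rfloor> < n" using assms by linarith
qed linarith+

text \<open>The functional of the side through the first boundary point is 1 there and at most 1 at
  the second point, so \<open>r \<le> r'\<close>; exchanging the roles gives equality. Each
  functional is then 1 at the other point as well.\<close>

lemma polar_unique:
  assumes "1 \<le> g" "0 < r" "0 < r'" "0 \<le> t" "t < real (4 * g)" "0 \<le> t'" "t' < real (4 * g)"
    and eq: "of_real r * bd g t = of_real r' * bd g t'"
  shows "r = r' \<and> t = t'"
proof -
  obtain k u where t: "t = real k + u" "0 \<le> u" "u < 1" "k < 4 * g" using assms(4,5) by (rule real_floor_cases)
  obtain k' u' where t': "t' = real k' + u'" "0 \<le> u'" "u' < 1" "k' < 4 * g" using assms(6,7) by (rule real_floor_cases)
  have s: "support g k (bd g t) = 1" "support g k' (bd g t') = 1"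
    using support_bd[OF assms(1)] t t' by auto
  have s': "support g k (bd g t') \<le> 1" "support g k' (bd g t) \<le> 1"
    using support_polygon[OF assms(1) _ bd_in_polygon[OF assms(1)]] t t' by auto
  have "r = r' * support g k (bd g t')" "r * support g k' (bd g t) = r'"
    using arg_cong[OF eq, of "support g k"] arg_cong[OF eq, of "support g k'"] s
    unfolding support_scale by auto
  then have r: "r = r'" "support g k (bd g t') = 1" "support g k' (bd g t) = 1"
    using s' assms(2,3) mult_left_le[of "support g k (bd g t')" r'] mult_left_le[of "support g k' (bd g t)" r] by auto
  \<comment> \<open>As \<open>v < 1\<close>, vertex \<open>m'\<close> has positive weight in the
    convex combination, so value 1 at the point forces value 1 at vertex \<open>m'\<close>: it is an
    end of side \<open>m\<close>.\<close>
  have hits: "m' = m \<or> m' = Suc m mod (4 * g)"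
    if "support g m (bd g (real m' + v)) = 1" "0 \<le> v" "v < 1" "m < 4 * g" "m' < 4 * g" for m m' v
  proof -
    have "(1 - v) * support g m (polygon_vertex g m') + v * support g m (polygon_vertex g (Suc m')) = 1"
      using that(1) bd_add[of v g m'] that(2,3) by (simp add: linepath_def support_linear)
    moreover have "support g m (polygon_vertex g (Suc m')) \<le> 1"
      using support_polygon[OF assms(1) that(4) vertex_in_polygon[OF assms(1)]] .
    then have "v * support g m (polygon_vertex g (Suc m')) \<le> v" using that(2) mult_left_le by blast
    ultimately have "1 - v \<le> (1 - v) * support g m (polygon_vertex g m')" by simp
    then have "1 \<le> support g m (polygon_vertex g m')" using that(3) by simp
    then show ?thesis
      using support_vertex[OF assms(1) that(4,5)] by auto
  qed
  have "k' = k \<or> k' = Suc k mod (4 * g)" "k = k' \<or> k = Suc k' mod (4 * g)"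
    using hits r(2,3) t t' by auto
  \<comment> \<open>Two different sides cannot each be the cyclic successor of the other when there
    are at least four sides.\<close>
  then have kk: "k = k'" using t(4) t'(4) assms(1) by (auto simp: mod_Suc split: if_splits) presburger+
  have "bd g t = bd g t'" using eq r(1) assms(3) by simp
  moreover have "polygon_vertex g k \<noteq> polygon_vertex g (Suc k)"
  proof
    assume "polygon_vertex g k = polygon_vertex g (Suc k)"
    then have "support g (Suc k mod (4 * g)) (polygon_vertex g k) = 1"
      using support_vertex(2)[OF assms(1), of "Suc k mod (4 * g)" "Suc k mod (4 * g)"] polygon_vertex_mod[OF assms(1), of "Suc k"] assms(1)
      by simp
    then show False
      using support_vertex(2)[OF assms(1), of "Suc k mod (4 * g)" k] t(4) assms(1) by (auto simp: mod_Suc split: if_splits) presburger+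
  qed
  moreover have "linepath (polygon_vertex g k) (polygon_vertex g (Suc k)) u
      - linepath (polygon_vertex g k) (polygon_vertex g (Suc k)) u'
      = (u - u') *\<^sub>R (polygon_vertex g (Suc k) - polygon_vertex g k)"
    by (simp add: linepath_def algebra_simps)
  ultimately have "u = u'"
    using t t' bd_add[of u g k] bd_add[of u' g k] by (simp add: kk)
  then show ?thesis using r(1) kk t t' by simp
qed

text \<open>\<open>z\<close> lies in the sector between two consecutive vertices. Its coefficients
  \<open>p\<close> and \<open>m\<close> with respect to them come from \<open>cis a * sin \<theta> =
  sin (\<theta> - a) + sin a * cis \<theta>\<close>; their sum is the radius, and
  \<open>m / (p + m)\<close> is the position on the side.\<close>

lemma polar_exists:
  assumes "1 \<le> g" "z \<noteq> 0"
  obtains r t where "0 < r" "0 \<le> t" "t < real (4 * g)" "z = of_real r * bd g t"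
proof -
  let ?N = "real (4 * g)"
  define \<theta> where "\<theta> = 2 * pi / ?N"
  have N: "4 \<le> ?N" using assms by simp
  have N\<theta>: "?N * \<theta> = 2 * pi" using N by (simp add: \<theta>_def)
  have \<theta>: "0 < \<theta>" "\<theta> < pi" using N pi_gt_zero unfolding \<theta>_def by (auto simp: field_simps)
  have sp: "0 < sin \<theta>" using \<theta> by (intro sin_gt_zero) auto
  define \<phi> where "\<phi> = Arg2pi z"
  have \<phi>: "0 \<le> \<phi>" "\<phi> < ?N * \<theta>" "z = of_real (norm z) * cis \<phi>"
    using Arg2pi[of z] N\<theta> unfolding \<phi>_def by (auto simp: cis_conv_exp mult.commute is_Arg_def)
  have "0 \<le> \<phi> / \<theta>" "\<phi> / \<theta> < ?N" using \<phi> \<theta> by (auto simp: field_simps)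
  then obtain k u where k: "\<phi> / \<theta> = real k + u" "0 \<le> u" "u < 1" "k < 4 * g" by (rule real_floor_cases)
  define a where "a = u * \<theta>"
  have a: "0 \<le> a" "a < \<theta>" "\<phi> = real k * \<theta> + a"
    using k \<theta> by (auto simp: a_def field_simps)
  define p where "p = norm z * sin (\<theta> - a) / sin \<theta>"
  define m where "m = norm z * sin a / sin \<theta>"
  have p: "0 < p" unfolding p_def using a \<theta> sp assms(2) by (auto intro!: divide_pos_pos mult_pos_pos sin_gt_zero)
  have m: "0 \<le> m" unfolding m_def using a \<theta> sp by (auto intro!: divide_nonneg_pos mult_nonneg_nonneg sin_ge_zero)
  have "cis a * of_real (sin \<theta>) = of_real (sin (\<theta> - a)) + of_real (sin a) * cis \<theta>"
    by (simp add: complex_eq_iff sin_diff)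
  then have cisa: "cis a = of_real (sin (\<theta> - a) / sin \<theta>) + of_real (sin a / sin \<theta>) * cis \<theta>"
    using sp by (simp add: field_simps)
  have V: "polygon_vertex g i = cis (real i * \<theta>)" for i
    by (simp add: polygon_vertex_def \<theta>_def field_simps)
  have "z = of_real (norm z) * (cis (real k * \<theta>) * cis a)"
    using \<phi>(3) unfolding a(3) cis_mult .
  also have "\<dots> = of_real p * polygon_vertex g k + of_real m * polygon_vertex g (Suc k)"
  proof -
    have "polygon_vertex g (Suc k) = cis (real k * \<theta>) * cis \<theta>"
      unfolding V cis_mult by (simp add: algebra_simps)
    then show ?thesis unfolding cisa p_def m_def V[of k] by (simp add: algebra_simps)
  qed
  finally have z: "z = of_real p * polygon_vertex g k + of_real m * polygon_vertex g (Suc k)" .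
  define v where "v = m / (p + m)"
  have v: "0 \<le> v" "v < 1" using p m by (auto simp: v_def field_simps)
  have "of_real (p + m) * bd g (real k + v) = of_real ((p + m) * (1 - v)) * polygon_vertex g k + of_real ((p + m) * v) * polygon_vertex g (Suc k)"
  proof -
    have "bd g (real k + v) = of_real (1 - v) * polygon_vertex g k + of_real v * polygon_vertex g (Suc k)"
      using bd_add[of v g k] v by (simp add: linepath_def scaleR_conv_of_real)
    show ?thesis unfolding \<open>bd g (real k + v) = _\<close> by (simp add: algebra_simps)
  qed
  also have "(p + m) * v = m" using p m by (simp add: v_def)
  also have "(p + m) * (1 - v) = p" using p m by (simp add: v_def field_simps)
  finally have "z = of_real (p + m) * bd g (real k + v)" using z by simp
  moreover have "real k + v < ?N" using v k(4) by linarith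
  ultimately show ?thesis using that[of "p + m" "real k + v"] p m v by simp
qed

lemma zero_in_polygon: assumes "1 \<le> g" shows "0 \<in> polygon g"
proof -
  have "polygon_vertex g (2 * g) = - polygon_vertex g 0"
    using assms by (simp add: polygon_vertex_def complex_eq_iff)
  then have "(0::complex) = (1 - 1/2) *\<^sub>R polygon_vertex g 0 + (1/2) *\<^sub>R polygon_vertex g (2 * g)" by simp
  also have "\<dots> \<in> polygon g"
    by (intro convexD_alt[OF convex_polygon] vertex_in_polygon assms) auto
  finally show ?thesis .
qed

lemma scaled_bd_in_polygon_iff:
  assumes "1 \<le> g" "0 \<le> r" "0 \<le> t" "t < real (4 * g)"
  shows "of_real r * bd g t \<in> polygon g \<longleftrightarrow> r \<le> 1"
proof
  assume *: "of_real r * bd g t \<in> polygon g"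
  obtain k u where t: "t = real k + u" "0 \<le> u" "u < 1" "k < 4 * g" using assms(3,4) by (rule real_floor_cases)
  have "support g k (of_real r * bd g t) \<le> 1" by (rule support_polygon[OF assms(1) t(4) *])
  then show "r \<le> 1" using support_bd[OF assms(1) t(4), of u] t by (simp add: support_scale)
next
  assume "r \<le> 1"
  then show "of_real r * bd g t \<in> polygon g"
    using convexD_alt[OF convex_polygon zero_in_polygon[OF assms(1)] bd_in_polygon[OF assms(1)], of r t] assms(2)
    by (simp add: scaleR_conv_of_real)
qed

text \<open>The radius is the inradius of the polygon, whose vertices lie on the unit circle: the
  normal of a side makes the angle \<open>pi / (4 * g)\<close> with the directions of its
  ends.\<close>

lemma polygon_ball: assumes "1 \<le> g" shows "ball 0 (cos (pi / real (4 * g))) \<subseteq> polygon g"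
proof
  fix z :: complex assume z: "z \<in> ball 0 (cos (pi / real (4 * g)))"
  show "z \<in> polygon g"
  proof (cases "z = 0")
    case False
    then obtain r t where rt: "0 < r" "0 \<le> t" "t < real (4 * g)" "z = of_real r * bd g t"
      by (rule polar_exists[OF assms])
    obtain k u where t: "t = real k + u" "0 \<le> u" "u < 1" "k < 4 * g" using rt(2,3) by (rule real_floor_cases)
    have "z \<bullet> cis (2 * pi * (real k + 1/2) / real (4 * g)) \<le> norm z"
      using norm_cauchy_schwarz[of z "cis (2 * pi * (real k + 1/2) / real (4 * g))"] by simp
    then have "support g k z \<le> 1"
      using z cos_pi_pos[OF assms] by (simp add: support_def)
    then have "r \<le> 1" using support_bd[OF assms t(4), of u] t unfolding rt(4) by (simp add: support_scale)
    then show ?thesis using scaled_bd_in_polygon_iff[OF assms, of r t] rt by simp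
  qed (use zero_in_polygon[OF assms] in simp)
qed

lemma zero_in_interior_polygon: "1 \<le> g \<Longrightarrow> 0 \<in> interior (polygon g)"
  using polygon_ball[of g] cos_pi_pos[of g] by (metis centre_in_ball interior_maximal open_ball subsetD)

lemma scaled_bd_in_interior_iff:
  assumes "1 \<le> g" "0 \<le> r" "0 \<le> t" "t < real (4 * g)"
  shows "of_real r * bd g t \<in> interior (polygon g) \<longleftrightarrow> r < 1"
proof
  assume "r < 1"
  have "bd g t - (1 - r) *\<^sub>R (bd g t - 0) \<in> interior (polygon g)"
    by (rule mem_interior_convex_shrink[OF convex_polygon zero_in_interior_polygon[OF assms(1)] bd_in_polygon[OF assms(1)]])
      (use assms \<open>r < 1\<close> in auto)
  then show "of_real r * bd g t \<in> interior (polygon g)"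
    by (simp add: scaleR_conv_of_real algebra_simps)
next
  assume *: "of_real r * bd g t \<in> interior (polygon g)"
  show "r < 1"
  proof (rule ccontr)
    assume "\<not> r < 1"
    then have r: "r = 1" using * scaled_bd_in_polygon_iff[OF assms] interior_subset by (metis antisym_conv1 not_less subsetD)
    have "bd g t \<noteq> 0"
      using polar_unique[OF assms(1), of 1 2 t t] assms by auto
    from * r obtain e where e: "e > 0" "ball (bd g t) e \<subseteq> polygon g" by (auto simp: mem_interior)
    define d where "d = e / (2 * norm (bd g t))"
    have d: "d > 0" using e \<open>bd g t \<noteq> 0\<close> by (simp add: d_def)
    have "dist (bd g t) (of_real (1 + d) * bd g t) = d * norm (bd g t)"
      using d by (simp add: dist_norm algebra_simps norm_mult)
    also have "\<dots> < e" using e \<open>bd g t \<noteq> 0\<close> by (simp add: d_def)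
    finally have "of_real (1 + d) * bd g t \<in> polygon g" using e(2) by auto
    then show False using scaled_bd_in_polygon_iff[OF assms(1), of "1 + d" t] assms d by simp
  qed
qed

section \<open>Moving finite sets of points\<close>

text \<open>A compact set is closed in a Hausdorff space, so the chart domain \<open>U\<close> and
  the complement of the image of \<open>K\<close> form an open cover of \<open>X\<close>. On the
  overlap the conjugate of \<open>H\<close> is the identity, and the two pieces paste.\<close>

lemma continuous_map_chart_extension:
  fixes f :: "'a \<Rightarrow> complex"
  assumes X: "Hausdorff_space X" and U: "openin X U"
    and fk: "homeomorphic_maps (subtopology X U) euclidean f k"
    and K: "compact K" and H: "continuous_on UNIV H" "\<And>z. z \<notin> K \<Longrightarrow> H z = z"
  shows "continuous_map X X (\<lambda>y. if y \<in> U then k (H (f y)) else y)"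
proof -
  let ?h = "\<lambda>y. if y \<in> U then k (H (f y)) else y"
  have UX: "U \<subseteq> topspace X" by (rule openin_subset[OF U])
  have f: "continuous_map (subtopology X U) euclidean f" and k: "continuous_map euclidean (subtopology X U) k"
    and kf: "\<And>y. y \<in> U \<Longrightarrow> k (f y) = y"
    using fk UX by (auto simp: homeomorphic_maps_def)
  have kX: "continuous_map euclidean X k" and kU: "\<And>z. k z \<in> U"
    using k by (auto simp: continuous_map_in_subtopology Pi_iff image_subset_iff)
  have "compactin X (k ` K)"
    by (rule image_compactin[OF _ kX]) (use K in simp)
  then have closed: "closedin X (k ` K)" by (rule compactin_imp_closedin[OF X])
  define T where "T b = (if b then U else topspace X - k ` K)" for b
  define g where "g b = (if b then k \<circ> H \<circ> f else id)" for b
  show ?thesis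
  proof (rule pasting_lemma[where I = UNIV and T = T and f = g])
    show "openin X (T b)" for b using U closed by (auto simp: T_def)
    show "continuous_map (subtopology X (T b)) X (g b)" for b
    proof (cases b)
      case True
      have "continuous_map (subtopology X U) X (k \<circ> H \<circ> f)"
        by (intro continuous_map_compose[OF f] continuous_map_compose[OF _ kX]) (use H in simp)
      then show ?thesis using True by (simp add: T_def g_def)
    qed (simp add: T_def g_def continuous_map_from_subtopology)
    have eq: "k (H (f x)) = x" if "x \<in> U" "x \<notin> k ` K" for x
    proof -
      have "f x \<notin> K" using kf[OF that(1)] that(2) by (metis imageI)
      then show ?thesis using H(2) kf[OF that(1)] by simp
    qed
    show "g a x = g b x" if "x \<in> topspace X \<inter> T a \<inter> T b" for a b x
      using that eq[of x] by (auto simp: T_def g_def split: if_splits)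
    show "\<exists>b. b \<in> UNIV \<and> x \<in> T b \<and> ?h x = g b x" if "x \<in> topspace X" for x
    proof (cases "x \<in> U")
      case True
      then show ?thesis by (intro exI[of _ True]) (simp add: T_def g_def)
    next
      case False
      then have "x \<notin> k ` K" using kU by auto
      then show ?thesis using that False by (intro exI[of _ False]) (simp add: T_def g_def)
    qed
  qed
qed

text \<open>The displacement is supported in a closed ball of the chart that avoids
  \<open>F\<close>; closed balls are compact, so it extends by the identity. Since \<open>W\<close>
  meets every nonempty open set, it contains a target point inside the ball.\<close>

lemma homeomorphic_map_into_dense:
  assumes X: "Hausdorff_space X" and U: "openin X U" "x \<in> U"
    and chart: "subtopology X U homeomorphic_space (euclidean :: complex topology)"
    and W: "\<And>V. openin X V \<Longrightarrow> V \<noteq> {} \<Longrightarrow> V \<inter> W \<noteq> {}"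
    and F: "finite F" "F \<subseteq> topspace X" "x \<notin> F"
  shows "\<exists>h. homeomorphic_map X X h \<and> h x \<in> W \<and> (\<forall>y\<in>F. h y = y)"
proof -
  obtain f k where fk: "homeomorphic_maps (subtopology X U) (euclidean :: complex topology) f k"
    using chart unfolding homeomorphic_space_def by blast
  have UX: "U \<subseteq> topspace X" by (rule openin_subset[OF U(1)])
  have f: "continuous_map (subtopology X U) euclidean f" and k: "continuous_map euclidean (subtopology X U) k"
    and kf: "\<And>y. y \<in> U \<Longrightarrow> k (f y) = y" and fk': "\<And>z. f (k z) = z"
    using fk UX by (auto simp: homeomorphic_maps_def)
  have kU: "\<And>z. k z \<in> U"
    using k by (auto simp: continuous_map_in_subtopology Pi_iff image_subset_iff)
  have "closedin X F" by (rule closedin_Hausdorff_finite[OF X F(2,1)])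
  then have "openin (subtopology X U) (U - F)"
    using U(1) by (metis Diff_subset openin_diff openin_open_subtopology)
  from openin_continuous_map_preimage[OF k this]
  have "open {z. k z \<in> U - F}" by simp
  moreover have "f x \<in> {z. k z \<in> U - F}" using kf U F by simp
  ultimately obtain e where e: "e > 0" "cball (f x) e \<subseteq> {z. k z \<in> U - F}"
    using open_contains_cball_eq by blast
  define B where "B = {y \<in> topspace (subtopology X U). f y \<in> ball (f x) e}"
  have "openin (subtopology X U) B"
    unfolding B_def by (rule openin_continuous_map_preimage[OF f]) simp
  then have "openin X B" by (rule openin_trans_full[OF _ U(1)])
  moreover have "x \<in> B" using e(1) U UX by (auto simp: B_def)
  ultimately have "B \<inter> W \<noteq> {}" by (intro W) auto
  then obtain w where w: "w \<in> W" "w \<in> U" "f w \<in> ball (f x) e" by (auto simp: B_def)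
  have aff: "affine hull (ball (f x) e) = UNIV"
    using e(1) by (simp add: affine_hull_open)
  have "openin (top_of_set (affine hull ball (f x) e)) (ball (f x) e)" unfolding aff by simp
  then obtain H H' where H: "homeomorphism UNIV UNIV H H'" "H (f x) = f w"
    and HB: "{z. \<not> (H z = z \<and> H' z = z)} \<subseteq> ball (f x) e"
    by (rule homeomorphism_moving_point[of "ball (f x) e" UNIV "f x" "f w"]) (use w e aff in simp_all)
  have out: "H z = z" "H' z = z" if "z \<notin> cball (f x) e" for z
    using HB that by (auto simp: subset_iff)
  have inv: "H' (H z) = z" "H (H' z) = z" for z using H(1) by (auto simp: homeomorphism_def)
  let ?h = "\<lambda>H y. if y \<in> U then k (H (f y)) else y"
  have "homeomorphic_maps X X (?h H) (?h H')"
    unfolding homeomorphic_maps_def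
  proof (intro conjI ballI)
    show "continuous_map X X (?h H)" "continuous_map X X (?h H')"
      by (rule continuous_map_chart_extension[OF X U(1) fk, of "cball (f x) e"];
        use H(1) out in \<open>simp add: homeomorphism_def\<close>)+
  qed (simp_all add: kU fk' inv kf)
  moreover have "?h H x \<in> W" using U(2) H(2) w kf by simp
  moreover have "?h H y = y" if "y \<in> F" for y
  proof (cases "y \<in> U")
    case True
    then have "f y \<notin> cball (f x) e" using e(2) that kf[OF True] by auto
    then show ?thesis using True out kf by simp
  qed simp
  ultimately show ?thesis unfolding homeomorphic_map_maps by blast
qed

text \<open>Induction on the number of points outside \<open>W\<close>: one point is moved in and
  all others are fixed, so points already in \<open>W\<close> remain there.\<close>

lemma homeomorphic_map_finite_into_dense:
  assumes X: "Hausdorff_space X"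
    and chart: "\<And>x. x \<in> topspace X \<Longrightarrow> \<exists>U. openin X U \<and> x \<in> U \<and>
        subtopology X U homeomorphic_space (euclidean :: complex topology)"
    and W: "\<And>V. openin X V \<Longrightarrow> V \<noteq> {} \<Longrightarrow> V \<inter> W \<noteq> {}"
    and N: "finite N" "N \<subseteq> topspace X"
  shows "\<exists>h. homeomorphic_map X X h \<and> h ` N \<subseteq> W"
  using N
proof (induction "card (N - W)" arbitrary: N rule: less_induct)
  case less
  show ?case
  proof (cases "N \<subseteq> W")
    case True
    then show ?thesis by (intro exI[of _ id]) (simp add: homeomorphic_map_id)
  next
    case False
    then obtain x where x: "x \<in> N" "x \<notin> W" by auto
    then obtain U where "openin X U" "x \<in> U" "subtopology X U homeomorphic_space (euclidean :: complex topology)"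
      using chart less.prems by blast
    then obtain h where h: "homeomorphic_map X X h" "h x \<in> W" "\<forall>y\<in>N - {x}. h y = y"
      using homeomorphic_map_into_dense[OF X _ _ _ W, of U x "N - {x}"] less.prems by blast
    have "h ` N - W \<subseteq> (N - W) - {x}"
    proof
      fix z assume "z \<in> h ` N - W"
      then obtain y where y: "y \<in> N" "z = h y" "h y \<notin> W" by blast
      then have "y \<noteq> x" using h(2) by blast
      then have "h y = y" using h(3) y(1) by blast
      then show "z \<in> (N - W) - {x}" using y \<open>y \<noteq> x\<close> by simp
    qed
    then have "card (h ` N - W) < card (N - W)"
      using x less.prems(1) card_mono[of "N - W - {x}" "h ` N - W"] card_Diff1_less[of "N - W" x] by simp
    moreover have "h ` N \<subseteq> topspace X"
      using less.prems(2) h(1) by (metis homeomorphic_imp_surjective_map image_mono)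
    ultimately obtain h' where h': "homeomorphic_map X X h'" "h' ` h ` N \<subseteq> W"
      using less.hyps[of "h ` N"] less.prems by auto
    then show ?thesis
      using homeomorphic_map_compose[OF h(1) h'(1)] by (intro exI[of _ "h' \<circ> h"]) (simp add: image_comp)
  qed
qed

section \<open>The side pairing\<close>

text \<open>The sides of the polygon are numbered by their initial vertices.\<close>

definition mate :: "nat \<Rightarrow> nat" where
  "mate k = (if k mod 4 < 2 then k + 2 else k - 2)"

lemma mate_cases:
  obtains "k mod 4 < 2" "mate k = k + 2" "\<not> (k + 2) mod 4 < 2"
  | m where "k = m + 2" "mate k = m" "m mod 4 < 2" "\<not> k mod 4 < 2"
proof (cases "k mod 4 < 2")
  case True
  moreover have "\<not> (k + 2) mod 4 < 2" using True by presburger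
  ultimately show ?thesis by (intro that(1)) (simp_all add: mate_def)
next
  case False
  then have "2 \<le> k" by (metis less_imp_le_nat mod_less not_less numeral_le_iff order_less_le_trans semiring_norm(69,72))
  then obtain m where m: "k = m + 2" by (metis add.commute le_iff_add)
  moreover have "m mod 4 < 2" using False unfolding m by presburger
  ultimately show ?thesis using False by (intro that(2)) (simp_all add: mate_def)
qed

lemma mate_mate: "mate (mate k) = k"
  by (rule mate_cases[of k]) (simp_all add: mate_def)

lemma mate_neq: "mate k \<noteq> k"
  by (rule mate_cases[of k]) simp_all

lemma mate_less:
  assumes "k < 4 * g" shows "mate k < 4 * g"
proof (rule mate_cases[of k])
  assume "k mod 4 < 2" "mate k = k + 2"
  moreover from this(1) assms have "k + 2 < 4 * g" by presburger
  ultimately show ?thesis by simp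
qed (use assms in simp)

text \<open>The parameter avoids 0 and 1. Away from the vertices every boundary point has exactly
  one partner, so that the relation is a symmetric partial function. The parameter
  \<open>1 - u\<close> reflects that glued sides run in opposite directions.\<close>

definition glued :: "nat \<Rightarrow> complex \<Rightarrow> complex \<Rightarrow> bool" where
  "glued g x y \<longleftrightarrow> (\<exists>k u. k < 4 * g \<and> 0 < u \<and> u < 1 \<and>
      x = bd g (real k + u) \<and> y = bd g (real (mate k) + (1 - u)))"

lemma glued_sym: "glued g x y \<Longrightarrow> glued g y x"
  unfolding glued_def
proof (elim exE conjE)
  fix k u assume "k < 4 * g" "0 < u" "u < (1::real)" "x = bd g (real k + u)" "y = bd g (real (mate k) + (1 - u))"
  then show "\<exists>k u. k < 4 * g \<and> 0 < u \<and> u < 1 \<and> y = bd g (real k + u) \<and> x = bd g (real (mate k) + (1 - u))"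
    by (intro exI[of _ "mate k"] exI[of _ "1 - u"]) (simp add: mate_mate mate_less)
qed

lemma bd_inject:
  assumes "1 \<le> g" "k < 4 * g" "k' < 4 * g" "0 \<le> u" "u < 1" "0 \<le> u'" "u' < 1"
    and "bd g (real k + u) = bd g (real k' + u')"
  shows "k = k' \<and> u = u'"
proof -
  have "real k + u < real (4 * g)" "real k' + u' < real (4 * g)" using assms(2-7) by linarith+
  then have "real k + u = real k' + u'"
    using polar_unique[OF assms(1), of 1 1 "real k + u" "real k' + u'"] assms by simp
  moreover have "k = k'" using \<open>real k + u = real k' + u'\<close> assms(4-7) by linarith
  ultimately show ?thesis by simp
qed

lemma bd_not_vertex:
  assumes "1 \<le> g" "k < 4 * g" "0 < u" "u < 1"
  shows "bd g (real k + u) \<notin> range (polygon_vertex g)"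
proof
  assume "bd g (real k + u) \<in> range (polygon_vertex g)"
  then obtain m where "bd g (real k + u) = polygon_vertex g m" by blast
  then have "bd g (real k + u) = bd g (real (m mod (4 * g)) + 0)"
    using bd_nat[of g "m mod (4 * g)"] polygon_vertex_mod[OF assms(1), of m] by simp
  then show False
    using bd_inject[OF assms(1,2), of "m mod (4 * g)" u 0] assms by simp
qed

lemma glued_unique:
  assumes "1 \<le> g" "glued g x y" "glued g x z" shows "y = z"
  using assms(2,3) bd_inject[OF assms(1)] unfolding glued_def by (metis less_imp_le)

lemma glued_not_vertex:
  assumes "1 \<le> g" "glued g x y" shows "x \<notin> range (polygon_vertex g)" "y \<notin> range (polygon_vertex g)"
proof -
  have *: "a \<notin> range (polygon_vertex g)" if "glued g a b" for a b
    using that bd_not_vertex[OF assms(1)] unfolding glued_def by (elim exE conjE) simp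
  show "x \<notin> range (polygon_vertex g)" "y \<notin> range (polygon_vertex g)"
    using *[OF assms(2)] *[OF glued_sym[OF assms(2)]] .
qed

text \<open>Closed form of the equivalence relation generated by \<open>edge_glue\<close>: the
  vertices are one class, and every other class has at most two points.\<close>

definition side_rel :: "nat \<Rightarrow> complex \<Rightarrow> complex \<Rightarrow> bool" where
  "side_rel g x y \<longleftrightarrow> x = y \<or> x \<in> range (polygon_vertex g) \<and> y \<in> range (polygon_vertex g) \<or> glued g x y"

lemma linepath_reverse: "linepath a b u = linepath b a (1 - u)"
  by (simp add: linepath_def algebra_simps)

lemma edge_glue_side_rel:
  assumes "1 \<le> g" "edge_glue g x y" shows "side_rel g x y"
proof -
  obtain k u where k: "k < 4 * g" "k mod 4 \<in> {0, 1}" "0 \<le> u" "u \<le> 1"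
    and x: "x = linepath (polygon_vertex g k) (polygon_vertex g (k + 1)) u"
    and y: "y = linepath (polygon_vertex g (k + 3)) (polygon_vertex g (k + 2)) u"
    using assms(2) unfolding edge_glue_def by auto
  consider "u = 0" | "u = 1" | "0 < u" "u < 1" using k by linarith
  then show ?thesis
  proof cases
    case 3
    have "mate k = k + 2" using k by (auto simp: mate_def)
    then have "y = bd g (real (mate k) + (1 - u))"
      using bd_add[of "1 - u" g "k + 2"] 3 unfolding y linepath_reverse[of _ _ u] by (simp add: numeral_3_eq_3)
    moreover have "x = bd g (real k + u)" using bd_add[of u g k] 3 by (simp add: x)
    ultimately show ?thesis unfolding side_rel_def glued_def using k 3 by blast
  qed (auto simp: side_rel_def x y linepath_def)
qed

text \<open>\<open>side_rel\<close> is transitive because partners are unique and a glued point is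
  never a vertex.\<close>

lemma equivclp_edge_glue_side_rel:
  assumes g: "1 \<le> g" and "equivclp (edge_glue g) x y" shows "side_rel g x y"
  using assms(2) unfolding equivclp_def
proof (induction rule: rtranclp_induct)
  case base
  then show ?case by (simp add: side_rel_def)
next
  case (step y z)
  have sym: "side_rel g b a" if "side_rel g a b" for a b
    using that glued_sym unfolding side_rel_def by blast
  have "side_rel g y z"
    using step(2) edge_glue_side_rel[OF g] sym unfolding symclp_def by blast
  with step(3) show ?case
    using glued_unique[OF g] glued_not_vertex[OF g] glued_sym[of g]
    unfolding side_rel_def by metis
qed

lemma equivclp_glued:
  assumes "glued g x y" shows "equivclp (edge_glue g) x y"
proof -
  have main: "edge_glue g x y" if k: "k < 4 * g" "k mod 4 < 2" "0 < u" "u < (1::real)"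
    and xy: "x = bd g (real k + u)" "y = bd g (real (mate k) + (1 - u))" for k u x y
  proof -
    have "mate k = k + 2" using k by (auto simp: mate_def)
    then have "y = linepath (polygon_vertex g (k + 3)) (polygon_vertex g (k + 2)) u"
      using bd_add[of "1 - u" g "k + 2"] k unfolding xy linepath_reverse[of _ _ u] by (simp add: numeral_3_eq_3)
    moreover have "x = linepath (polygon_vertex g k) (polygon_vertex g (k + 1)) u"
      using bd_add[of u g k] k by (simp add: xy)
    moreover have "k mod 4 \<in> {0, 1}" using k by auto
    ultimately show ?thesis using k unfolding edge_glue_def by force
  qed
  obtain k u where k: "k < 4 * g" "0 < u" "u < 1" "x = bd g (real k + u)" "y = bd g (real (mate k) + (1 - u))"
    using assms unfolding glued_def by blast
  have "edge_glue g x y \<or> edge_glue g y x"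
  proof (cases "k mod 4 < 2")
    case True
    then show ?thesis using main k by blast
  next
    case False
    then have "mate k mod 4 < 2" by (cases k rule: mate_cases) simp_all
    then have "edge_glue g y x"
      using main[of "mate k" "1 - u" y x] k by (simp add: mate_mate mate_less)
    then show ?thesis by blast
  qed
  then show ?thesis unfolding equivclp_def symclp_def by blast
qed

text \<open>In the block of four sides after vertex \<open>4 * m\<close> the gluings lead from
  \<open>4 * m\<close> to \<open>4 * m + 3\<close>, then to \<open>4 * m + 2\<close>,
  \<open>4 * m + 1\<close> and finally \<open>4 * m + 4\<close>, which starts the next
  block.\<close>

lemma equivclp_vertices:
  assumes "1 \<le> g" shows "equivclp (edge_glue g) (polygon_vertex g i) (polygon_vertex g j)"
proof -
  let ?V = "polygon_vertex g" let ?R = "equivclp (edge_glue g)"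
  have e: "?R (?V k) (?V (k + 3))" "?R (?V (k + 1)) (?V (k + 2))"
    if "k < 4 * g" "k mod 4 \<in> {0, 1}" for k
  proof -
    have "edge_glue g (?V k) (?V (k + 3))" unfolding edge_glue_def
      using that by (intro exI[of _ k] conjI bexI[of _ 0]) (auto simp: linepath_def)
    moreover have "edge_glue g (?V (k + 1)) (?V (k + 2))" unfolding edge_glue_def
      using that by (intro exI[of _ k] conjI bexI[of _ 1]) (auto simp: linepath_def)
    ultimately show "?R (?V k) (?V (k + 3))" "?R (?V (k + 1)) (?V (k + 2))"
      unfolding equivclp_def symclp_def by blast+
  qed
  have tr: "?R x z" if "?R x y" "?R y z" for x y z using that by (metis equivclp_trans)
  have sy: "?R y x" if "?R x y" for x y using that by (rule equivclp_sym)
  have block: "?R (?V (4 * m)) (?V (4 * m + r))" if "m < g" "r \<le> 4" for m r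
  proof -
    have m1: "4 * m < 4 * g" using that(1) by simp
    have m2: "4 * m mod 4 \<in> {0, 1}" by simp
    have m3: "4 * m + 1 < 4 * g" using that(1) by linarith
    have m4: "(4 * m + 1) mod 4 \<in> {0, 1}" by (simp add: mod_Suc)
    have a: "?R (?V (4 * m)) (?V (4 * m + 3))" "?R (?V (4 * m + 1)) (?V (4 * m + 2))"
      using e[OF m1 m2] by auto
    have *: "4 * m + 1 + 3 = 4 * m + 4" "4 * m + 1 + 1 = 4 * m + 2" "4 * m + 1 + 2 = 4 * m + 3" by simp_all
    have b: "?R (?V (4 * m + 1)) (?V (4 * m + 4))" "?R (?V (4 * m + 2)) (?V (4 * m + 3))"
      using e[OF m3 m4] unfolding * by auto
    have r2: "?R (?V (4 * m)) (?V (4 * m + 2))" by (rule tr[OF a(1) sy[OF b(2)]])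
    have r1: "?R (?V (4 * m)) (?V (4 * m + 1))" by (rule tr[OF r2 sy[OF a(2)]])
    have r4: "?R (?V (4 * m)) (?V (4 * m + 4))" by (rule tr[OF r1 b(1)])
    have r0: "?R (?V (4 * m)) (?V (4 * m + 0))" by (simp add: equivclp_def)
    consider "r = 0" | "r = 1" | "r = 2" | "r = 3" | "r = 4" using \<open>r \<le> 4\<close> by linarith
    then show ?thesis by cases (simp_all only: r0 r1 r2 a(1) r4)
  qed
  have mult4: "?R (?V 0) (?V (4 * m))" if "m \<le> g" for m
    using that
  proof (induction m)
    case (Suc m)
    then have "?R (?V 0) (?V (4 * m))" "?R (?V (4 * m)) (?V (4 * m + 4))" using block[of m 4] by auto
    then have "?R (?V 0) (?V (4 * m + 4))" by (rule tr)
    then show ?case by (simp add: add.commute)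
  qed (simp add: equivclp_def)
  have all: "?R (?V 0) (?V k)" if "k < 4 * g" for k
  proof -
    have k: "k = 4 * (k div 4) + k mod 4" "k div 4 < g" "k mod 4 \<le> 4" using that by auto
    show ?thesis
      using tr[OF mult4[OF less_imp_le[OF k(2)]] block[OF k(2,3)]] k(1) by simp
  qed
  have "?R (?V 0) (?V k)" for k
    using all[of "k mod (4 * g)"] polygon_vertex_mod[OF assms, of k] assms by simp
  then show ?thesis using tr sy by metis
qed

section \<open>The surface as a quotient of the polygon\<close>

locale glued_polygon =
  fixes g :: nat and X :: "'a topology" and q :: "complex \<Rightarrow> 'a"
  assumes g: "1 \<le> g" and X: "closed_surface X"
    and q: "quotient_map (top_of_set (polygon g)) X q"
    and q_eq: "\<And>x y. x \<in> polygon g \<Longrightarrow> y \<in> polygon g \<Longrightarrow> q x = q y \<longleftrightarrow> equivclp (edge_glue g) x y"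
begin

lemma q_eq_side_rel: "x \<in> polygon g \<Longrightarrow> y \<in> polygon g \<Longrightarrow> q x = q y \<Longrightarrow> side_rel g x y"
  using q_eq equivclp_edge_glue_side_rel[OF g] by blast

lemma q_glued: "glued g x y \<Longrightarrow> q x = q y"
  using q_eq[of x y] equivclp_glued[of g x y] bd_in_polygon[OF g] unfolding glued_def by auto

lemma q_vertices: "q (polygon_vertex g i) = q (polygon_vertex g j)"
  using q_eq equivclp_vertices[OF g] vertex_in_polygon[OF g] by blast

lemma q_image: "q ` polygon g = topspace X"
  using q by (simp add: quotient_map_def)

lemma bd_not_interior: "0 \<le> t \<Longrightarrow> t < real (4 * g) \<Longrightarrow> bd g t \<notin> interior (polygon g)"
  using scaled_bd_in_interior_iff[OF g, of 1 t] by simp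

lemma side_rel_not_interior:
  assumes "side_rel g x y" "x \<noteq> y" shows "x \<notin> interior (polygon g)" "y \<notin> interior (polygon g)"
proof -
  have V: "polygon_vertex g i \<notin> interior (polygon g)" for i
  proof -
    have "i mod (4 * g) < 4 * g" using g by simp
    then have "real (i mod (4 * g)) < real (4 * g)" by (simp only: of_nat_less_iff)
    then show ?thesis
      using bd_not_interior[of "real (i mod (4 * g))"] bd_nat[of g "i mod (4 * g)"] polygon_vertex_mod[OF g, of i]
      by simp
  qed
  have G: "a \<notin> interior (polygon g)" if ab: "glued g a b" for a b
  proof -
    obtain k u where "k < 4 * g" "0 < u" "u < 1" "a = bd g (real k + u)"
      using ab unfolding glued_def by blast
    moreover from this have "real k + u < real (4 * g)" by linarith
    ultimately show ?thesis using bd_not_interior[of "real k + u"] by simp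
  qed
  show "x \<notin> interior (polygon g)" "y \<notin> interior (polygon g)"
    using assms V G glued_sym unfolding side_rel_def by blast+
qed

lemma q_interior_eq:
  assumes "x \<in> interior (polygon g)" "y \<in> polygon g" "q x = q y" shows "x = y"
  using assms q_eq_side_rel side_rel_not_interior interior_subset by blast

text \<open>The preimage of \<open>V\<close> is relatively open in the polygon, and a convex set
  with nonempty interior is contained in the closure of that interior. This makes the image of the
  interior a target for \<open>homeomorphic_map_finite_into_dense\<close>.\<close>

lemma dense_interior:
  assumes "openin X V" "V \<noteq> {}" shows "V \<inter> q ` interior (polygon g) \<noteq> {}"
proof -
  have VX: "V \<subseteq> topspace X" using assms(1) by (rule openin_subset)
  have "openin (top_of_set (polygon g)) {x \<in> topspace (top_of_set (polygon g)). q x \<in> V}"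
    using q assms(1) VX unfolding quotient_map_def by blast
  then obtain T where T: "open T" "{x \<in> polygon g. q x \<in> V} = polygon g \<inter> T"
    by (auto simp: openin_open)
  obtain v where v: "v \<in> V" using assms(2) by auto
  then obtain x where "x \<in> polygon g" "q x = v" using VX q_image by (metis imageE subsetD)
  then have x: "x \<in> polygon g \<inter> T" using T v by auto
  have "closure (interior (polygon g)) = closure (polygon g)"
    using convex_closure_interior[OF convex_polygon] zero_in_interior_polygon[OF g] by blast
  then have "x \<in> closure (interior (polygon g))" using x closure_subset by blast
  then obtain y where "y \<in> T" "y \<in> interior (polygon g)"
    using x T(1) by (metis IntD2 Int_iff closure_iff_nhds_not_empty disjoint_iff interior_open interior_subset)
  then have "q y \<in> V" using T(2) interior_subset by blast
  then show ?thesis using \<open>y \<in> interior (polygon g)\<close> by blast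
qed

text \<open>Two different points with the same image lie outside the interior, where the map is the
  identity, so it respects the gluing and descends to \<open>X\<close>. The same applies to its
  inverse.\<close>

lemma homeomorphic_map_from_polygon:
  assumes f: "homeomorphism (polygon g) (polygon g) f f'"
    and fix_out: "{x. \<not> (f x = x \<and> f' x = x)} \<subseteq> interior (polygon g)"
  shows "\<exists>F. homeomorphic_map X X F \<and> (\<forall>x\<in>polygon g. F (q x) = q (f x))"
proof -
  have lift: "\<exists>F. continuous_map X X F \<and> (\<forall>x\<in>polygon g. F (q x) = q (h x))"
    if h: "continuous_on (polygon g) h" "h ` polygon g = polygon g" "{x. h x \<noteq> x} \<subseteq> interior (polygon g)" for h
  proof -
    have "continuous_map (top_of_set (polygon g)) (top_of_set (polygon g)) h"
      using h by auto
    then have c: "continuous_map (top_of_set (polygon g)) X (q \<circ> h)"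
      by (rule continuous_map_compose[OF _ quotient_imp_continuous_map[OF q]])
    have resp: "(q \<circ> h) x = (q \<circ> h) y"
      if "x \<in> topspace (top_of_set (polygon g))" "y \<in> topspace (top_of_set (polygon g))" "q x = q y" for x y
    proof (cases "x = y")
      case False
      then have "side_rel g x y" using that q_eq_side_rel by simp
      then have "h x = x" "h y = y" using side_rel_not_interior[OF _ False] h(3) by auto
      then show ?thesis using that by simp
    qed simp
    obtain F where F: "continuous_map X X F"
      "F ` topspace X = (q \<circ> h) ` topspace (top_of_set (polygon g))"
      "\<And>x. x \<in> topspace (top_of_set (polygon g)) \<Longrightarrow> F (q x) = (q \<circ> h) x"
      by (rule quotient_map_lift_exists[OF q c]) (erule (2) resp, blast)
    then show ?thesis by (intro exI[of _ F]) simp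
  qed
  have ff: "continuous_on (polygon g) f" "f ` polygon g = polygon g" "{x. f x \<noteq> x} \<subseteq> interior (polygon g)"
    and ff': "continuous_on (polygon g) f'" "f' ` polygon g = polygon g" "{x. f' x \<noteq> x} \<subseteq> interior (polygon g)"
    using f fix_out unfolding homeomorphism_def by blast+
  obtain F where F: "continuous_map X X F" "\<forall>x\<in>polygon g. F (q x) = q (f x)"
    using lift[OF ff] by blast
  obtain F' where F': "continuous_map X X F'" "\<forall>x\<in>polygon g. F' (q x) = q (f' x)"
    using lift[OF ff'] by blast
  have im: "f x \<in> polygon g" "f' x \<in> polygon g" "f' (f x) = x" "f (f' x) = x" if "x \<in> polygon g" for x
    using f that by (auto simp: homeomorphism_def)
  have "homeomorphic_maps X X F F'"
    unfolding homeomorphic_maps_def q_image[symmetric] using F F' im by simp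
  then show ?thesis unfolding homeomorphic_map_maps using F(2) by blast
qed

lemma homeomorphic_map_interior_points:
  assumes "finite M" "M \<subseteq> q ` interior (polygon g)" "N \<subseteq> q ` interior (polygon g)" "finite N" "card M = card N"
  shows "\<exists>h. homeomorphic_map X X h \<and> h ` M = N"
proof -
  let ?I = "interior (polygon g)"
  obtain \<sigma> where \<sigma>: "bij_betw \<sigma> M N" using assms by (metis finite_same_card_bij)
  have "\<forall>m\<in>q ` ?I. \<exists>x. x \<in> ?I \<and> q x = m" by blast
  then obtain a where a: "\<And>m. m \<in> q ` ?I \<Longrightarrow> a m \<in> ?I" "\<And>m. m \<in> q ` ?I \<Longrightarrow> q (a m) = m"
    by metis
  have \<sigma>N: "\<sigma> m \<in> q ` ?I" if "m \<in> M" for m using \<sigma> assms(3) that by (auto simp: bij_betw_def)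
  have pts: "a m \<in> ?I \<and> a (\<sigma> m) \<in> ?I" if "m \<in> M" for m using a(1) \<sigma>N assms(2) that by blast
  have conn: "connected ?I" by (rule convex_connected[OF convex_interior[OF convex_polygon]])
  have pw: "pairwise (\<lambda>i j. a i \<noteq> a j \<and> a (\<sigma> i) \<noteq> a (\<sigma> j)) M"
    unfolding pairwise_def
  proof (intro ballI impI)
    fix i j assume ij: "i \<in> M" "j \<in> M" "i \<noteq> j"
    then have "\<sigma> i \<noteq> \<sigma> j" using \<sigma> by (auto simp: bij_betw_def inj_on_def)
    then show "a i \<noteq> a j \<and> a (\<sigma> i) \<noteq> a (\<sigma> j)"
      using ij a(2) \<sigma>N assms(2) by (metis subsetD)
  qed
  have aff: "affine hull ?I = UNIV"
    by (rule affine_hull_open) (use zero_in_interior_polygon[OF g] in auto)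
  \<comment> \<open>Any bijection between the two finite sets can be realised, since the interior of
    the polygon is open and connected in real dimension 2, where points can be routed around each
    other.\<close>
  obtain f f' where f: "homeomorphism (polygon g) (polygon g) f f'"
    and fa: "\<And>m. m \<in> M \<Longrightarrow> f (a m) = a (\<sigma> m)" and out: "{x. \<not> (f x = x \<and> f' x = x)} \<subseteq> ?I"
    by (rule homeomorphism_moving_points_exists[of ?I "polygon g" M a "\<lambda>m. a (\<sigma> m)"])
      (simp_all add: pts conn pw aff interior_subset assms)
  obtain F where F: "homeomorphic_map X X F" "\<forall>x\<in>polygon g. F (q x) = q (f x)"
    using homeomorphic_map_from_polygon[OF f out] by blast
  have "F m = \<sigma> m" if "m \<in> M" for m
  proof -
    have m: "m \<in> q ` ?I" using that assms(2) by blast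
    have "F (q (a m)) = q (f (a m))" using F(2) a(1)[OF m] interior_subset by blast
    then show ?thesis using a(2)[OF m] a(2)[OF \<sigma>N[OF that]] fa[OF that] by simp
  qed
  then have "F ` M = N" using \<sigma> by (auto simp: bij_betw_def)
  then show ?thesis using F(1) by blast
qed

lemma homeomorphic_map_moving_finite:
  assumes "finite M" "M \<subseteq> topspace X" "finite N" "N \<subseteq> topspace X" "card M = card N"
  shows "\<exists>h. homeomorphic_map X X h \<and> h ` M = N"
proof -
  have H: "Hausdorff_space X" and chart: "\<And>x. x \<in> topspace X \<Longrightarrow> \<exists>U. openin X U \<and> x \<in> U \<and>
        subtopology X U homeomorphic_space (euclidean :: complex topology)"
    using X unfolding closed_surface_def by blast+
  note into = homeomorphic_map_finite_into_dense[OF H chart dense_interior]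
  obtain h where h: "homeomorphic_map X X h" "h ` M \<subseteq> q ` interior (polygon g)"
    using into[of M] assms by blast
  obtain k where k: "homeomorphic_map X X k" "k ` N \<subseteq> q ` interior (polygon g)"
    using into[of N] assms by blast
  have inj: "inj_on h M" "inj_on k N"
    using h(1) k(1) assms by (auto simp: homeomorphic_eq_everything_map intro: inj_on_subset)
  obtain f where f: "homeomorphic_map X X f" "f ` h ` M = k ` N"
    using homeomorphic_map_interior_points[OF _ h(2) k(2)] inj assms by (auto simp: card_image)
  obtain k' where k': "homeomorphic_maps X X k k'" using k(1) homeomorphic_map_maps by blast
  then have k'h: "homeomorphic_map X X k'" by (metis homeomorphic_map_maps homeomorphic_maps_sym)
  have "(k' \<circ> (f \<circ> h)) ` M = k' ` (f ` h ` M)" by (simp add: image_comp comp_assoc)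
  also have "\<dots> = N" unfolding f(2) using k' assms(4) by (force simp: homeomorphic_maps_def image_iff)
  finally have "(k' \<circ> (f \<circ> h)) ` M = N" .
  then show ?thesis
    using homeomorphic_map_compose[OF homeomorphic_map_compose[OF h(1) f(1)] k'h] by blast
qed

text \<open>The homeomorphism is absorbed into the quotient map. Every later construction starts
  from \<open>q\<close>, so replacing \<open>q\<close> by \<open>h \<circ> q\<close> moves the whole
  cone to the prescribed punctures without transporting a triangulation.\<close>

lemma ex_repositioned:
  assumes "finite M" "M \<subseteq> topspace X" "finite A" "A \<subseteq> polygon g" "card (q ` A) = card M"
  shows "\<exists>q'. glued_polygon g X q' \<and> q' ` A = M"
proof -
  have "q ` A \<subseteq> topspace X" using image_mono[OF assms(4), of q] unfolding q_image .
  then obtain h where h: "homeomorphic_map X X h" "h ` q ` A = M"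
    using homeomorphic_map_moving_finite[OF finite_imageI[OF assms(3)] _ assms(1,2,5)] by blast
  have inj: "h x = h y \<longleftrightarrow> x = y" if "x \<in> topspace X" "y \<in> topspace X" for x y
    using h(1) that by (auto simp: homeomorphic_eq_everything_map inj_on_def)
  have "glued_polygon g X (h \<circ> q)"
  proof
    show "quotient_map (top_of_set (polygon g)) X (h \<circ> q)"
      by (rule quotient_map_compose[OF q h(1)[unfolded homeomorphic_map_def, THEN conjunct1]])
    show "(h \<circ> q) x = (h \<circ> q) y \<longleftrightarrow> equivclp (edge_glue g) x y" if "x \<in> polygon g" "y \<in> polygon g" for x y
      using inj[of "q x" "q y"] q_eq[OF that] q_image that by auto
  qed (use g X in auto)
  then show ?thesis using h(2) by (intro exI[of _ "h \<circ> q"]) (simp add: image_comp)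
qed

end

section \<open>Cone triangulations\<close>

text \<open>The corners are the cube roots of unity. They have mutual inner products
  \<open>- 1/2\<close>, so this affine function is 1 at corner \<open>s\<close> and 0 at the other
  two, hence a barycentric coordinate.\<close>

definition bary :: "nat \<Rightarrow> complex \<Rightarrow> real" where
  "bary s z = (1 + 2 * (z \<bullet> corner s)) / 3"

lemma corner_0: "corner 0 = 1"
  and corner_1: "corner (Suc 0) = Complex (- 1 / 2) (sqrt 3 / 2)"
  and corner_2: "corner (Suc (Suc 0)) = Complex (- 1 / 2) (- (sqrt 3 / 2))"
  and corner_3: "corner (Suc (Suc (Suc 0))) = 1"
proof -
  have "cos (2 * pi / 3) = cos (pi - pi / 3)" "sin (2 * pi / 3) = sin (pi - pi / 3)"
    "cos (4 * pi / 3) = cos (pi / 3 + pi)" "sin (4 * pi / 3) = sin (pi / 3 + pi)"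
    by (rule arg_cong[where f = cos] arg_cong[where f = sin]; simp)+
  then have "cos (2 * pi / 3) = - (1 / 2)" "sin (2 * pi / 3) = sqrt 3 / 2"
    "cos (4 * pi / 3) = - (1 / 2)" "sin (4 * pi / 3) = - (sqrt 3 / 2)"
    by (simp_all only: cos_pi_minus sin_pi_minus cos_periodic_pi sin_periodic_pi cos_60 sin_60)
  then show "corner (Suc 0) = Complex (- 1 / 2) (sqrt 3 / 2)"
    "corner (Suc (Suc 0)) = Complex (- 1 / 2) (- (sqrt 3 / 2))"
    by (simp_all add: corner_def complex_eq_iff)
qed (simp_all add: corner_def complex_eq_iff)

lemmas corner_simps = corner_0 corner_1 corner_2 corner_3

lemma bary_affine: "bary s ((1 - u) *\<^sub>R a + u *\<^sub>R b) = (1 - u) * bary s a + u * bary s b"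
proof -
  have "((1 - u) *\<^sub>R a + u *\<^sub>R b) \<bullet> corner s = (1 - u) * (a \<bullet> corner s) + u * (b \<bullet> corner s)"
    by (simp only: inner_add_left inner_scaleR_left)
  then show ?thesis unfolding bary_def by (simp add: field_simps)
qed

lemma bary_corner:
  "bary 0 (corner 0) = 1" "bary 0 (corner (Suc 0)) = 0" "bary 0 (corner (Suc (Suc 0))) = 0"
  "bary (Suc 0) (corner 0) = 0" "bary (Suc 0) (corner (Suc 0)) = 1" "bary (Suc 0) (corner (Suc (Suc 0))) = 0"
  "bary (Suc (Suc 0)) (corner 0) = 0" "bary (Suc (Suc 0)) (corner (Suc 0)) = 0" "bary (Suc (Suc 0)) (corner (Suc (Suc 0))) = 1"
  by (simp_all add: bary_def corner_simps inner_complex_def)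

lemma bary_sum: "bary 0 z + bary (Suc 0) z + bary (Suc (Suc 0)) z = 1"
  by (simp add: bary_def corner_simps inner_complex_def field_simps)

lemma bary_expand:
  "z = bary 0 z *\<^sub>R corner 0 + bary (Suc 0) z *\<^sub>R corner (Suc 0) + bary (Suc (Suc 0)) z *\<^sub>R corner (Suc (Suc 0))"
  by (simp add: bary_def corner_simps inner_complex_def complex_eq_iff field_simps)

lemma bary_inject:
  assumes "bary 0 z = bary 0 w" "bary (Suc 0) z = bary (Suc 0) w" shows "z = w"
proof -
  have "bary (Suc (Suc 0)) z = bary (Suc (Suc 0)) w" using bary_sum[of z] bary_sum[of w] assms by simp
  then show ?thesis using bary_expand[of z] bary_expand[of w] assms by simp
qed

lemma model_triangle_eq: "model_triangle = {z. 0 \<le> bary 0 z \<and> 0 \<le> bary (Suc 0) z \<and> 0 \<le> bary (Suc (Suc 0)) z}"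
proof -
  have "corner ` {..<3} = {corner 0, corner (Suc 0), corner (Suc (Suc 0))}"
    by (auto simp: numeral_3_eq_3 lessThan_Suc)
  then have m: "model_triangle = {u *\<^sub>R corner 0 + v *\<^sub>R corner (Suc 0) + w *\<^sub>R corner (Suc (Suc 0)) | u v w.
      0 \<le> u \<and> 0 \<le> v \<and> 0 \<le> w \<and> u + v + w = 1}"
    unfolding model_triangle_def by (simp only: convex_hull_3)
  show ?thesis
  proof (intro set_eqI iffI)
    fix z assume "z \<in> model_triangle"
    then obtain u v w where uvw: "0 \<le> u" "0 \<le> v" "0 \<le> w" "u + v + w = 1"
      "z = u *\<^sub>R corner 0 + v *\<^sub>R corner (Suc 0) + w *\<^sub>R corner (Suc (Suc 0))"
      unfolding m by blast
    have "u = 1 - v - w" using uvw(4) by simp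
    then have "bary 0 z = u" "bary (Suc 0) z = v" "bary (Suc (Suc 0)) z = w"
      unfolding uvw(5) by (simp_all add: bary_def corner_simps inner_complex_def field_simps)
    then show "z \<in> {z. 0 \<le> bary 0 z \<and> 0 \<le> bary (Suc 0) z \<and> 0 \<le> bary (Suc (Suc 0)) z}"
      using uvw by simp
  next
    fix z assume "z \<in> {z. 0 \<le> bary 0 z \<and> 0 \<le> bary (Suc 0) z \<and> 0 \<le> bary (Suc (Suc 0)) z}"
    then show "z \<in> model_triangle"
      unfolding m using bary_expand[of z] bary_sum[of z] by blast
  qed
qed

lemma continuous_on_bary: "continuous_on S (bary s)"
  unfolding bary_def by (intro continuous_intros) auto

lemma interior_model_triangle:
  "interior model_triangle = {z. 0 < bary 0 z \<and> 0 < bary (Suc 0) z \<and> 0 < bary (Suc (Suc 0)) z}"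
proof
  let ?O = "{z. 0 < bary 0 z \<and> 0 < bary (Suc 0) z \<and> 0 < bary (Suc (Suc 0)) z}"
  have "open {z. 0 < bary s z}" for s
    using open_Collect_less[OF continuous_on_const continuous_on_bary] by blast
  then have "open ?O" by (intro open_Collect_conj)
  moreover have "?O \<subseteq> model_triangle" by (auto simp: model_triangle_eq)
  ultimately show "?O \<subseteq> interior model_triangle" by (simp add: interior_maximal)
  show "interior model_triangle \<subseteq> ?O"
  proof
    fix z assume "z \<in> interior model_triangle"
    then obtain e where e: "e > 0" "ball z e \<subseteq> model_triangle" by (auto simp: mem_interior)
    have "0 < bary s z" if "s \<in> {0, Suc 0, Suc (Suc 0)}" for s
    proof -
      have n: "norm (corner s) = 1" by (simp add: corner_def)
      \<comment> \<open>A move against corner \<open>s\<close> lowers this coordinate by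
        \<open>e / 3\<close> and stays in the ball, so the coordinate was positive.\<close>
      have "z - (e / 2) *\<^sub>R corner s \<in> ball z e" using e by (simp add: dist_norm n)
      then have "z - (e / 2) *\<^sub>R corner s \<in> model_triangle" using e(2) by blast
      then have "0 \<le> bary s (z - (e / 2) *\<^sub>R corner s)" using that by (auto simp: model_triangle_eq)
      also have "bary s (z - (e / 2) *\<^sub>R corner s) = bary s z - e / 3"
        using n by (simp add: bary_def inner_diff_left dot_square_norm field_simps)
      finally show ?thesis using e(1) by simp
    qed
    then show "z \<in> ?O" by simp
  qed
qed

definition side_point :: "nat \<Rightarrow> real \<Rightarrow> complex" where
  "side_point s u = linepath (corner s) (corner (Suc s)) u"

lemma bary_side_point:
  "bary 0 (side_point 0 u) = 1 - u" "bary (Suc 0) (side_point 0 u) = u" "bary (Suc (Suc 0)) (side_point 0 u) = 0"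
  "bary 0 (side_point (Suc 0) u) = 0" "bary (Suc 0) (side_point (Suc 0) u) = 1 - u" "bary (Suc (Suc 0)) (side_point (Suc 0) u) = u"
  "bary 0 (side_point (Suc (Suc 0)) u) = u" "bary (Suc 0) (side_point (Suc (Suc 0)) u) = 0" "bary (Suc (Suc 0)) (side_point (Suc (Suc 0)) u) = 1 - u"
proof -
  have c3: "corner (Suc (Suc (Suc 0))) = corner 0" by (simp add: corner_simps)
  show "bary 0 (side_point 0 u) = 1 - u" "bary (Suc 0) (side_point 0 u) = u" "bary (Suc (Suc 0)) (side_point 0 u) = 0"
  "bary 0 (side_point (Suc 0) u) = 0" "bary (Suc 0) (side_point (Suc 0) u) = 1 - u" "bary (Suc (Suc 0)) (side_point (Suc 0) u) = u"
  "bary 0 (side_point (Suc (Suc 0)) u) = u" "bary (Suc 0) (side_point (Suc (Suc 0)) u) = 0" "bary (Suc (Suc 0)) (side_point (Suc (Suc 0)) u) = 1 - u"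
    by (simp_all add: side_point_def linepath_def bary_affine bary_corner c3)
qed

lemma less_3_cases: "s < 3 \<Longrightarrow> s = 0 \<or> s = Suc 0 \<or> s = Suc (Suc 0)"
  by linarith

lemma side_eq: "side s = side_point s ` {0..1}"
  unfolding side_def side_point_def closed_segment_def linepath_def by auto

lemma side_point_in_model:
  assumes "s < 3" "0 \<le> u" "u \<le> 1" shows "side_point s u \<in> model_triangle"
  using less_3_cases[OF assms(1)] assms(2,3) by (auto simp: model_triangle_eq bary_side_point)

lemma open_side_eq:
  assumes "s < 3" shows "open_side s = side_point s ` {0<..<1}"
proof -
  have "corner s \<noteq> corner (Suc s)"
    using less_3_cases[OF assms] by (auto simp: corner_simps complex_eq_iff)
  then show ?thesis
    unfolding open_side_def side_point_def
    by (auto simp: in_segment linepath_def image_iff) (metis greaterThanLessThan_iff)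
qed

lemma corner_side_point: "corner s = side_point s 0" "corner (Suc s) = side_point s 1"
  by (simp_all add: side_point_def linepath_def)

text \<open>\<open>br j\<close> is the boundary parameter at which piece \<open>j\<close> starts. A
  piece does not extend beyond the polygon side that contains its start. The last two assumptions
  say that \<open>\<tau> j\<close> is the image of piece \<open>j\<close> under the gluing: as the
  direction is reversed, its start corresponds to the end of piece \<open>j\<close> and its end to
  the start.\<close>

locale cone_triangulation = glued_polygon g X q
  for g :: nat and X :: "'a topology" and q :: "complex \<Rightarrow> 'a" +
  fixes n :: nat and br :: "nat \<Rightarrow> real" and \<tau> :: "nat \<Rightarrow> nat"
  assumes n: "3 \<le> n" and br_0: "br 0 = 0" and br_n: "br n = real (4 * g)"
    and br_less: "\<And>j. j < n \<Longrightarrow> br j < br (Suc j)"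
    and br_side: "\<And>j. j < n \<Longrightarrow> br (Suc j) \<le> real (nat \<lfloor>br j\<rfloor>) + 1"
    and tau_less: "\<And>j. j < n \<Longrightarrow> \<tau> j < n"
    and br_tau: "\<And>j. j < n \<Longrightarrow> br (\<tau> j) = real (mate (nat \<lfloor>br j\<rfloor>)) + 1 - (br (Suc j) - real (nat \<lfloor>br j\<rfloor>))"
    and br_Suc_tau: "\<And>j. j < n \<Longrightarrow> br (Suc (\<tau> j)) = real (mate (nat \<lfloor>br j\<rfloor>)) + 1 - (br j - real (nat \<lfloor>br j\<rfloor>))"
begin

definition e :: "nat \<Rightarrow> nat" where "e j = nat \<lfloor>br j\<rfloor>"
definition B :: "nat \<Rightarrow> complex" where "B j = bd g (br j)"
text \<open>Corner 2 goes to the centre of the polygon, corners 0 and 1 to the ends of piece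
  \<open>j\<close>. Hence side 0 is the outer side, and sides 1 and 2 are the spokes
  \<open>j + 1\<close> and \<open>j\<close>.\<close>

definition pt :: "nat \<Rightarrow> complex \<Rightarrow> complex" where
  "pt j z = of_real (bary 0 z) * B j + of_real (bary (Suc 0) z) * B (Suc j)"
definition tri :: "nat \<Rightarrow> complex \<Rightarrow> 'a" where "tri j z = q (pt j z)"
definition T :: "nat \<Rightarrow> real \<Rightarrow> real" where "T j u = br j + (br (Suc j) - br j) * u"
definition M :: "'a set" where "M = q ` insert 0 (B ` {..<n})"
definition triangles :: "(complex \<Rightarrow> 'a) set" where "triangles = tri ` {..<n}"

lemma br_mono: "i < j \<Longrightarrow> j \<le> n \<Longrightarrow> br i < br j"
proof (induction j)
  case (Suc j)
  then show ?case using br_less[of j] by (cases "i = j") auto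
qed simp

lemma br_mono_le: "i \<le> j \<Longrightarrow> j \<le> n \<Longrightarrow> br i \<le> br j"
  using br_mono[of i j] by (cases "i = j") auto

lemma br_range: "j < n \<Longrightarrow> 0 \<le> br j" "j < n \<Longrightarrow> br j < real (4 * g)"
  using br_mono_le[of 0 j] br_mono[of j n] br_0 br_n by auto

lemma br_inject: "i < n \<Longrightarrow> j < n \<Longrightarrow> br i = br j \<longleftrightarrow> i = j"
  using br_mono[of i j] br_mono[of j i] by (metis less_imp_le linorder_neqE_nat order_less_irrefl)

lemma e_props:
  assumes "j < n"
  shows "real (e j) \<le> br j" "br j < real (e j) + 1" "br (Suc j) \<le> real (e j) + 1" "e j < 4 * g"
proof -
  have "0 \<le> br j" "br j < real (4 * g)" using br_range assms by auto
  then show "real (e j) \<le> br j" "br j < real (e j) + 1" "e j < 4 * g" unfolding e_def by linarith+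
  show "br (Suc j) \<le> real (e j) + 1" using br_side[OF assms] by (simp add: e_def)
qed

lemma interval_unique:
  assumes "i < n" "j < n" "br i < t" "t < br (Suc i)" "br j < t" "t < br (Suc j)"
  shows "i = j"
proof (rule ccontr)
  assume "i \<noteq> j"
  then have "Suc i \<le> j \<or> Suc j \<le> i" by linarith
  then show False
    using br_mono_le[of "Suc i" j] br_mono_le[of "Suc j" i] assms by auto
qed

lemma interval_no_break:
  assumes "i \<le> n" "j < n" shows "\<not> (br j < br i \<and> br i < br (Suc j))"
proof -
  have "i \<le> j \<or> Suc j \<le> i" by linarith
  then show ?thesis using br_mono_le[of i j] br_mono_le[of "Suc j" i] assms by auto
qed

lemma interval_exists:
  assumes "0 \<le> t" "t < real (4 * g)" obtains j where "j < n" "br j \<le> t" "t < br (Suc j)"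
proof -
  have "\<exists>j<m. br j \<le> t \<and> t < br (Suc j)" if "t < br m" "m \<le> n" for m
    using that
  proof (induction m)
    case (Suc m)
    then show ?case by (cases "t < br m") (auto simp: less_Suc_eq)
  qed (use assms br_0 in simp)
  from this[of n] show ?thesis using assms br_n that by auto
qed

lemma T_bounds:
  assumes "j < n" "0 < u" "u < 1" shows "br j < T j u" "T j u < br (Suc j)"
proof -
  have "0 < br (Suc j) - br j" using br_less[OF assms(1)] by simp
  then have "0 < (br (Suc j) - br j) * u" "(br (Suc j) - br j) * u < (br (Suc j) - br j) * 1"
    using assms by (intro mult_pos_pos mult_strict_left_mono; simp)+
  then show "br j < T j u" "T j u < br (Suc j)" unfolding T_def by auto
qed

lemma T_range:
  assumes "j < n" "0 < u" "u < 1" shows "0 < T j u" "T j u < real (4 * g)"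
  using T_bounds[OF assms] br_range[OF assms(1)] br_mono_le[of "Suc j" n] assms(1) br_n by auto

lemma T_inject: "j < n \<Longrightarrow> T j u = T j v \<Longrightarrow> u = v"
  using br_less[of j] by (simp add: T_def)

lemma bd_T:
  assumes "j < n" "0 \<le> u" "u \<le> 1"
  shows "bd g (T j u) = of_real (1 - u) * B j + of_real u * B (Suc j)"
proof -
  let ?a = "polygon_vertex g (e j)" let ?b = "polygon_vertex g (Suc (e j))"
  define s s' where "s = br j - real (e j)" and "s' = br (Suc j) - real (e j)"
  have s: "0 \<le> s" "s \<le> 1" "0 \<le> s'" "s' \<le> 1"
    using e_props[OF assms(1)] br_less[OF assms(1)] unfolding s_def s'_def by auto
  have B: "B j = linepath ?a ?b s" "B (Suc j) = linepath ?a ?b s'"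
    using bd_add[OF s(1,2), of g "e j"] bd_add[OF s(3,4), of g "e j"] by (simp_all add: B_def s_def s'_def)
  have w: "0 \<le> (1 - u) * s + u * s'" "(1 - u) * s + u * s' \<le> 1"
    using s assms by (auto intro: convex_bound_le)
  have "T j u = real (e j) + ((1 - u) * s + u * s')"
    unfolding T_def s_def s'_def by (simp add: algebra_simps)
  then have "bd g (T j u) = linepath ?a ?b ((1 - u) * s + u * s')"
    using bd_add[OF w, of g "e j"] by simp
  also have "\<dots> = of_real (1 - u) * B j + of_real u * B (Suc j)"
    unfolding B linepath_def scaleR_conv_of_real by (simp add: algebra_simps)
  finally show ?thesis .
qed

lemma B_Suc: "j < n \<Longrightarrow> B (Suc j) = B (cyc_succ n j)"
  using bd_periodic[OF g, of 0] br_n br_0 by (auto simp: cyc_succ_def B_def)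

text \<open>Polar form is what \<open>polar_unique\<close> compares: the radius is the total weight
  of the two outer corners, and the boundary parameter depends only on the ratio of these weights.
  The centre, with total weight 0, is excluded.\<close>

lemma pt_polar:
  assumes "j < n" "0 \<le> bary 0 z" "0 \<le> bary (Suc 0) z" "0 < bary 0 z + bary (Suc 0) z"
  shows "pt j z = of_real (bary 0 z + bary (Suc 0) z) * bd g (T j (bary (Suc 0) z / (bary 0 z + bary (Suc 0) z)))"
proof -
  define r where "r = bary 0 z + bary (Suc 0) z"
  define u where "u = bary (Suc 0) z / r"
  have r: "0 < r" using assms r_def by simp
  have u: "0 \<le> u" "u \<le> 1" using assms r unfolding u_def by (auto simp: r_def)
  have "r * u = bary (Suc 0) z" using r by (simp add: u_def)
  moreover have "r * (1 - u) = bary 0 z" using r by (simp add: u_def right_diff_distrib) (simp add: r_def)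
  ultimately have "of_real r * bd g (T j u) = pt j z"
    unfolding bd_T[OF assms(1) u] pt_def by (metis (no_types, lifting) distrib_left mult.assoc of_real_mult)
  then show ?thesis by (simp add: r_def u_def)
qed

lemma pt_interior:
  assumes "j < n" "z \<in> interior model_triangle"
  shows "0 < bary 0 z + bary (Suc 0) z" "bary 0 z + bary (Suc 0) z < 1"
    "0 < bary (Suc 0) z / (bary 0 z + bary (Suc 0) z)" "bary (Suc 0) z / (bary 0 z + bary (Suc 0) z) < 1"
    "pt j z = of_real (bary 0 z + bary (Suc 0) z) * bd g (T j (bary (Suc 0) z / (bary 0 z + bary (Suc 0) z)))"
    "pt j z \<in> interior (polygon g)"
proof -
  have b: "0 < bary 0 z" "0 < bary (Suc 0) z" "0 < bary (Suc (Suc 0)) z"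
    using assms(2) by (auto simp: interior_model_triangle)
  then show *: "0 < bary 0 z + bary (Suc 0) z" "bary 0 z + bary (Suc 0) z < 1"
    "0 < bary (Suc 0) z / (bary 0 z + bary (Suc 0) z)" "bary (Suc 0) z / (bary 0 z + bary (Suc 0) z) < 1"
    using bary_sum[of z] by auto
  show p: "pt j z = of_real (bary 0 z + bary (Suc 0) z) * bd g (T j (bary (Suc 0) z / (bary 0 z + bary (Suc 0) z)))"
    using b by (intro pt_polar assms) auto
  show "pt j z \<in> interior (polygon g)"
    unfolding p using * T_range[OF assms(1) *(3,4)] by (subst scaled_bd_in_interior_iff[OF g]) auto
qed

lemma pt_interior_inject:
  assumes "i < n" "z \<in> interior model_triangle" "j < n" "w \<in> interior model_triangle" "pt i z = pt j w"
  shows "i = j \<and> z = w"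
proof -
  note z = pt_interior[OF assms(1,2)] and w = pt_interior[OF assms(3,4)]
  define r u where "r = bary 0 z + bary (Suc 0) z" and "u = bary (Suc 0) z / r"
  define r' u' where "r' = bary 0 w + bary (Suc 0) w" and "u' = bary (Suc 0) w / r'"
  note z = z[folded r_def, folded u_def] and w = w[folded r'_def, folded u'_def]
  have "of_real r * bd g (T i u) = of_real r' * bd g (T j u')" using z(5) w(5) assms(5) by simp
  then have "r = r' \<and> T i u = T j u'"
    using T_range[OF assms(1) z(3,4)] T_range[OF assms(3) w(3,4)]
    by (intro polar_unique[OF g z(1) w(1)]) auto
  moreover from this have "i = j"
    using interval_unique[OF assms(1,3), of "T i u"] T_bounds[OF assms(1) z(3,4)] T_bounds[OF assms(3) w(3,4)] by simp
  ultimately have ru: "r = r'" "u = u'" "i = j" using T_inject[OF assms(3)] by auto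
  have "bary (Suc 0) z = r * u" "bary (Suc 0) w = r' * u'" using z(1) w(1) by (simp_all add: u_def u'_def)
  then have "bary (Suc 0) z = bary (Suc 0) w" using ru by simp
  moreover have "bary 0 z = bary 0 w" using calculation ru(1) by (simp add: r_def r'_def)
  ultimately show ?thesis using bary_inject ru(3) by blast
qed

lemma pt_side:
  assumes "j < n" "0 \<le> u" "u \<le> 1"
  shows "pt j (side_point 0 u) = bd g (T j u)"
    "pt j (side_point (Suc 0) u) = of_real (1 - u) * B (cyc_succ n j)"
    "pt j (side_point (Suc (Suc 0)) u) = of_real u * B j"
  by (simp_all add: pt_def bary_side_point bd_T[OF assms] B_Suc[OF assms(1)])

lemma spoke_interior:
  assumes "i < n" "0 \<le> r" "r < 1" shows "of_real r * B i \<in> interior (polygon g)"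
  unfolding B_def using assms br_range[OF assms(1)] by (subst scaled_bd_in_interior_iff[OF g]) auto

lemma T_form:
  assumes "j < n" "0 < u" "u < 1"
  shows "\<exists>w. 0 < w \<and> w < 1 \<and> T j u = real (e j) + w"
  using T_bounds[OF assms] e_props[OF assms(1)]
  by (intro exI[of _ "T j u - real (e j)"]) auto

lemma bd_T_not_interior: "j < n \<Longrightarrow> 0 < u \<Longrightarrow> u < 1 \<Longrightarrow> bd g (T j u) \<notin> interior (polygon g)"
  using bd_not_interior T_range by (simp add: less_imp_le)

lemma glued_T:
  assumes "j < n" "0 < u" "u < 1" "glued g (bd g (T j u)) y"
  shows "y = bd g (T (\<tau> j) (1 - u))" "T (\<tau> j) (1 - u) = real (mate (e j)) + (1 - (T j u - real (e j)))"
proof -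
  obtain w where w: "0 < w" "w < 1" "T j u = real (e j) + w" using T_form[OF assms(1-3)] by blast
  obtain k v where k: "k < 4 * g" "0 < v" "v < 1" "bd g (T j u) = bd g (real k + v)"
    "y = bd g (real (mate k) + (1 - v))"
    using assms(4) unfolding glued_def by blast
  then have kv: "k = e j" "v = w"
    using bd_inject[OF g, of "e j" k w v] w e_props[OF assms(1)] by auto
  show *: "T (\<tau> j) (1 - u) = real (mate (e j)) + (1 - (T j u - real (e j)))"
    unfolding T_def br_tau[OF assms(1)] br_Suc_tau[OF assms(1)] e_def by (simp add: algebra_simps)
  show "y = bd g (T (\<tau> j) (1 - u))" unfolding * k(5) kv w(3) by simp
qed

lemma glued_bd_T:
  assumes "j < n" "0 < u" "u < 1" shows "glued g (bd g (T j u)) (bd g (T (\<tau> j) (1 - u)))"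
proof -
  obtain w where w: "0 < w" "w < 1" "T j u = real (e j) + w" using T_form[OF assms(1-3)] by blast
  have G: "glued g (bd g (T j u)) (bd g (real (mate (e j)) + (1 - w)))"
    unfolding glued_def w(3) using w(1,2) e_props(4)[OF assms(1)]
    by (intro exI[of _ "e j"] exI[of _ w]) simp
  show ?thesis using G unfolding glued_T(1)[OF assms G] .
qed

lemma br_tau_e:
  assumes "j < n" shows "br (\<tau> j) = real (mate (e j)) + 1 - (br (Suc j) - real (e j))"
    "br (Suc (\<tau> j)) = real (mate (e j)) + 1 - (br j - real (e j))"
  using br_tau[OF assms] br_Suc_tau[OF assms] by (simp_all add: e_def)

lemma e_tau: "j < n \<Longrightarrow> e (\<tau> j) = mate (e j)"
proof -
  assume j: "j < n"
  have "real (mate (e j)) \<le> br (\<tau> j)" "br (\<tau> j) < real (mate (e j)) + 1"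
    using br_tau_e[OF j] e_props[OF j] br_less[OF j] by auto
  then show ?thesis unfolding e_def[of "\<tau> j"] by linarith
qed

lemma tau_tau: assumes "j < n" shows "\<tau> (\<tau> j) = j"
proof -
  have "br (\<tau> (\<tau> j)) = br j"
    using br_tau_e[OF tau_less[OF assms]] br_tau_e[OF assms] e_tau[OF assms] by (simp add: mate_mate)
  then show ?thesis using br_inject tau_less assms by blast
qed

lemma tau_neq: "j < n \<Longrightarrow> \<tau> j \<noteq> j"
  using e_tau mate_neq by metis

text \<open>Neighbouring pieces lie on the same side of the polygon or on neighbouring ones, and
  glued sides are two apart. Where the numbering closes up, the mate of side
  \<open>4 * g - 1\<close> is side \<open>4 * g - 3\<close> and not side 0.\<close>

lemma tau_neq_succ: assumes "j < n" shows "\<tau> j \<noteq> cyc_succ n j"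
proof
  assume eq: "\<tau> j = cyc_succ n j"
  have e: "e (cyc_succ n j) = mate (e j)" using e_tau[OF assms] eq by simp
  show False
  proof (cases "Suc j = n")
    case True
    then have "e (cyc_succ n j) = 0" by (simp add: cyc_succ_def e_def br_0)
    moreover have "br (Suc j) = real (4 * g)" using True br_n by simp
    then have "real (4 * g) \<le> real (e j) + 1" using e_props(3)[OF assms] by simp
    then have "Suc (e j) = 4 * g" using e_props(4)[OF assms] by linarith
    then have "e j mod 4 = 3" "3 \<le> e j" using g by presburger+
    then have "mate (e j) \<noteq> 0" unfolding mate_def by simp
    ultimately show False using e by simp
  next
    case False
    then have s: "cyc_succ n j = Suc j" "Suc j < n" using assms by (auto simp: cyc_succ_def)
    have "real (e j) < br (Suc j)" "br (Suc j) < real (e (Suc j)) + 1" "real (e (Suc j)) \<le> br (Suc j)"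
      using e_props[OF assms] e_props[OF s(2)] br_less[OF assms] by auto
    then have "e (Suc j) = e j \<or> e (Suc j) = Suc (e j)" using e_props(3)[OF assms] by linarith
    then show False using e s by (cases "e j" rule: mate_cases) auto
  qed
qed

lemma cyc_succ_less: "j < n \<Longrightarrow> cyc_succ n j < n"
  by (auto simp: cyc_succ_def)

lemma pt_spoke:
  assumes "j < n" "s < 3" "s \<noteq> 0" "0 < u" "u < 1"
  shows "\<exists>k r. k < n \<and> 0 < r \<and> r < 1 \<and> pt j (side_point s u) = of_real r * B k \<and>
      (s = Suc 0 \<and> k = cyc_succ n j \<and> r = 1 - u \<or> s = Suc (Suc 0) \<and> k = j \<and> r = u)"
proof -
  consider "s = Suc 0" | "s = Suc (Suc 0)" using less_3_cases[OF assms(2)] assms(3) by blast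
  then show ?thesis
  proof cases
    case 1
    then show ?thesis
      using pt_side(2)[OF assms(1), of u] assms cyc_succ_less[OF assms(1)]
      by (intro exI[of _ "cyc_succ n j"] exI[of _ "1 - u"]) simp
  next
    case 2
    then show ?thesis
      using pt_side(3)[OF assms(1), of u] assms by (intro exI[of _ j] exI[of _ u]) simp
  qed
qed

lemma pt_in_polygon:
  assumes "j < n" "z \<in> model_triangle" shows "pt j z \<in> polygon g"
proof -
  have b: "0 \<le> bary 0 z" "0 \<le> bary (Suc 0) z" "0 \<le> bary (Suc (Suc 0)) z"
    using assms(2) by (auto simp: model_triangle_eq)
  define r where "r = bary 0 z + bary (Suc 0) z"
  show ?thesis
  proof (cases "r = 0")
    case True
    then have "bary 0 z = 0" "bary (Suc 0) z = 0" using b by (auto simp: r_def)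
    then show ?thesis using zero_in_polygon[OF g] by (simp add: pt_def)
  next
    case False
    then have r: "0 < r" "r \<le> 1" using b bary_sum[of z] by (auto simp: r_def)
    define y where "y = bd g (T j (bary (Suc 0) z / r))"
    have "pt j z = (1 - r) *\<^sub>R 0 + r *\<^sub>R y"
      using pt_polar[OF assms(1) b(1,2)] r(1) by (simp add: r_def y_def scaleR_conv_of_real)
    also have "\<dots> \<in> polygon g"
      unfolding y_def using r by (intro convexD_alt[OF convex_polygon zero_in_polygon[OF g] bd_in_polygon[OF g]]) auto
    finally show ?thesis .
  qed
qed

text \<open>A point of an open spoke is interior in the polygon and so identified with no other
  point; a point of an open outer side is on the boundary and not a vertex, hence has exactly one
  partner. Comparing polar coordinates then leaves only the intended coincidences.\<close>

lemma side_overlap: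
  assumes "i < n" "j < n" "s < 3" "t < 3" "0 < u" "u < 1" "0 < v" "v < 1"
    and eq: "tri i (side_point s u) = tri j (side_point t v)"
  shows "i = j \<and> s = t \<and> u = v \<or> s = 0 \<and> t = 0 \<and> j = \<tau> i
    \<or> s = Suc 0 \<and> t = Suc (Suc 0) \<and> j = cyc_succ n i \<or> s = Suc (Suc 0) \<and> t = Suc 0 \<and> i = cyc_succ n j"
proof -
  have P: "pt a (side_point m x) \<in> polygon g" if "a < n" "m < 3" "0 < x" "x < 1" for a m x
    using pt_in_polygon side_point_in_model that by simp
  have q: "q (pt i (side_point s u)) = q (pt j (side_point t v))" using eq by (simp add: tri_def)
  consider "s = 0" "t = 0" | "s = 0" "t \<noteq> 0" | "s \<noteq> 0" "t = 0" | "s \<noteq> 0" "t \<noteq> 0" by blast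
  then show ?thesis
  proof cases
    case 1
    have p: "pt i (side_point s u) = bd g (T i u)" "pt j (side_point t v) = bd g (T j v)"
      using 1 pt_side(1) assms by auto
    have "side_rel g (bd g (T i u)) (bd g (T j v))"
      using q_eq_side_rel bd_in_polygon[OF g] q unfolding p by blast
    moreover have "bd g (T i u) \<notin> range (polygon_vertex g)"
      using T_form[OF assms(1,5,6)] bd_not_vertex[OF g] e_props(4)[OF assms(1)] by metis
    ultimately consider "bd g (T i u) = bd g (T j v)" | "glued g (bd g (T i u)) (bd g (T j v))"
      unfolding side_rel_def by blast
    then show ?thesis
    proof cases
      case A: 1
      have "T i u = T j v"
        using polar_unique[OF g, of 1 1 "T i u" "T j v"] T_range[OF assms(1,5,6)] T_range[OF assms(2,7,8)] A by simp
      moreover from this have "i = j"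
        using interval_unique[OF assms(1,2), of "T i u"] T_bounds[OF assms(1,5,6)] T_bounds[OF assms(2,7,8)] by simp
      ultimately show ?thesis using T_inject[OF assms(2)] 1 by auto
    next
      case A: 2
      have u': "0 < 1 - u" "1 - u < 1" using assms(5,6) by auto
      have "bd g (T j v) = bd g (T (\<tau> i) (1 - u))" using glued_T[OF assms(1,5,6) A] by simp
      then have "T j v = T (\<tau> i) (1 - u)"
        using polar_unique[OF g, of 1 1 "T j v" "T (\<tau> i) (1 - u)"] T_range[OF tau_less[OF assms(1)] u'] T_range[OF assms(2,7,8)] by simp
      then have "j = \<tau> i"
        using interval_unique[OF assms(2) tau_less[OF assms(1)], of "T j v"]
          T_bounds[OF tau_less[OF assms(1)] u'] T_bounds[OF assms(2,7,8)] by simp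
      then show ?thesis using 1 by simp
    qed
  next
    case 2
    obtain k r where "k < n" "0 < r" "r < 1" "pt j (side_point t v) = of_real r * B k"
      using pt_spoke[OF assms(2,4) 2(2) assms(7,8)] by blast
    then have "pt j (side_point t v) \<in> interior (polygon g)" using spoke_interior by simp
    then have "pt j (side_point t v) = pt i (side_point s u)"
      using q_interior_eq P[OF assms(1,3,5,6)] q by metis
    then show ?thesis
      using \<open>pt j (side_point t v) \<in> interior (polygon g)\<close> bd_T_not_interior[OF assms(1,5,6)] pt_side(1)[OF assms(1), of u] 2 assms by simp
  next
    case 3
    obtain k r where "k < n" "0 < r" "r < 1" "pt i (side_point s u) = of_real r * B k"
      using pt_spoke[OF assms(1,3) 3(1) assms(5,6)] by blast
    then have "pt i (side_point s u) \<in> interior (polygon g)" using spoke_interior by simp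
    then have "pt i (side_point s u) = pt j (side_point t v)"
      using q_interior_eq P[OF assms(2,4,7,8)] q by metis
    then show ?thesis
      using \<open>pt i (side_point s u) \<in> interior (polygon g)\<close> bd_T_not_interior[OF assms(2,7,8)] pt_side(1)[OF assms(2), of v] 3 assms by simp
  next
    case 4
    obtain k r where k: "k < n" "0 < r" "r < 1" "pt i (side_point s u) = of_real r * B k"
      "s = Suc 0 \<and> k = cyc_succ n i \<and> r = 1 - u \<or> s = Suc (Suc 0) \<and> k = i \<and> r = u"
      using pt_spoke[OF assms(1,3) 4(1) assms(5,6)] by blast
    obtain l r' where l: "l < n" "0 < r'" "r' < 1" "pt j (side_point t v) = of_real r' * B l"
      "t = Suc 0 \<and> l = cyc_succ n j \<and> r' = 1 - v \<or> t = Suc (Suc 0) \<and> l = j \<and> r' = v"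
      using pt_spoke[OF assms(2,4) 4(2) assms(7,8)] by blast
    have "pt i (side_point s u) \<in> interior (polygon g)" using k spoke_interior by simp
    then have "of_real r * B k = of_real r' * B l"
      using q_interior_eq P[OF assms(2,4,7,8)] q k(4) l(4) by metis
    then have "r = r' \<and> br k = br l"
      unfolding B_def using polar_unique[OF g k(2) l(2)] br_range k(1) l(1) by blast
    then have kl: "r = r'" "k = l" using br_inject k(1) l(1) by auto
    have "cyc_succ n i = cyc_succ n j \<Longrightarrow> i = j"
      using assms(1,2) by (auto simp: cyc_succ_def split: if_splits)
    then show ?thesis using k(5) l(5) kl by auto
  qed
qed

text \<open>The start of piece \<open>j\<close> is either a vertex of the polygon, and all of these
  have one image, or lies inside a side, where it is glued to the end of the partner piece.\<close>

lemma q_B_tau: assumes "j < n" shows "q (B (Suc (\<tau> j))) = q (B j)"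
proof -
  define s where "s = br j - real (e j)"
  have s: "0 \<le> s" "s < 1" "br j = real (e j) + s" using e_props[OF assms] by (auto simp: s_def)
  have t: "br (Suc (\<tau> j)) = real (mate (e j)) + (1 - s)" using br_tau_e(2)[OF assms] s by simp
  show ?thesis
  proof (cases "s = 0")
    case True
    have "B j = polygon_vertex g (e j)" "B (Suc (\<tau> j)) = polygon_vertex g (Suc (mate (e j)))"
      using s t True bd_nat[of g "e j"] bd_nat[of g "Suc (mate (e j))"] by (simp_all add: B_def add.commute)
    then show ?thesis using q_vertices by simp
  next
    case False
    have "glued g (B j) (B (Suc (\<tau> j)))"
      unfolding glued_def B_def t s(3) using s False e_props(4)[OF assms]
      by (intro exI[of _ "e j"] exI[of _ s]) simp
    then show ?thesis using q_glued by simp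
  qed
qed

lemma outer_sides_agree:
  assumes "j < n" "0 \<le> u" "u \<le> 1"
  shows "tri j (side_point 0 u) = tri (\<tau> j) (side_point 0 (1 - u))"
proof -
  have p: "tri j (side_point 0 u) = q (bd g (T j u))" "tri (\<tau> j) (side_point 0 (1 - u)) = q (bd g (T (\<tau> j) (1 - u)))"
    using pt_side(1) assms tau_less by (simp_all add: tri_def)
  consider "u = 0" | "u = 1" | "0 < u" "u < 1" using assms by linarith
  then show ?thesis
  proof cases
    case 1
    then show ?thesis unfolding p using q_B_tau[OF assms(1)] by (simp add: T_def B_def)
  next
    case 2
    then show ?thesis unfolding p using q_B_tau[OF tau_less[OF assms(1)]] tau_tau[OF assms(1)] by (simp add: T_def B_def)
  next
    case 3
    then show ?thesis unfolding p using q_glued[OF glued_bd_T[OF assms(1)]] by simp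
  qed
qed

lemma spokes_agree:
  assumes "j < n" "0 \<le> u" "u \<le> 1"
  shows "tri j (side_point (Suc 0) u) = tri (cyc_succ n j) (side_point (Suc (Suc 0)) (1 - u))"
  using pt_side(2)[OF assms] pt_side(3)[OF cyc_succ_less[OF assms(1)], of "1 - u"] assms by (simp add: tri_def)

lemma B_not_interior: "i < n \<Longrightarrow> B i \<notin> interior (polygon g)"
  unfolding B_def using bd_not_interior br_range by simp

lemma B_in_polygon: "B i \<in> polygon g"
  unfolding B_def by (rule bd_in_polygon[OF g])

lemma interior_not_M:
  assumes "x \<in> interior (polygon g)" "x \<noteq> 0" shows "q x \<notin> M"
proof
  assume "q x \<in> M"
  then obtain y where y: "y = 0 \<or> (\<exists>i<n. y = B i)" "q x = q y" by (auto simp: M_def)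
  then have "y \<in> polygon g" using zero_in_polygon[OF g] B_in_polygon by auto
  then have "x = y" using q_interior_eq assms(1) y(2) by blast
  then show False using y(1) assms B_not_interior by auto
qed

lemma bd_nonzero: "0 \<le> t \<Longrightarrow> t < real (4 * g) \<Longrightarrow> bd g t \<noteq> 0"
  using bd_not_interior zero_in_interior_polygon[OF g] by metis

lemma tri_interior_not_M:
  assumes "j < n" "z \<in> interior model_triangle" shows "tri j z \<notin> M"
proof -
  note z = pt_interior[OF assms]
  have "pt j z \<noteq> 0"
    unfolding z(5) mult_eq_0_iff of_real_eq_0_iff
    using z(1) bd_nonzero[OF less_imp_le[OF T_range(1)[OF assms(1) z(3,4)]] T_range(2)[OF assms(1) z(3,4)]] by simp
  then show ?thesis unfolding tri_def using interior_not_M z(6) by blast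
qed

lemma tri_side_not_M:
  assumes "j < n" "s < 3" "0 < u" "u < 1" shows "tri j (side_point s u) \<notin> M"
proof (cases "s = 0")
  case True
  have p: "tri j (side_point s u) = q (bd g (T j u))" using pt_side(1)[OF assms(1)] assms True by (simp add: tri_def)
  have no: "bd g (T k v) \<noteq> B i" if "k < n" "0 < v" "v < 1" "i < n" for k v i
  proof
    assume "bd g (T k v) = B i"
    then have "T k v = br i"
      using polar_unique[OF g, of 1 1 "T k v" "br i"] T_range[OF that(1-3)] br_range[OF that(4)] by (simp add: B_def)
    then show False using interval_no_break[of i k] T_bounds[OF that(1-3)] that by simp
  qed
  show ?thesis
  proof
    assume "tri j (side_point s u) \<in> M"
    then consider "q (bd g (T j u)) = q 0" | i where "i < n" "q (bd g (T j u)) = q (B i)"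
      unfolding p M_def by auto
    then show False
    proof cases
      case 1
      then have "0 = bd g (T j u)"
        using q_interior_eq[OF zero_in_interior_polygon[OF g] bd_in_polygon[OF g]] by metis
      then show False using bd_nonzero T_range[OF assms(1,3,4)] by (metis less_imp_le)
    next
      case 2
      have "side_rel g (bd g (T j u)) (B i)"
        using q_eq_side_rel[OF bd_in_polygon[OF g] B_in_polygon 2(2)] .
      moreover have "bd g (T j u) \<notin> range (polygon_vertex g)"
        using T_form[OF assms(1,3,4)] bd_not_vertex[OF g] e_props(4)[OF assms(1)] by metis
      ultimately have "glued g (bd g (T j u)) (B i)"
        using no[OF assms(1,3,4) 2(1)] unfolding side_rel_def by blast
      then have "B i = bd g (T (\<tau> j) (1 - u))" by (rule glued_T(1)[OF assms(1,3,4)])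
      then show False using no[OF tau_less[OF assms(1)] _ _ 2(1), of "1 - u"] assms(3,4) by simp
    qed
  qed
next
  case False
  obtain k r where k: "k < n" "0 < r" "r < 1" "pt j (side_point s u) = of_real r * B k"
    using pt_spoke[OF assms(1,2) False assms(3,4)] by blast
  have "of_real r * B k \<noteq> 0" using k bd_nonzero br_range[OF k(1)] by (simp add: B_def)
  then show ?thesis
    unfolding tri_def k(4) using interior_not_M spoke_interior k by simp
qed

lemma tri_interior_side_disjoint:
  assumes "i < n" "z \<in> interior model_triangle" "j < n" "s < 3" "0 < u" "u < 1"
  shows "tri i z \<noteq> tri j (side_point s u)"
proof
  assume "tri i z = tri j (side_point s u)"
  note z = pt_interior[OF assms(1,2)]
  have eq: "pt i z = pt j (side_point s u)"
    using q_interior_eq[OF z(6) pt_in_polygon[OF assms(3) side_point_in_model]] \<open>tri i z = _\<close> assms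
    by (simp add: tri_def)
  show False
  proof (cases "s = 0")
    case True
    then show False using eq z(6) bd_T_not_interior[OF assms(3,5,6)] pt_side(1)[OF assms(3), of u] assms by simp
  next
    case False
    obtain k r where k: "k < n" "0 < r" "r < 1" "pt j (side_point s u) = of_real r * B k"
      using pt_spoke[OF assms(3,4) False assms(5,6)] by blast
    define t where "t = T i (bary (Suc 0) z / (bary 0 z + bary (Suc 0) z))"
    have t: "br i < t" "t < br (Suc i)" "0 < t" "t < real (4 * g)"
      using T_bounds[OF assms(1) z(3,4)] T_range[OF assms(1) z(3,4)] by (auto simp: t_def)
    have "of_real (bary 0 z + bary (Suc 0) z) * bd g t = of_real r * bd g (br k)"
      using eq z(5) k(4) by (simp add: B_def t_def)
    then have "t = br k"
      using polar_unique[OF g z(1) k(2), of t "br k"] t br_range[OF k(1)] by auto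
    then show False using t interval_no_break[of k i] k(1) assms(1) by simp
  qed
qed

lemma tri_interior_inject:
  assumes "i < n" "z \<in> interior model_triangle" "j < n" "w \<in> interior model_triangle" "tri i z = tri j w"
  shows "i = j \<and> z = w"
proof -
  have "pt j w \<in> polygon g" using pt_interior(6)[OF assms(3,4)] interior_subset by blast
  then have "pt i z = pt j w"
    using q_interior_eq[OF pt_interior(6)[OF assms(1,2)]] assms(5) by (simp add: tri_def)
  then show ?thesis using pt_interior_inject assms by blast
qed

lemma zero_interior_model: "0 \<in> interior model_triangle"
  by (simp add: interior_model_triangle bary_def)

lemma inj_on_tri: "inj_on tri {..<n}"
proof (rule inj_onI)
  fix i j assume "i \<in> {..<n}" "j \<in> {..<n}" "tri i = tri j"
  then show "i = j" using tri_interior_inject[of i 0 j 0] zero_interior_model by simp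
qed

lemma tri_corner: "j < n \<Longrightarrow> s < 3 \<Longrightarrow> tri j (corner s) \<in> M"
proof -
  assume j: "j < n" and s: "s < 3"
  have "pt j (corner s) \<in> insert 0 (B ` {..<n})"
    using less_3_cases[OF s] j B_Suc[OF j] cyc_succ_less[OF j] by (auto simp: pt_def bary_corner)
  then show ?thesis by (auto simp: tri_def M_def)
qed

lemma tri_side_ends: "j < n \<Longrightarrow> s < 3 \<Longrightarrow> u = 0 \<or> u = 1 \<Longrightarrow> tri j (side_point s u) \<in> M"
proof -
  assume j: "j < n" and s: "s < 3" and u: "u = 0 \<or> u = 1"
  have "side_point s u \<in> {corner s, corner (Suc s)}" using u corner_side_point[of s] by auto
  moreover have "corner (Suc s) \<in> corner ` {..<3}"
  proof (cases "s = 2")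
    case True
    then have "corner (Suc s) = corner 0" by (simp add: corner_0 corner_3 numeral_2_eq_2)
    then show ?thesis by auto
  qed (use s in auto)
  ultimately show ?thesis using tri_corner[OF j] s by auto
qed

lemma ex_bary:
  obtains z where "bary 0 z = a" "bary (Suc 0) z = b"
proof -
  define z where "z = a *\<^sub>R corner 0 + b *\<^sub>R corner (Suc 0) + (1 - a - b) *\<^sub>R corner (Suc (Suc 0))"
  have "bary 0 z = a" "bary (Suc 0) z = b"
    by (simp_all add: z_def bary_def corner_simps inner_complex_def field_simps)
  then show ?thesis by (rule that)
qed

lemma tri_cover: "(\<Union>\<phi>\<in>triangles. \<phi> ` model_triangle) = topspace X"
proof
  show "(\<Union>\<phi>\<in>triangles. \<phi> ` model_triangle) \<subseteq> topspace X"
    unfolding triangles_def q_image[symmetric] tri_def using pt_in_polygon by auto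
  show "topspace X \<subseteq> (\<Union>\<phi>\<in>triangles. \<phi> ` model_triangle)"
  proof
    fix x assume "x \<in> topspace X"
    then obtain y where y: "y \<in> polygon g" "x = q y" unfolding q_image[symmetric] by blast
    have "\<exists>j<n. \<exists>z\<in>model_triangle. pt j z = y"
    proof (cases "y = 0")
      case True
      obtain z where z: "bary 0 z = 0" "bary (Suc 0) z = 0" by (rule ex_bary)
      have "0 < n" using n by simp
      then show ?thesis using z True bary_sum[of z]
        by (intro exI[of _ 0] conjI bexI[of _ z]) (auto simp: model_triangle_eq pt_def)
    next
      case False
      obtain r t where rt: "0 < r" "0 \<le> t" "t < real (4 * g)" "y = of_real r * bd g t"
        by (rule polar_exists[OF g False])
      have r1: "r \<le> 1" using scaled_bd_in_polygon_iff[OF g, of r t] rt y(1) by simp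
      obtain j where j: "j < n" "br j \<le> t" "t < br (Suc j)" using interval_exists[OF rt(2,3)] .
      define u where "u = (t - br j) / (br (Suc j) - br j)"
      have d: "0 < br (Suc j) - br j" using br_less[OF j(1)] by simp
      have u: "0 \<le> u" "u \<le> 1" "T j u = t" using j d by (auto simp: u_def T_def field_simps)
      obtain z where z: "bary 0 z = r * (1 - u)" "bary (Suc 0) z = r * u" by (rule ex_bary)
      have "bary (Suc (Suc 0)) z = 1 - r" using bary_sum[of z] z by (simp add: algebra_simps)
      then have "z \<in> model_triangle" using z u rt(1) r1 by (simp add: model_triangle_eq)
      moreover have "pt j z = y"
        unfolding pt_def z rt(4) u(3)[symmetric] bd_T[OF j(1) u(1,2)] by (simp add: algebra_simps)
      ultimately show ?thesis using j(1) by blast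
    qed
    then show "x \<in> (\<Union>\<phi>\<in>triangles. \<phi> ` model_triangle)"
      unfolding triangles_def y(2) tri_def by blast
  qed
qed

lemma continuous_tri: "j < n \<Longrightarrow> continuous_map (top_of_set model_triangle) X (tri j)"
proof -
  assume j: "j < n"
  have "continuous_on model_triangle (pt j)"
    unfolding pt_def by (intro continuous_intros continuous_on_bary)
  then have c: "continuous_map (top_of_set model_triangle) (top_of_set (polygon g)) (pt j)"
    using pt_in_polygon[OF j] by auto
  show ?thesis
    using continuous_map_compose[OF c quotient_imp_continuous_map[OF q]] by (simp add: tri_def[abs_def] comp_def)
qed

theorem ideal_triangulation_triangles: "ideal_triangulation X M triangles"
  unfolding ideal_triangulation_def
proof (intro conjI ballI allI impI)
  show "finite triangles" by (simp add: triangles_def)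
  show "(\<Union>\<phi>\<in>triangles. \<phi> ` model_triangle) = topspace X" by (rule tri_cover)
next
  fix \<phi> assume "\<phi> \<in> triangles"
  then obtain i where i: "i < n" "\<phi> = tri i" by (auto simp: triangles_def)
  show "continuous_map (top_of_set model_triangle) X \<phi>" using continuous_tri i by simp
  show "inj_on \<phi> (interior model_triangle)"
    using tri_interior_inject[OF i(1) _ i(1)] i(2) by (auto intro: inj_onI)
  show "\<phi> ` interior model_triangle \<inter> M = {}" using tri_interior_not_M i by auto
  fix s :: nat assume s: "s < 3"
  show "\<phi> (corner s) \<in> M" using tri_corner i s by simp
  show "\<phi> ` open_side s \<inter> M = {}" using tri_side_not_M[OF i(1) s] by (auto simp: open_side_eq[OF s] i(2))
  show "inj_on \<phi> (open_side s)"
  proof (rule inj_onI)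
    fix x y assume "x \<in> open_side s" "y \<in> open_side s" "\<phi> x = \<phi> y"
    then obtain u v where uv: "x = side_point s u" "0 < u" "u < 1" "y = side_point s v" "0 < v" "v < 1"
      by (auto simp: open_side_eq[OF s])
    then show "x = y"
      using side_overlap[OF i(1) i(1) s s uv(2,3,5,6)] \<open>\<phi> x = \<phi> y\<close> tau_neq[OF i(1)] by (auto simp: i(2))
  qed
next
  fix \<phi> \<psi> assume "\<phi> \<in> triangles" "\<psi> \<in> triangles"
  then obtain i j where ij: "i < n" "j < n" "\<phi> = tri i" "\<psi> = tri j" by (auto simp: triangles_def)
  show "\<phi> ` interior model_triangle \<inter> \<psi> ` interior model_triangle = {}" if "\<phi> \<noteq> \<psi>"
    using tri_interior_inject[OF ij(1) _ ij(2)] that ij by blast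
  fix s :: nat assume s: "s < 3"
  show "\<phi> ` interior model_triangle \<inter> \<psi> ` open_side s = {}"
    using tri_interior_side_disjoint[OF ij(1) _ ij(2) s] by (auto simp: open_side_eq[OF s] ij)
  fix t u assume t: "t < (3::nat)" and H: "(\<phi>, s) \<noteq> (\<psi>, t) \<and> \<phi> ` open_side s \<inter> \<psi> ` open_side t \<noteq> {}"
    and u: "u \<in> {0..1::real}"
  then obtain v w where vw: "0 < v" "v < 1" "0 < w" "w < 1" "tri i (side_point s v) = tri j (side_point t w)"
    by (auto simp: open_side_eq s ij)
  have "(i, s) \<noteq> (j, t)" using H ij by auto
  \<comment> \<open>The case of one and the same side is excluded, so only the three reversed
    coincidences remain, and each of them is known on the whole closed side.\<close>
  then consider "s = 0" "t = 0" "j = \<tau> i" | "s = Suc 0" "t = Suc (Suc 0)" "j = cyc_succ n i"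
    | "s = Suc (Suc 0)" "t = Suc 0" "i = cyc_succ n j"
    using side_overlap[OF ij(1,2) s t vw] by blast
  then have "tri i (side_point s u) = tri j (side_point t (1 - u))"
  proof cases
    case 1
    then show ?thesis using outer_sides_agree[OF ij(1)] u by simp
  next
    case 2
    then show ?thesis using spokes_agree[OF ij(1)] u by simp
  next
    case 3
    then show ?thesis using spokes_agree[OF ij(2), of "1 - u"] u by simp
  qed
  then show "\<phi> (linepath (corner s) (corner (Suc s)) u) = \<psi> (linepath (corner (Suc t)) (corner t) u)"
    using linepath_reverse[of "corner (Suc t)" "corner t" u] by (simp add: ij side_point_def)
qed

section \<open>Arcs of the cone and the quiver they span\<close>

definition spoke :: "nat \<Rightarrow> 'a set" where "spoke j = arc_of (tri j) (Suc (Suc 0))"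
definition outer :: "nat \<Rightarrow> 'a set" where "outer j = arc_of (tri j) 0"

lemma arc_of_tri: "arc_of (tri j) s = (\<lambda>u. tri j (side_point s u)) ` {0..1}"
  by (simp add: arc_of_def side_eq image_image)

lemma arc_1: assumes "j < n" shows "arc_of (tri j) (Suc 0) = spoke (cyc_succ n j)"
proof -
  have "(\<lambda>u. tri j (side_point (Suc 0) u)) ` {0..1} = (\<lambda>u. tri (cyc_succ n j) (side_point (Suc (Suc 0)) u)) ` (\<lambda>u. 1 - u) ` {0..1}"
    unfolding image_image using spokes_agree[OF assms] by (intro image_cong) auto
  also have "(\<lambda>u. 1 - u) ` {0..1} = {0..1::real}" by simp
  finally show ?thesis by (simp add: arc_of_tri spoke_def)
qed

text \<open>In \<open>triangle_arrows\<close> and in \<open>folded_at\<close> the index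
  \<open>Suc s\<close> reaches 3; periodicity of the corners identifies this side with side
  0.\<close>

lemma arc_3: "arc_of (tri j) (Suc (Suc (Suc 0))) = outer j"
proof -
  have "corner (Suc (Suc (Suc (Suc 0)))) = corner (Suc 0)"
    using cis_mult[of "2 * pi / 3" "2 * pi"] by (simp add: corner_def complex_eq_iff field_simps)
  moreover have "corner (Suc (Suc (Suc 0))) = corner 0" by (simp add: corner_simps)
  ultimately show ?thesis by (simp add: outer_def arc_of_def side_def)
qed

text \<open>The midpoint of an arc is not a puncture, whereas the ends of the other arc are. It
  therefore lies on the open part of that arc, where \<open>side_overlap\<close> applies.\<close>

lemma arc_eqD:
  assumes "i < n" "j < n" "s < 3" "t < 3" "arc_of (tri i) s = arc_of (tri j) t"
  shows "i = j \<and> s = t \<or> s = 0 \<and> t = 0 \<and> j = \<tau> i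
    \<or> s = Suc 0 \<and> t = Suc (Suc 0) \<and> j = cyc_succ n i \<or> s = Suc (Suc 0) \<and> t = Suc 0 \<and> i = cyc_succ n j"
proof -
  have "tri i (side_point s (1/2)) \<in> arc_of (tri i) s"
    unfolding arc_of_tri by (rule image_eqI[of _ _ "1/2"]) simp_all
  then have "tri i (side_point s (1/2)) \<in> arc_of (tri j) t" unfolding assms(5) .
  then obtain v where v: "0 \<le> v" "v \<le> 1" "tri i (side_point s (1/2)) = tri j (side_point t v)"
    unfolding arc_of_tri by auto
  have "tri i (side_point s (1/2)) \<notin> M" using tri_side_not_M[OF assms(1,3)] by simp
  then have "v \<noteq> 0" "v \<noteq> 1" using tri_side_ends[OF assms(2,4)] v(3) by auto
  then show ?thesis using side_overlap[OF assms(1-4) _ _ _ _ v(3)] v by auto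
qed

lemma outer_eq_iff: "i < n \<Longrightarrow> j < n \<Longrightarrow> outer i = outer j \<longleftrightarrow> i = j \<or> i = \<tau> j"
proof
  assume ij: "i < n" "j < n" and "outer i = outer j"
  then have "i = j \<or> j = \<tau> i" unfolding outer_def using arc_eqD[of i j 0 0] by auto
  then show "i = j \<or> i = \<tau> j" using tau_tau ij by auto
next
  assume ij: "i < n" "j < n" "i = j \<or> i = \<tau> j"
  have "outer j = outer (\<tau> j)"
  proof -
    have "(\<lambda>u. tri j (side_point 0 u)) ` {0..1} = (\<lambda>u. tri (\<tau> j) (side_point 0 u)) ` (\<lambda>u. 1 - u) ` {0..1}"
      unfolding image_image using outer_sides_agree[OF ij(2)] by (intro image_cong) auto
    also have "(\<lambda>u. 1 - u) ` {0..1} = {0..1::real}" by simp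
    finally show ?thesis by (simp add: arc_of_tri outer_def)
  qed
  then show "outer i = outer j" using ij(3) by auto
qed

lemma spoke_eq_iff: "i < n \<Longrightarrow> j < n \<Longrightarrow> spoke i = spoke j \<longleftrightarrow> i = j"
  unfolding spoke_def using arc_eqD[of i j "Suc (Suc 0)" "Suc (Suc 0)"] by auto

lemma spoke_neq_outer: "i < n \<Longrightarrow> j < n \<Longrightarrow> spoke i \<noteq> outer j"
  unfolding spoke_def outer_def using arc_eqD[of i j "Suc (Suc 0)" 0] by auto

lemma not_folded: "j < n \<Longrightarrow> s < 3 \<Longrightarrow> \<not> folded_at (tri j) s"
proof
  assume j: "j < n" and s: "s < 3" and "folded_at (tri j) s"
  then consider "outer j = spoke (cyc_succ n j)" | "spoke (cyc_succ n j) = spoke j" | "spoke j = outer j"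
    using less_3_cases[OF s] arc_1[OF j] arc_3[of j] by (auto simp: folded_at_def outer_def spoke_def)
  then show False
    using spoke_neq_outer[of j j] spoke_neq_outer[of "cyc_succ n j" j] spoke_eq_iff[of "cyc_succ n j" j]
      cyc_succ_less[OF j] j n by cases (auto simp: cyc_succ_def split: if_splits)
qed

lemma fst_label_triangles: "fst_label triangles a = a"
  unfolding fst_label_def triangles_def using not_folded by auto

lemma arcs_triangles: "arcs triangles = spoke ` {..<n} \<union> outer ` {..<n}"
proof
  show "arcs triangles \<subseteq> spoke ` {..<n} \<union> outer ` {..<n}"
  proof
    fix a assume "a \<in> arcs triangles"
    then obtain j s where js: "j < n" "s < 3" "a = arc_of (tri j) s" by (auto simp: arcs_def triangles_def)
    then show "a \<in> spoke ` {..<n} \<union> outer ` {..<n}"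
      using less_3_cases[OF js(2)] arc_1[OF js(1)] cyc_succ_less[OF js(1)] by (auto simp: spoke_def outer_def)
  qed
  show "spoke ` {..<n} \<union> outer ` {..<n} \<subseteq> arcs triangles"
    by (auto simp: arcs_def triangles_def spoke_def outer_def) (metis One_nat_def less_numeral_extra(3) numeral_3_eq_3 lessI lessThan_iff imageI zero_less_Suc)+
qed

text \<open>Triangle \<open>k\<close> contributes the oriented 3-cycle from \<open>spoke k\<close>
  to the next spoke, to \<open>outer k\<close> and back to \<open>spoke k\<close>, one arrow for
  each \<open>s\<close>. This is the orientation assumed in \<open>sweep\<close>.\<close>

lemma triangle_arrows_triangles:
  "int (triangle_arrows triangles a b) = (\<Sum>k<n. of_bool (spoke (cyc_succ n k) = a \<and> outer k = b)
     + of_bool (spoke k = a \<and> spoke (cyc_succ n k) = b) + of_bool (outer k = a \<and> spoke k = b))"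
proof -
  define P where "P k s \<longleftrightarrow> arc_of (tri k) (Suc s) = a \<and> arc_of (tri k) s = b" for k s
  have nf: "\<not> self_folded (tri k)" if "k < n" for k
    using not_folded that by (auto simp: self_folded_def)
  have "{(\<phi>, s). \<phi> \<in> triangles \<and> \<not> self_folded \<phi> \<and> s < 3 \<and>
        arc_of \<phi> (Suc s) = fst_label triangles a \<and> arc_of \<phi> s = fst_label triangles b}
      = (\<lambda>(k, s). (tri k, s)) ` (({..<n} \<times> {..<3}) \<inter> {(k, s). P k s})"
  proof (intro set_eqI iffI)
    fix x assume "x \<in> {(\<phi>, s). \<phi> \<in> triangles \<and> \<not> self_folded \<phi> \<and> s < 3 \<and>
        arc_of \<phi> (Suc s) = fst_label triangles a \<and> arc_of \<phi> s = fst_label triangles b}"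
    then obtain k s where "k < n" "s < 3" "P k s" "x = (tri k, s)"
      unfolding fst_label_triangles unfolding triangles_def P_def by auto
    then show "x \<in> (\<lambda>(k, s). (tri k, s)) ` (({..<n} \<times> {..<3}) \<inter> {(k, s). P k s})"
      by (intro image_eqI[of _ _ "(k, s)"]) auto
  next
    fix x assume "x \<in> (\<lambda>(k, s). (tri k, s)) ` (({..<n} \<times> {..<3}) \<inter> {(k, s). P k s})"
    then obtain k s where "k < n" "s < 3" "P k s" "x = (tri k, s)" by auto
    then show "x \<in> {(\<phi>, s). \<phi> \<in> triangles \<and> \<not> self_folded \<phi> \<and> s < 3 \<and>
        arc_of \<phi> (Suc s) = fst_label triangles a \<and> arc_of \<phi> s = fst_label triangles b}"
      unfolding fst_label_triangles unfolding triangles_def P_def using nf by auto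
  qed
  moreover have "inj_on (\<lambda>(k, s). (tri k, s)) (({..<n} \<times> {..<3}) \<inter> {(k, s). P k s})"
    using inj_on_tri by (auto simp: inj_on_def)
  ultimately have "int (triangle_arrows triangles a b) = int (card (({..<n} \<times> {..<3}) \<inter> {(k, s). P k s}))"
    unfolding triangle_arrows_def by (simp add: card_image)
  also have "\<dots> = (\<Sum>(k, s)\<in>{..<n} \<times> {..<3}. of_bool (P k s))"
    by (simp add: sum_of_bool_eq case_prod_unfold)
  also have "\<dots> = (\<Sum>k<n. \<Sum>s<3. of_bool (P k s))"
    by (rule sum.cartesian_product[symmetric])
  also have "\<dots> = (\<Sum>k<n. of_bool (P k 0) + of_bool (P k (Suc 0)) + of_bool (P k (Suc (Suc 0))))"
    by (simp add: numeral_3_eq_3)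
  also have "\<dots> = (\<Sum>k<n. of_bool (spoke (cyc_succ n k) = a \<and> outer k = b)
     + of_bool (spoke k = a \<and> spoke (cyc_succ n k) = b) + of_bool (outer k = a \<and> spoke k = b))"
    unfolding P_def by (intro sum.cong refl) (auto simp: arc_1 arc_3 outer_def[symmetric] spoke_def[symmetric])
  finally show ?thesis .
qed

lemma sum_of_bool_conj:
  assumes "m < (n :: nat)" shows "(\<Sum>k<n. of_bool (k = m \<and> P k)) = (of_bool (P m) :: int)"
proof -
  have "(\<Sum>k<n. of_bool (k = m \<and> P k)) = (\<Sum>k\<in>{m}. of_bool (k = m \<and> P k) :: int)"
    using assms by (intro sum.mono_neutral_right) auto
  then show ?thesis by simp
qed

text \<open>Signed counts do not see \<open>cancel_2_cycles\<close>, since cancelling removes the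
  same number in both directions.\<close>

lemma net_arrows_triangles:
  "net_arrows (triangulation_quiver triangles) a b = int (triangle_arrows triangles a b) - int (triangle_arrows triangles b a)"
proof (cases "a \<in> arcs triangles \<and> b \<in> arcs triangles")
  case True
  then show ?thesis
    by (auto simp: net_arrows_def triangulation_quiver_def cancel_2_cycles_def of_nat_diff)
next
  case False
  have V: "spoke k \<in> arcs triangles" "spoke (cyc_succ n k) \<in> arcs triangles" "outer k \<in> arcs triangles" if "k < n" for k
    using that cyc_succ_less[OF that] by (auto simp: arcs_triangles)
  have "int (triangle_arrows triangles a b) = 0" "int (triangle_arrows triangles b a) = 0"
    unfolding triangle_arrows_triangles using False V by (auto intro!: sum.neutral)
  then show ?thesis using False by (auto simp: net_arrows_def triangulation_quiver_def)
qed

lemma triangle_arrows_spoke: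
  assumes "k < n"
  shows "int (triangle_arrows triangles z (spoke k)) = of_bool (z = spoke (cyc_pred n k)) + of_bool (z = outer k)"
    and "int (triangle_arrows triangles (spoke k) z) = of_bool (z = spoke (cyc_succ n k)) + of_bool (z = outer (cyc_pred n k))"
proof -
  have p: "cyc_pred n k < n" using assms n by (auto simp: cyc_pred_def)
  have pk: "cyc_succ n j = k \<longleftrightarrow> j = cyc_pred n k" if "j < n" for j
    using assms n that by (auto simp: cyc_pred_def cyc_succ_def split: if_splits)
  have eqs: "spoke (cyc_succ n j) = spoke k \<longleftrightarrow> j = cyc_pred n k" "spoke j = spoke k \<longleftrightarrow> j = k"
    "outer j \<noteq> spoke k" if "j < n" for j
    using that assms spoke_eq_iff[of "cyc_succ n j" k] spoke_eq_iff[of j k] spoke_neq_outer[of k j]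
      cyc_succ_less[OF that] pk[OF that] by auto
  have "int (triangle_arrows triangles z (spoke k)) = (\<Sum>j<n. of_bool (j = cyc_pred n k \<and> z = spoke j)
      + of_bool (j = k \<and> z = outer j))"
    unfolding triangle_arrows_triangles
  proof (intro sum.cong refl)
    fix j assume "j \<in> {..<n}"
    then have "j < n" by simp
    note e = eqs[OF this]
    show "of_bool (spoke (cyc_succ n j) = z \<and> outer j = spoke k)
        + of_bool (spoke j = z \<and> spoke (cyc_succ n j) = spoke k) + of_bool (outer j = z \<and> spoke j = spoke k)
      = of_bool (j = cyc_pred n k \<and> z = spoke j) + (of_bool (j = k \<and> z = outer j) :: int)"
      by (simp only: e simp_thms of_bool_eq eq_commute[of z] conj_commute add_0_left add_0_right ac_simps)
  qed
  then show "int (triangle_arrows triangles z (spoke k)) = of_bool (z = spoke (cyc_pred n k)) + of_bool (z = outer k)"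
    using sum_of_bool_conj[OF p] sum_of_bool_conj[OF assms] assms by (simp add: sum.distrib)
  have "int (triangle_arrows triangles (spoke k) z) = (\<Sum>j<n. of_bool (j = cyc_pred n k \<and> z = outer j)
      + of_bool (j = k \<and> z = spoke (cyc_succ n j)))"
    unfolding triangle_arrows_triangles
  proof (intro sum.cong refl)
    fix j assume "j \<in> {..<n}"
    then have "j < n" by simp
    note e = eqs[OF this]
    show "of_bool (spoke (cyc_succ n j) = spoke k \<and> outer j = z)
        + of_bool (spoke j = spoke k \<and> spoke (cyc_succ n j) = z) + of_bool (outer j = spoke k \<and> spoke j = z)
      = of_bool (j = cyc_pred n k \<and> z = outer j) + (of_bool (j = k \<and> z = spoke (cyc_succ n j)) :: int)"
      by (simp only: e simp_thms of_bool_eq eq_commute[of z] conj_commute add_0_left add_0_right ac_simps)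
  qed
  then show "int (triangle_arrows triangles (spoke k) z) = of_bool (z = spoke (cyc_succ n k)) + of_bool (z = outer (cyc_pred n k))"
    using sum_of_bool_conj[OF p] sum_of_bool_conj[OF assms] assms by (simp add: sum.distrib)
qed

theorem ex_maximal_green_sequence_triangles: "\<exists>ks. maximal_green_sequence (triangulation_quiver triangles) ks"
proof -
  interpret C: cone n \<tau> outer
    using n tau_less tau_tau tau_neq tau_neq_succ outer_eq_iff by unfold_locales auto
  let ?Q = "triangulation_quiver triangles"
  have sp: "C.spokes spoke"
    unfolding C.spokes_def using spoke_eq_iff spoke_neq_outer by (auto simp: inj_on_def)
  have V: "verts ?Q = spoke ` {..<n} \<union> outer ` {..<n}"
    by (simp add: triangulation_quiver_def arcs_triangles)
  have "C.cone_form spoke (net_arrows ?Q)"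
    unfolding C.cone_form_def
  proof (intro conjI allI impI)
    show "skew (net_arrows ?Q)" by (rule skew_net_arrows)
    show "net_arrows ?Q (outer j) (outer k) = 0" if "j < n" "k < n" for j k
    proof -
      have "int (triangle_arrows triangles (outer a) (outer b)) = 0" if "a < n" "b < n" for a b
        unfolding triangle_arrows_triangles using that spoke_neq_outer cyc_succ_less
        by (auto intro!: sum.neutral simp: of_bool_def)
      then show ?thesis using that by (simp add: net_arrows_triangles)
    qed
    show "net_arrows ?Q z y = 0" if "z \<notin> spoke ` {..<n} \<union> outer ` {..<n}" for y z
      using that by (simp add: net_arrows_def triangulation_quiver_def arcs_triangles)
    show "net_arrows ?Q z (spoke k) = of_bool (z = spoke (cyc_pred n k)) + of_bool (z = outer k)
          - of_bool (z = spoke (cyc_succ n k)) - of_bool (z = outer (cyc_pred n k))" if "k < n" for k z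
      using triangle_arrows_spoke[OF that] by (simp add: net_arrows_triangles)
  qed
  from C.ex_green_run_to_red[OF sp this V, of "\<lambda>i f. of_bool (i = f \<and> i \<in> verts ?Q)"]
  obtain ks b c where "green_run (verts ?Q) (net_arrows ?Q) (\<lambda>i f. of_bool (i = f \<and> i \<in> verts ?Q)) ks b c"
    "\<forall>i\<in>verts ?Q. \<forall>f. c i f \<le> (0::int)" by auto
  then have "maximal_green_sequence ?Q ks"
    using is_quiver_triangulation_quiver[of triangles]
    by (intro maximal_green_sequence_if_green_run) (auto simp: triangles_def triangulation_quiver_def)
  then show ?thesis by blast
qed

end

text \<open>Side 0 of the polygon, and side 2 which is glued to it, are divided into \<open>L\<close> pieces.\<close>

definition brk :: "nat \<Rightarrow> nat \<Rightarrow> real" where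
  "brk L j = (if j \<le> L then real j / real L
     else if j \<le> 2 * L + 1 then 2 + (real j - real L - 1) / real L
     else real j - 2 * real L + 2)"

text \<open>Pieces \<open>0, ..., L - 1\<close> divide side 0, piece \<open>L\<close> is side 1,
  pieces \<open>L + 1, ..., 2 * L\<close> divide side 2 and piece \<open>2 * L + 1\<close> is side
  3. The gluing of sides 0 and 2 reverses the order, hence \<open>2 * L - j\<close>. From then on,
  piece \<open>j\<close> is side \<open>j - 2 * L + 2\<close>.\<close>

definition brk_mate :: "nat \<Rightarrow> nat \<Rightarrow> nat" where
  "brk_mate L j = (if j = L then 2 * L + 1 else if j \<le> 2 * L then 2 * L - j
     else if j = 2 * L + 1 then L else 2 * L - 2 + mate (j - 2 * L + 2))"

lemma brk_simps:
  assumes "1 \<le> L"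
  shows "j \<le> L \<Longrightarrow> brk L j = real j / real L"
    and "L < j \<Longrightarrow> j \<le> 2 * L + 1 \<Longrightarrow> brk L j = 2 + (real j - real L - 1) / real L"
    and "2 * L + 1 \<le> j \<Longrightarrow> brk L j = real (j - 2 * L + 2)"
  using assms by (auto simp: brk_def of_nat_diff)

lemma nat_floor_brk:
  assumes "1 \<le> L"
  shows "nat \<lfloor>brk L j\<rfloor> = (if j < L then 0 else if j = L then 1 else if j \<le> 2 * L then 2 else j - 2 * L + 2)"
proof -
  have floor: "nat \<lfloor>x\<rfloor> = k" if "real k \<le> x" "x < real k + 1" for x k
    using that by linarith
  consider "j < L" | "j = L" | "L < j" "j \<le> 2 * L" | "2 * L < j" by linarith
  then show ?thesis
  proof cases
    case 3
    have "nat \<lfloor>brk L j\<rfloor> = 2"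
      by (rule floor) (use 3 assms in \<open>auto simp: brk_simps(2) field_simps\<close>)
    then show ?thesis using 3 by simp
  next
    case 1
    have "nat \<lfloor>brk L j\<rfloor> = 0"
      by (rule floor) (use 1 assms in \<open>auto simp: brk_simps(1) field_simps\<close>)
    then show ?thesis using 1 by simp
  next
    case 2
    then show ?thesis using assms by (simp add: brk_simps(1))
  next
    case 4
    have "nat \<lfloor>brk L j\<rfloor> = j - 2 * L + 2"
      by (rule floor) (use 4 assms in \<open>auto simp: brk_simps(3)\<close>)
    then show ?thesis using 4 assms by simp
  qed
qed

lemma cone_triangulation_brk:
  assumes "glued_polygon g X q" "2 \<le> g" "1 \<le> L"
  shows "cone_triangulation g X q (4 * g + 2 * L - 2) (brk L) (brk_mate L)"
proof -
  interpret glued_polygon g X q by (fact assms(1))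
  let ?n = "4 * g + 2 * L - 2"
  note L = assms(3) and s = brk_simps[OF assms(3)]
  have m0: "mate 0 = 2" "mate 1 = 3" "mate 2 = 0" "mate 3 = 1" by (simp_all add: mate_def)
  have cases: "j < L \<or> j = L \<or> L < j \<and> j \<le> 2 * L \<or> j = 2 * L + 1 \<or> 2 * L + 2 \<le> j" for j by linarith
  \<comment> \<open>Mates stay within a block of four sides, so a side from 4 on is glued to another
    such side. None of these is divided, and the last branch of \<open>brk\<close> applies to the
    mate as well.\<close>
  have mate4: "4 \<le> mate (j - 2 * L + 2)" if "2 * L + 2 \<le> j" for j
  proof (cases "j - 2 * L + 2" rule: mate_cases)
    case (2 m)
    have "2 \<le> m" using 2(1) that by linarith
    moreover have "m \<noteq> 2" "m \<noteq> 3" using 2(3) by auto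
    ultimately show ?thesis using 2(2) by simp
  qed (use that in linarith)
  show ?thesis
  proof
    show "3 \<le> ?n" using assms by simp
    show "brk L 0 = 0" by (simp add: brk_def)
    show "brk L ?n = real (4 * g)" using assms by (simp add: s(3))
    show "brk L j < brk L (Suc j)" if "j < ?n" for j
    proof -
      have "j < L \<or> j = L \<or> L < j \<and> j \<le> 2 * L \<or> 2 * L + 1 \<le> j" using cases[of j] by linarith
      then show ?thesis
      proof (elim disjE)
        assume "j < L" then show ?thesis using L by (simp add: s(1) divide_strict_right_mono)
      next
        assume "j = L" then show ?thesis using L by (simp add: s(1,2))
      next
        assume "L < j \<and> j \<le> 2 * L" then show ?thesis using L by (simp add: s(2) divide_strict_right_mono)
      next
        assume "2 * L + 1 \<le> j" then show ?thesis using L by (simp add: s(3))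
      qed
    qed
    show "brk L (Suc j) \<le> real (nat \<lfloor>brk L j\<rfloor>) + 1" if "j < ?n" for j
      using cases[of j]
    proof (elim disjE)
      assume "j < L" then show ?thesis using L unfolding nat_floor_brk[OF L] by (simp add: s(1) field_simps)
    next
      assume "j = L" then show ?thesis using L unfolding nat_floor_brk[OF L] by (simp add: s(2))
    next
      assume "L < j \<and> j \<le> 2 * L" then show ?thesis using L unfolding nat_floor_brk[OF L] by (simp add: s(2) field_simps)
    next
      assume "j = 2 * L + 1" then show ?thesis using L unfolding nat_floor_brk[OF L] by (simp add: s(3))
    next
      assume "2 * L + 2 \<le> j" then show ?thesis using L unfolding nat_floor_brk[OF L] by (simp add: s(3))
    qed
    show "brk_mate L j < ?n" if "j < ?n" for j
      using cases[of j]
    proof (elim disjE)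
      assume j: "2 * L + 2 \<le> j"
      have "j - 2 * L + 2 < 4 * g" using that j assms by linarith
      then have "mate (j - 2 * L + 2) < 4 * g" by (rule mate_less)
      then show ?thesis using j L by (simp add: brk_mate_def)
    qed (use assms in \<open>auto simp: brk_mate_def\<close>)
    have pairing: "brk L (brk_mate L j) = real (mate (nat \<lfloor>brk L j\<rfloor>)) + 1 - (brk L (Suc j) - real (nat \<lfloor>brk L j\<rfloor>))
      \<and> brk L (Suc (brk_mate L j)) = real (mate (nat \<lfloor>brk L j\<rfloor>)) + 1 - (brk L j - real (nat \<lfloor>brk L j\<rfloor>))" for j
      using cases[of j]
    proof (elim disjE)
      assume j: "j < L"
      then have "brk_mate L j = 2 * L - j" "L < 2 * L - j" "Suc (2 * L - j) \<le> 2 * L + 1" by (auto simp: brk_mate_def)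
      then show ?thesis using j L unfolding nat_floor_brk[OF L] by (simp add: s m0 of_nat_diff field_simps)
    next
      assume j: "j = L"
      then have "brk_mate L j = 2 * L + 1" by (simp add: brk_mate_def)
      then show ?thesis using j L unfolding nat_floor_brk[OF L] by (simp add: s m0[unfolded One_nat_def])
    next
      assume j: "L < j \<and> j \<le> 2 * L"
      then have "brk_mate L j = 2 * L - j" "Suc (2 * L - j) \<le> L" by (auto simp: brk_mate_def)
      then show ?thesis using j L unfolding nat_floor_brk[OF L] by (simp add: s m0 of_nat_diff field_simps)
    next
      assume j: "j = 2 * L + 1"
      then have "brk_mate L j = L" by (simp add: brk_mate_def)
      then show ?thesis using j L unfolding nat_floor_brk[OF L] by (simp add: s m0 numeral_3_eq_3[symmetric])
    next
      assume j: "2 * L + 2 \<le> j"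
      then have "brk_mate L j = 2 * L - 2 + mate (j - 2 * L + 2)" "2 * L + 1 \<le> brk_mate L j"
        using L mate4[OF j] by (auto simp: brk_mate_def)
      then show ?thesis using j L mate4[OF j] unfolding nat_floor_brk[OF L] by (simp add: s(3) of_nat_diff)
    qed
    show "brk L (brk_mate L j) = real (mate (nat \<lfloor>brk L j\<rfloor>)) + 1 - (brk L (Suc j) - real (nat \<lfloor>brk L j\<rfloor>))"
      and "brk L (Suc (brk_mate L j)) = real (mate (nat \<lfloor>brk L j\<rfloor>)) + 1 - (brk L j - real (nat \<lfloor>brk L j\<rfloor>))"
      if "j < ?n" for j
      using pairing by blast+
  qed
qed

text \<open>The division points of side 2 are glued to those of side 0, and all vertices have one
  image. This leaves \<open>L - 1\<close> division points, the vertex and the centre, all distinct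
  in \<open>X\<close>.\<close>

lemma card_brk_punctures:
  assumes "glued_polygon g X q" "2 \<le> g" "1 \<le> L"
  shows "card (q ` insert 0 ((\<lambda>j. bd g (brk L j)) ` {..<4 * g + 2 * L - 2})) = L + 1"
proof -
  interpret C: cone_triangulation g X q "4 * g + 2 * L - 2" "brk L" "brk_mate L"
    by (rule cone_triangulation_brk[OF assms])
  let ?n = "4 * g + 2 * L - 2"
  note L = assms(3) and s = brk_simps[OF assms(3)]
  define v where "v = q (polygon_vertex g 0)"
  define f where "f i = q (bd g (real i / real L))" for i
  have B: "C.B j = bd g (brk L j)" for j by (simp add: C.B_def)
  have vert: "q (bd g (real k)) = v" for k
    unfolding bd_nat v_def by (rule C.q_vertices)
  have fB: "q (C.B i) = f i" if "i \<le> L" for i using s(1)[OF that] by (simp add: B f_def)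
  have f_ends: "f 0 = v" "f L = v" using vert[of 0] vert[of 1] L by (simp_all add: f_def)
  have qB: "q (C.B j) \<in> insert v (f ` {1..<L})" if j: "j < ?n" for j
  proof -
    have small: "q (C.B i) \<in> insert v (f ` {1..<L})" if "i \<le> L" for i
    proof (cases "i = 0 \<or> i = L")
      case True
      then show ?thesis using fB[OF that] f_ends by auto
    next
      case False
      then show ?thesis using fB[OF that] that by auto
    qed
    consider "j \<le> L" | "L < j" "j \<le> 2 * L" | "2 * L + 1 \<le> j" by linarith
    then show ?thesis
    proof cases
      case 1
      then show ?thesis by (rule small)
    next
      case 2
      then have "q (C.B j) = q (C.B (Suc (2 * L - j)))"
        using C.q_B_tau[OF j] by (simp add: brk_mate_def)
      then show ?thesis using small[of "Suc (2 * L - j)"] 2 by simp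
    next
      case 3
      show ?thesis unfolding B s(3)[OF 3] vert by simp
    qed
  qed
  have "q ` insert 0 ((\<lambda>j. bd g (brk L j)) ` {..<?n}) = insert (q 0) (insert v (f ` {1..<L}))"
  proof (intro equalityI subsetI)
    fix x assume "x \<in> q ` insert 0 ((\<lambda>j. bd g (brk L j)) ` {..<?n})"
    then show "x \<in> insert (q 0) (insert v (f ` {1..<L}))" using qB unfolding B by auto
  next
    fix x assume "x \<in> insert (q 0) (insert v (f ` {1..<L}))"
    then consider "x = q 0" | i where "x = q (C.B i)" "i < L"
      using fB f_ends L by (auto simp: Suc_le_eq)
    then show "x \<in> q ` insert 0 ((\<lambda>j. bd g (brk L j)) ` {..<?n})"
    proof cases
      case (2 i)
      have "i < ?n" using 2(2) assms by simp
      then show ?thesis using 2(1) unfolding B by blast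
    qed simp
  qed
  moreover have pos: "bd g (real i / real L) \<notin> range (polygon_vertex g)"
    "bd g (real i / real L) = bd g (real 0 + real i / real L)" "0 < real i / real L" "real i / real L < 1"
    if "i \<in> {1..<L}" for i
    using that bd_not_vertex[OF C.g, of 0 "real i / real L"] assms by (auto simp: field_simps)
  have q0: "q 0 \<noteq> q (bd g t)" if "0 \<le> t" "t < real (4 * g)" for t
    using C.q_interior_eq[OF zero_in_interior_polygon[OF C.g] bd_in_polygon[OF C.g, of t]] C.bd_nonzero[OF that] by metis
  have "q 0 \<noteq> v" using q0[of 0] vert[of 0] assms by simp
  moreover have "q 0 \<notin> f ` {1..<L}"
  proof
    assume "q 0 \<in> f ` {1..<L}"
    then obtain i where i: "i \<in> {1..<L}" "q 0 = f i" by blast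
    have "real i / real L < real (4 * g)" using pos(4)[OF i(1)] assms(2) by linarith
    then show False using q0[of "real i / real L"] i(2) by (simp add: f_def)
  qed
  moreover have "v \<notin> f ` {1..<L}"
  proof
    assume "v \<in> f ` {1..<L}"
    then obtain i where i: "i \<in> {1..<L}" "q (polygon_vertex g 0) = q (bd g (real i / real L))"
      unfolding v_def f_def by blast
    have "side_rel g (polygon_vertex g 0) (bd g (real i / real L))"
      by (rule C.q_eq_side_rel[OF vertex_in_polygon[OF C.g] bd_in_polygon[OF C.g] i(2)])
    then show False
      using pos(1)[OF i(1)] glued_not_vertex[OF C.g] unfolding side_rel_def by (metis rangeI)
  qed
  moreover have "inj_on f {1..<L}"
  proof (rule inj_onI)
    fix i j assume ij: "i \<in> {1..<L}" "j \<in> {1..<L}" "f i = f j"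
    note i = pos[OF ij(1)] and j = pos[OF ij(2)]
    have "side_rel g (bd g (real i / real L)) (bd g (real j / real L))"
      using C.q_eq_side_rel[OF bd_in_polygon[OF C.g] bd_in_polygon[OF C.g]] ij(3) unfolding f_def .
    \<comment> \<open>Gluing two points of side 0 to each other would make side 0 its own
      mate.\<close>
    moreover have "\<not> glued g (bd g (real i / real L)) (bd g (real j / real L))"
    proof
      assume "glued g (bd g (real i / real L)) (bd g (real j / real L))"
      then obtain k u where k: "k < 4 * g" "0 < u" "u < 1" "bd g (real i / real L) = bd g (real k + u)"
        "bd g (real j / real L) = bd g (real (mate k) + (1 - u))" unfolding glued_def by blast
      have "k = 0" using bd_inject[OF C.g, of 0 k "real i / real L" u] k i(3,4) assms(2) by simp
      moreover have "mate k = 0"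
        using bd_inject[OF C.g, of 0 "mate k" "real j / real L" "1 - u"] k j(3,4) mate_less[OF k(1)] assms(2) by simp
      ultimately show False using mate_neq by metis
    qed
    ultimately have "bd g (real i / real L) = bd g (real j / real L)"
      using i(1) unfolding side_rel_def by blast
    then have "real i / real L = real j / real L"
      using bd_inject[OF C.g, of 0 0 "real i / real L" "real j / real L"] i(3,4) j(3,4) assms(2) by simp
    then show "i = j" using L by simp
  qed
  ultimately show ?thesis using L by (simp add: card_image)
qed

theorem theorem1p1:
  fixes X :: "'a topology" and M :: "'a set" and g p :: nat
  assumes "closed_orientable_surface_of_genus g X"
    and "g \<ge> 2"
    and "M \<subseteq> topspace X" and "finite M" and "card M = p"
    and "p \<ge> 3"
  shows "\<exists>T. ideal_triangulation X M T \<and>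
           (\<exists>ks. maximal_green_sequence (triangulation_quiver T) ks)"
proof -
  obtain q where "closed_surface X" "quotient_map (top_of_set (polygon g)) X q"
    "\<forall>x \<in> polygon g. \<forall>y \<in> polygon g. q x = q y \<longleftrightarrow> equivclp (edge_glue g) x y"
    using assms(1) unfolding closed_orientable_surface_of_genus_def by blast
  then have q: "glued_polygon g X q" using assms(2) by unfold_locales auto
  \<comment> \<open>\<open>p - 2\<close> division points cut a side into \<open>p - 1\<close>
    pieces; with the vertex and the centre they make \<open>p\<close> punctures.\<close>
  let ?L = "p - 1"
  let ?A = "insert 0 ((\<lambda>j. bd g (brk ?L j)) ` {..<4 * g + 2 * ?L - 2})"
  have L: "1 \<le> ?L" using assms(6) by simp
  have g: "1 \<le> g" using assms(2) by simp
  have A: "?A \<subseteq> polygon g" using zero_in_polygon[OF g] bd_in_polygon[OF g] by auto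
  have "card (q ` ?A) = card M" using card_brk_punctures[OF q assms(2) L] assms(5,6) by simp
  then obtain q' where q': "glued_polygon g X q'" "q' ` ?A = M"
    using glued_polygon.ex_repositioned[OF q assms(4,3) _ A] by auto
  interpret C: cone_triangulation g X q' "4 * g + 2 * ?L - 2" "brk ?L" "brk_mate ?L"
    by (rule cone_triangulation_brk[OF q'(1) assms(2) L])
  have "C.M = M" unfolding C.M_def C.B_def[abs_def] by (fact q'(2))
  then show ?thesis
    using C.ideal_triangulation_triangles C.ex_maximal_green_sequence_triangles by auto
qed

end
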